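(* Let $M>0$, $C>0$, $A=\mathbb Q^+$, let $(\mu_\alpha:\alpha\in\mathbb Q^+)$ be strictly positive with $\sum_{\alpha\in\mathbb Q^+}\sqrt{\mu_\alpha}<\infty$, and put $\varepsilon_{n,\alpha}=n^{-\alpha/(2\alpha+1)}$. For each $n,\alpha$ let $f_1,\dots,f_{N_{n,\alpha}}$ be functions in $C^\alpha[0,1]$ with $\|f_i\|_\alpha\le M$ such that every $f$ with $\|f\|_\alpha\le M$ is within uniform distance $\varepsilon_{n,\alpha}$ of some $f_i$, where $\log N_{n,\alpha}\lesssim(M/\varepsilon_{n,\alpha})^{1/\alpha}$; let $\theta_i\in\mathbb R^{J_{n,\alpha}}$ be such that $\|\theta_i^TB_{J_{n,\alpha}}-f_i\|_\infty\lesssim(1/J_{n,\alpha})^\alpha$; and let $\bar\Pi_{n,\alpha}$ be the uniform probability distribution on $\{\theta_1,\dots,\theta_{N_{n,\alpha}}\}$ and $\Pi_{n,\alpha}$ the distribution of $p_{J_{n,\alpha},\theta}$ for $\theta\sim\bar\Pi_{n,\alpha}$ (constants in $\lesssim$ do not depend on $n$). Let the model weights be $$\lambda_{n,\alpha}=\frac{\mu_\alpha\exp[-Cn\varepsilon_{n,\alpha}^2]}{\sum_{\alpha'}\mu_{\alpha'}\exp[-Cn\varepsilon_{n,\alpha'}^2]} .$$ If $p_0\in C^\beta[0,1]$ for some $\beta\in A$ and $\|\log p_0\|_\beta<M$, then there exists a constant $B$ such that, as $n\to\infty$, $$P_0^n\,\Pi_n\big(p:h(p,p_0)\ge B\vare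psilon_{n,\beta}\,\big|\,X_1,\dots,X_n\big)\to0,\qquad\varepsilon_{n,\beta}=n^{-\beta/(2\beta+1)}.$$
   Context: $X_1,\dots,X_n$ are i.i.d. from a probability measure $P_0$ on $[0,1]$ with Lebesgue density $p_0$; $P_0^nT$ is the expectation of $T(X_1,\dots,X_n)$ under $P_0^n$; $h(p,q)=\|\sqrt p-\sqrt q\|_2$ is the Hellinger distance ($L_2[0,1]$-norm); $\|\cdot\|_\infty$ is the supremum norm. $\|f\|_\alpha$ is a norm for the Hölder space $C^\alpha[0,1]$, e.g. $\|f\|_\alpha=\|f\|_\infty+\sup_{x\ne y}|f^{(\underline\alpha)}(x)-f^{(\underline\alpha)}(y)|/|x-y|^{\alpha-\underline\alpha}$ with $\underline\alpha$ the largest integer strictly smaller than $\alpha$. Log spline models. For order $q\in\mathbb N$ and resolution $K\in\mathbb N$, the splines of order $q$ are the continuous functions $f:[0,1]\to\mathbb R$ that are $q-2$ times differentiable on $[0,1)$ and restrict to a polynomial of degree $<q$ on each interval $[(k-1)/K,k/K)$, $k=1,\dots,K$ (for $q=1$: piecewise constant functions). They form a vector space of dimension $J=q+K-1$ with B-spline basis $B_{J,1},\dots,B_{J,J}$ (de Boor): $B_{J,j}\ge0$, $\sum_jB_{J,j}\equiv1$, each $B_{J,j}$ is supported on an interval of length $q/K$, and at most $q$ of them are nonzero at any given point. For $\theta\in\mathbb R^J$ put $\theta^TB_J=\sum_j\theta_jB_{J,j}$ and $$p_{J,\theta}(x)=e^{\theta^TB_J(x)-c_J(\theta)},\qquad e^{c_J(\theta)}=\int_0^1e^{\theta^TB_J(x)}dx.$$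 For each $\alpha$ the model uses splines of an order $q_\alpha\ge\alpha$ (not depending on $n$) and dimension $J_{n,\alpha}=\lfloor n^{1/(2\alpha+1)}\rfloor$. For given $n$ only indices in $A_n=\{\alpha\in A:J_{n,\alpha}\ge q_\alpha\}$, for which such a spline space exists, are used. The posterior is $$\Pi_n(S|X_1,\dots,X_n)=\frac{\sum_{\alpha\in A_n}\lambda_{n,\alpha}\int_S\prod_{i=1}^np(X_i)\,d\Pi_{n,\alpha}(p)}{\sum_{\alpha\in A_n}\lambda_{n,\alpha}\int\prod_{i=1}^np(X_i)\,d\Pi_{n,\alpha}(p)}$$ (which does not depend on the normalization of the weights). Functions $f_i$ and vectors $\theta_i$ as required exist by the entropy bound for Hölder balls and the approximation property of splines. *)

theory Defs
  imports "HOL-Probability.Probability"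
begin

text \<open>
  Functions on \<open>[0,1]\<close> are represented by functions of type \<open>real \<Rightarrow> real\<close>; every notion below
  inspects their values on \<open>{0..1}\<close> only.
\<close>

section \<open>Hoelder spaces\<close>

definition sup_norm :: "(real \<Rightarrow> real) \<Rightarrow> real" where
  "sup_norm f = (SUP x\<in>{0..1}. \<bar>f x\<bar>)"

text \<open>Iterated derivative on \<open>[0,1]\<close>, one-sided at the end points.\<close>

definition nth_deriv01 :: "nat \<Rightarrow> (real \<Rightarrow> real) \<Rightarrow> real \<Rightarrow> real" where
  "nth_deriv01 k = (\<lambda>g x. vector_derivative g (at x within {0..1})) ^^ k"

text \<open>The largest integer strictly smaller than \<open>\<alpha>\<close>, for \<open>\<alpha> > 0\<close>.\<close>

definition lower_int :: "real \<Rightarrow> nat" where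
  "lower_int \<alpha> = nat (\<lceil>\<alpha>\<rceil> - 1)"

definition hoelder_quotients :: "real \<Rightarrow> (real \<Rightarrow> real) \<Rightarrow> real set" where
  "hoelder_quotients \<alpha> f =
     {\<bar>nth_deriv01 (lower_int \<alpha>) f x - nth_deriv01 (lower_int \<alpha>) f y\<bar>
        / \<bar>x - y\<bar> powr (\<alpha> - real (lower_int \<alpha>)) | x y. x \<in> {0..1} \<and> y \<in> {0..1} \<and> x \<noteq> y}"

definition hoelder_space :: "real \<Rightarrow> (real \<Rightarrow> real) set" where
  "hoelder_space \<alpha> =
     {f. (\<forall>k<lower_int \<alpha>. nth_deriv01 k f differentiable_on {0..1}) \<and>
         bdd_above (hoelder_quotients \<alpha> f)}"

text \<open>Only meaningful on \<^term>\<open>hoelder_space \<alpha>\<close>, where both suprema are finite.\<close>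

definition hoelder_norm :: "real \<Rightarrow> (real \<Rightarrow> real) \<Rightarrow> real" where
  "hoelder_norm \<alpha> f = sup_norm f + Sup (hoelder_quotients \<alpha> f)"

section \<open>B-splines and log spline densities\<close>

text \<open>
  The Cox--de Boor recursion for the \<open>i\<close>-th B-spline of order \<open>k\<close> (degree \<open>k - 1\<close>) over a knot
  sequence \<open>t\<close>; the usual convention \<open>0/0 = 0\<close> at coinciding knots is division by zero in HOL.
  The last nonempty knot interval is closed at \<open>1\<close>, so that the basis functions sum to one on all
  of \<open>[0,1]\<close> and are continuous there when the order is at least 2.
\<close>

fun bspline :: "(nat \<Rightarrow> real) \<Rightarrow> nat \<Rightarrow> nat \<Rightarrow> real \<Rightarrow> real" where
  "bspline t 0 i x = 0"
| "bspline t (Suc 0) i x =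
     (if t i \<le> x \<and> x < t (Suc i) \<or> x = 1 \<and> t i < 1 \<and> t (Suc i) = 1 then 1 else 0)"
| "bspline t (Suc (Suc k)) i x =
     (x - t i) / (t (i + Suc k) - t i) * bspline t (Suc k) i x +
     (t (i + Suc (Suc k)) - x) / (t (Suc i + Suc k) - t (Suc i)) * bspline t (Suc k) (Suc i) x"

text \<open>
  Knots for order \<open>q\<close> and resolution \<open>K\<close>, indexed from 1: \<open>q\<close> knots at 0, the interior knots
  \<open>1/K, \<dots>, (K-1)/K\<close>, and then only knots at 1.
\<close>

definition spline_knots :: "nat \<Rightarrow> nat \<Rightarrow> nat \<Rightarrow> real" where
  "spline_knots q K i = min 1 (max 0 ((real i - real q) / real K))"

text \<open>
  The basis function \<open>B\<^bsub>J,j\<^esub>\<close>, \<open>j = 1, \<dots>, J\<close>, of the splines of order \<open>q\<close>. The dimension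
  \<open>J = q + K - 1\<close> determines the resolution \<open>K\<close>; meaningful for \<open>1 \<le> q \<le> J\<close>.
\<close>

definition spline_basis :: "nat \<Rightarrow> nat \<Rightarrow> nat \<Rightarrow> real \<Rightarrow> real" where
  "spline_basis q J j = bspline (spline_knots q (J + 1 - q)) q j"

definition spline_comb :: "nat \<Rightarrow> nat \<Rightarrow> (nat \<Rightarrow> real) \<Rightarrow> real \<Rightarrow> real" where
  "spline_comb q J \<theta> x = (\<Sum>j=1..J. \<theta> j * spline_basis q J j x)"

definition log_normalizer :: "nat \<Rightarrow> nat \<Rightarrow> (nat \<Rightarrow> real) \<Rightarrow> real" where
  "log_normalizer q J \<theta> = ln (LBINT x:{0..1}. exp (spline_comb q J \<theta> x))"

definition log_spline_density :: "nat \<Rightarrow> nat \<Rightarrow> (nat \<Rightarrow> real) \<Rightarrow> real \<Rightarrow> real" where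
  "log_spline_density q J \<theta> x = exp (spline_comb q J \<theta> x - log_normalizer q J \<theta>)"

section \<open>The statistical model\<close>

definition hellinger :: "(real \<Rightarrow> real) \<Rightarrow> (real \<Rightarrow> real) \<Rightarrow> real" where
  "hellinger p r = sqrt (LBINT x:{0..1}. (sqrt (p x) - sqrt (r x))\<^sup>2)"

text \<open>The measure on \<open>[0,1]\<close> with Lebesgue density \<open>p\<close>.\<close>

definition measure01 :: "(real \<Rightarrow> real) \<Rightarrow> real measure" where
  "measure01 p = density (restrict_space lborel {0..1}) (\<lambda>x. ennreal (p x))"

definition iid_sample :: "(real \<Rightarrow> real) \<Rightarrow> nat \<Rightarrow> (nat \<Rightarrow> real) measure" where
  "iid_sample p n = (\<Pi>\<^sub>M i\<in>{1..n}. measure01 p)"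

definition pos_rats :: "real set" where
  "pos_rats = {\<alpha>. \<alpha> \<in> \<rat> \<and> \<alpha> > 0}"

definition rate :: "nat \<Rightarrow> real \<Rightarrow> real" where
  "rate n \<alpha> = real n powr (- \<alpha> / (2 * \<alpha> + 1))"

definition spline_dim :: "nat \<Rightarrow> real \<Rightarrow> nat" where
  "spline_dim n \<alpha> = nat \<lfloor>real n powr (1 / (2 * \<alpha> + 1))\<rfloor>"

text \<open>The indices for which a spline space of order \<open>q \<alpha>\<close> and the prescribed dimension exists.\<close>

definition usable_indices :: "(real \<Rightarrow> nat) \<Rightarrow> nat \<Rightarrow> real set" where
  "usable_indices q n = {\<alpha> \<in> pos_rats. q \<alpha> \<le> spline_dim n \<alpha>}"

definition model_weight :: "real \<Rightarrow> (real \<Rightarrow> real) \<Rightarrow> nat \<Rightarrow> real \<Rightarrow> real" where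
  "model_weight C \<mu> n \<alpha> =
     \<mu> \<alpha> * exp (- C * real n * (rate n \<alpha>)\<^sup>2) /
     (\<Sum>\<^sub>\<infinity>\<alpha>'\<in>pos_rats. \<mu> \<alpha>' * exp (- C * real n * (rate n \<alpha>')\<^sup>2))"

text \<open>The law of the log spline density when the parameter is uniform on a finite set \<open>\<Theta>\<close>.\<close>

definition sieve_prior :: "nat \<Rightarrow> nat \<Rightarrow> (nat \<Rightarrow> real) set \<Rightarrow> (real \<Rightarrow> real) pmf" where
  "sieve_prior q J \<Theta> = map_pmf (log_spline_density q J) (pmf_of_set \<Theta>)"

text \<open>
  The sum over the (possibly infinite) index set \<open>I\<close> is formed in \<^typ>\<open>ennreal\<close>, as an integral
  with respect to counting measure, so that it needs no convergence assumption.
\<close>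

definition weighted_likelihood ::
  "real set \<Rightarrow> (real \<Rightarrow> real) \<Rightarrow> (real \<Rightarrow> (real \<Rightarrow> real) pmf) \<Rightarrow> nat \<Rightarrow> (nat \<Rightarrow> real)
     \<Rightarrow> (real \<Rightarrow> real) set \<Rightarrow> ennreal" where
  "weighted_likelihood I w Pr n X S =
     (\<integral>\<^sup>+\<alpha>. ennreal (w \<alpha>) * (\<integral>\<^sup>+p\<in>S. ennreal (\<Prod>i=1..n. p (X i)) \<partial>measure_pmf (Pr \<alpha>))
        \<partial>count_space I)"

definition posterior ::
  "real set \<Rightarrow> (real \<Rightarrow> real) \<Rightarrow> (real \<Rightarrow> (real \<Rightarrow> real) pmf) \<Rightarrow> nat \<Rightarrow> (nat \<Rightarrow> real)
     \<Rightarrow> (real \<Rightarrow> real) set \<Rightarrow> ennreal" where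
  "posterior I w Pr n X S = weighted_likelihood I w Pr n X S / weighted_likelihood I w Pr n X UNIV"

end

theory Submission
  imports Defs
begin

text \<open>
  The approximation constants may depend on \<open>\<alpha>\<close> in an uncontrolled way, so the entropies of the
  individual nets cannot be used uniformly over the models. Instead, the only property used of the
  models other than \<open>\<beta>\<close> is that the log spline densities of order \<open>q\<close> and dimension \<open>J\<close> have log
  likelihood ratios \<open>ln (p / p0)\<close> in a linear space \<open>V\<close> of dimension \<open>J + 2\<close> (spanned by the
  constants, \<open>ln p0\<close> and the B-splines), with no bound on the coefficients.

  The alternative \<open>p\<close> is tested by the sign of \<open>\<Sum>\<^sub>i \<psi> (X\<^sub>i) - \<psi> (X\<^sub>i)\<^sup>2 / 16\<close> with
  \<open>\<psi> = tanh (ln (p / p0) / 4)\<close>, whose mean under \<open>p0\<close> is at most minus a quarter of the squared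
  Hellinger distance \<open>h\<^sup>2\<close>. All alternatives in \<open>V\<close> with \<open>n h\<^sup>2 \<ge> B dim V\<close> are treated at
  once: a ghost sample and random swaps reduce the error of the first kind to a count of sign vectors
  for which some \<open>y \<in> V\<close> correlates with the signs in proportion to \<open>s = \<Sum>\<^sub>i (tanh (y\<^sub>i))\<^sup>2\<close>. Where
  \<open>\<bar>y\<^sub>i\<bar> \<le> 1\<close>, such a \<open>y\<close> is rounded to a lattice; the points with \<open>\<bar>y\<^sub>i\<bar> > 1\<close>, at most
  \<open>4 s\<close> of them, contribute through half spaces, which the Sauer--Shelah lemma counts. These points
  depend on \<open>y\<close>; this is resolved by a random set \<open>T\<close> of points, each point being included
  independently with a small probability: with a probability that is not too small \<open>T\<close> avoids them
  while the quadratic form \<open>\<Sum>\<^sub>i\<^sub>\<in>\<^sub>T (y\<^sub>i)\<^sup>2\<close> controls the values \<open>\<bar>y\<^sub>i\<bar> \<le> 1\<close> on average, in the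
  sense of its leverage scores. The set \<open>T\<close> thus serves as a label for a class of functions that can
  be treated with a common set of tame points.

  It remains to combine these tests with the weights. Models with \<open>\<epsilon>\<^sub>n\<^sub>,\<^sub>\<alpha>\<^sup>2 \<ge> H \<epsilon>\<^sub>n\<^sub>,\<^sub>\<beta>\<^sup>2\<close> are
  negligible because of their weights; the others have dimension at most \<open>H n \<epsilon>\<^sub>n\<^sub>,\<^sub>\<beta>\<^sup>2\<close> and are
  tested; and the evidence is bounded below by the contribution of the single element of model
  \<open>\<beta>\<close> that is closest to \<open>ln p0\<close>.
\<close>

section \<open>Leverage scores of regularized linear families\<close>

text \<open>With no bound on the coefficients, every count has to depend on the dimension alone. Two
  features of the test allow this: \<open>tanh\<close> saturates, and the subtracted square makes
  the statistic self-normalizing, so that a positive value forces a correlation with the signs at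
  the scale of \<open>s\<close>, whatever \<open>s\<close> is. The probability of a useful label is
  estimated by tilting the law of \<open>T\<close> with a determinant. Under the tilted law the
  expected total leverage is at most the dimension divided by the inclusion probability
  \<open>p\<close>, and removing the tilt costs a factor \<open>p ^ d\<close>. Avoiding the wild
  points costs a further factor \<open>exp (- (8 * p * s))\<close>. The first loss is absorbed by
  taking \<open>s\<close> at least a large multiple of \<open>d\<close>. The second is absorbed by
  taking \<open>p\<close> small against the square of the correlation level \<open>c\<close>,
  because the Rademacher tails have exponents proportional to that square times \<open>s\<close>.
  The ridge term \<open>\<eta>\<close> keeps the quadratic form definite when the features are
  dependent on the sample. No bound depends on its value, so it can be fixed last, once the finitely
  many functions that it has to accommodate are known.\<close>

definition lin :: "nat \<Rightarrow> (nat \<Rightarrow> nat \<Rightarrow> real) \<Rightarrow> (nat \<Rightarrow> real) \<Rightarrow> nat \<Rightarrow> real" where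
  "lin d \<phi> c i = (\<Sum>j<d. c j * \<phi> i j)"

locale features =
  fixes d :: nat and \<phi> :: "nat \<Rightarrow> nat \<Rightarrow> real" and \<eta> :: real
  assumes eta_pos: "\<eta> > 0"
begin

abbreviation ev :: "(nat \<Rightarrow> real) \<Rightarrow> nat \<Rightarrow> real" where
  "ev \<equiv> lin d \<phi>"

definition qf :: "nat set \<Rightarrow> (nat \<Rightarrow> real) \<Rightarrow> real" where
  "qf T c = \<eta> * (\<Sum>j<d. (c j)\<^sup>2) + (\<Sum>i\<in>T. (ev c i)\<^sup>2)"

text \<open>The rows of \<open>e\<close> hold the values of a basis that is orthonormal for \<open>qf T\<close>.\<close>

definition frame :: "nat set \<Rightarrow> (nat \<Rightarrow> nat \<Rightarrow> real) \<Rightarrow> bool" where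
  "frame T e \<longleftrightarrow>
     (\<forall>c. \<exists>b. (\<forall>i. ev c i = (\<Sum>j<d. b j * e j i)) \<and> (\<Sum>j<d. (b j)\<^sup>2) = qf T c) \<and>
     (\<forall>b. \<exists>c. (\<forall>i. ev c i = (\<Sum>j<d. b j * e j i)) \<and> (\<Sum>j<d. (b j)\<^sup>2) = qf T c)"

text \<open>The ridge leverage score: the feature vector at \<open>i\<close> measured in the inverse
  of the matrix of \<open>qf T\<close>. The supremum avoids the inverse matrix and the choice of a
  frame, so that scores for different \<open>T\<close> can be compared.\<close>

definition lev :: "nat set \<Rightarrow> nat \<Rightarrow> real" where
  "lev T i = Sup {(ev c i)\<^sup>2 | c. qf T c \<le> 1}"

lemma frame_coords:
  assumes "frame T e"
  obtains b where "\<And>i. ev c i = (\<Sum>j<d. b j * e j i)" "(\<Sum>j<d. (b j)\<^sup>2) = qf T c"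
  using assms unfolding frame_def by blast

lemma frame_vector:
  assumes "frame T e"
  obtains c where "\<And>i. ev c i = (\<Sum>j<d. b j * e j i)" "(\<Sum>j<d. (b j)\<^sup>2) = qf T c"
  using assms unfolding frame_def by blast

text \<open>Cauchy-Schwarz in frame coordinates, with equality in the direction of the column of
  \<open>e\<close> at \<open>i\<close>.\<close>

lemma lev_frame:
  assumes "frame T e"
  shows "lev T i = (\<Sum>j<d. (e j i)\<^sup>2)"
  unfolding lev_def
proof (rule cSup_eq_maximum)
  let ?S = "\<Sum>j<d. (e j i)\<^sup>2"
  \<comment> \<open>If the column vanishes, division by zero makes \<open>b\<close> the zero vector,
    which still satisfies the norm constraint.\<close>
  define b where "b = (\<lambda>j. e j i / sqrt ?S)"
  have S0: "?S \<ge> 0" by (simp add: sum_nonneg)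
  obtain c where c: "\<And>i. ev c i = (\<Sum>j<d. b j * e j i)" "(\<Sum>j<d. (b j)\<^sup>2) = qf T c"
    using frame_vector[OF assms] by blast
  have "(\<Sum>j<d. b j * e j i) = ?S / sqrt ?S"
    unfolding b_def by (simp add: sum_divide_distrib power2_eq_square)
  hence "ev c i = sqrt ?S" using c(1) S0 by (simp add: real_div_sqrt)
  hence 1: "?S = (ev c i)\<^sup>2" using S0 by simp
  have "(\<Sum>j<d. (b j)\<^sup>2) = ?S / ?S"
    unfolding b_def using S0 by (simp add: power_divide flip: sum_divide_distrib)
  moreover have "x / x \<le> 1" for x :: real by (cases "x = 0") auto
  ultimately have "qf T c \<le> 1" using c(2) by metis
  thus "?S \<in> {(ev c i)\<^sup>2 | c. qf T c \<le> 1}" using 1 by blast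
next
  fix x assume "x \<in> {(ev c i)\<^sup>2 | c. qf T c \<le> 1}"
  then obtain c where c: "x = (ev c i)\<^sup>2" "qf T c \<le> 1" by blast
  obtain b where b: "\<And>i. ev c i = (\<Sum>j<d. b j * e j i)" "(\<Sum>j<d. (b j)\<^sup>2) = qf T c"
    using frame_coords[OF assms] by blast
  have "x \<le> (\<Sum>j<d. (b j)\<^sup>2) * (\<Sum>j<d. (e j i)\<^sup>2)"
    unfolding c(1) b(1) by (rule Cauchy_Schwarz_ineq_sum)
  also have "\<dots> \<le> 1 * (\<Sum>j<d. (e j i)\<^sup>2)"
    using b(2) c(2) by (intro mult_right_mono) (auto intro: sum_nonneg)
  finally show "x \<le> (\<Sum>j<d. (e j i)\<^sup>2)" by simp
qed

lemma frame_empty: "frame {} (\<lambda>j i. \<phi> i j / sqrt \<eta>)"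
  unfolding frame_def
proof (intro conjI allI)
  fix c
  show "\<exists>b. (\<forall>i. ev c i = (\<Sum>j<d. b j * (\<phi> i j / sqrt \<eta>))) \<and> (\<Sum>j<d. (b j)\<^sup>2) = qf {} c"
    using eta_pos
    by (intro exI[of _ "\<lambda>j. sqrt \<eta> * c j"])
       (auto simp: lin_def qf_def power_mult_distrib sum_distrib_left)
next
  fix b
  show "\<exists>c. (\<forall>i. ev c i = (\<Sum>j<d. b j * (\<phi> i j / sqrt \<eta>))) \<and> (\<Sum>j<d. (b j)\<^sup>2) = qf {} c"
    using eta_pos
    by (intro exI[of _ "\<lambda>j. b j / sqrt \<eta>"])
       (auto simp: lin_def qf_def power_divide sum_distrib_left)
qed

text \<open>The Sherman--Morrison formula; the new frame comes from the symmetric square root of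
  the rank one update of the identity.\<close>

lemma frame_insert:
  assumes fr: "frame T e" and i: "i \<notin> T" and fin: "finite T"
  obtains e' where "frame (insert i T) e'"
    "\<And>k. (\<Sum>j<d. (e' j k)\<^sup>2) =
       (\<Sum>j<d. (e j k)\<^sup>2) - (\<Sum>j<d. e j i * e j k)\<^sup>2 / (1 + (\<Sum>j<d. (e j i)\<^sup>2))"
proof -
  define S where "S = (\<Sum>j<d. (e j i)\<^sup>2)"
  define r where "r = sqrt (1 + S)"
  have S0: "S \<ge> 0" unfolding S_def by (simp add: sum_nonneg)
  have r1: "r \<ge> 1" and r2: "r\<^sup>2 = 1 + S" using S0 by (auto simp: r_def)
  \<comment> \<open>With \<open>v\<close> the column of \<open>e\<close> at \<open>i\<close>, the
    matrices I - \<rho> v v' and I + \<sigma> v v' are the inverse square root and the square root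
    of I + v v'. These closed forms equal (1 - 1/r)/S and (r - 1)/S without a division by
    \<open>S\<close>, which may be 0. Below, \<open>e1\<close> and \<open>e3\<close> are the two
    squares, and \<open>e2\<close> says that the matrices are inverse to each other.\<close>
  define \<rho> where "\<rho> = 1 / (r * (1 + r))"
  define \<sigma> where "\<sigma> = 1 / (1 + r)"
  have SS: "S = r\<^sup>2 - 1" using r2 by simp
  have rr: "\<rho> * (r * (1 + r)) = 1" and sr: "\<sigma> * (1 + r) = 1"
    using r1 unfolding \<rho>_def \<sigma>_def by auto
  have "(2 * \<rho> - \<rho>\<^sup>2 * S) * r\<^sup>2 = 2 * \<rho> * r\<^sup>2 - \<rho> * (r * (1 + r)) * (\<rho> * r * (r - 1))"
    unfolding SS by (simp add: power2_eq_square algebra_simps)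
  also have "\<dots> = 2 * \<rho> * r\<^sup>2 - \<rho> * r * (r - 1)" unfolding rr by simp
  also have "\<dots> = \<rho> * (r * (1 + r))" by (simp add: power2_eq_square algebra_simps)
  also have "\<dots> = 1" by (rule rr)
  finally have e1: "2 * \<rho> - \<rho>\<^sup>2 * S = 1 / (1 + S)"
    using S0 unfolding r2 by (intro nonzero_eq_divide_eq[THEN iffD2]) simp_all
  have "\<sigma> - \<rho> - \<sigma> * \<rho> * S = \<sigma> - \<rho> - \<sigma> * (1 + r) * (\<rho> * (r - 1))"
    unfolding SS by (simp add: power2_eq_square algebra_simps)
  also have "\<dots> = \<sigma> * (\<rho> * (r * (1 + r))) - \<rho> * r"
    unfolding sr rr by (simp add: algebra_simps)
  also have "\<dots> = \<rho> * r * (\<sigma> * (1 + r) - 1)" by (simp add: algebra_simps)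
  finally have e2: "\<sigma> - \<rho> - \<sigma> * \<rho> * S = 0" unfolding sr by simp
  have "2 * \<sigma> + \<sigma>\<^sup>2 * S = 2 * \<sigma> + \<sigma> * (1 + r) * (\<sigma> * (r - 1))"
    unfolding SS by (simp add: power2_eq_square algebra_simps)
  also have "\<dots> = 2 * \<sigma> + \<sigma> * (r - 1)" unfolding sr by simp
  also have "\<dots> = \<sigma> * (1 + r)" by (simp add: algebra_simps)
  finally have e3: "2 * \<sigma> + \<sigma>\<^sup>2 * S = 1" unfolding sr .
  define w where "w = (\<lambda>k. \<Sum>m<d. e m i * e m k)"
  define e' where "e' = (\<lambda>j k. e j k - \<rho> * e j i * w k)"
  have sq: "(\<Sum>j<d. (e' j k)\<^sup>2) = (\<Sum>j<d. (e j k)\<^sup>2) - (w k)\<^sup>2 / (1 + S)" for k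
  proof -
    have "(\<Sum>j<d. (e' j k)\<^sup>2) = (\<Sum>j<d. (e j k)\<^sup>2 - 2 * \<rho> * w k * (e j i * e j k) + \<rho>\<^sup>2 * (w k)\<^sup>2 * (e j i)\<^sup>2)"
      unfolding e'_def by (intro sum.cong) (auto simp: power2_eq_square algebra_simps)
    also have "\<dots> = (\<Sum>j<d. (e j k)\<^sup>2) - 2 * \<rho> * w k * w k + \<rho>\<^sup>2 * (w k)\<^sup>2 * S"
      unfolding S_def w_def by (simp add: sum.distrib sum_subtractf sum_distrib_left)
    also have "\<dots> = (\<Sum>j<d. (e j k)\<^sup>2) - (w k)\<^sup>2 * (2 * \<rho> - \<rho>\<^sup>2 * S)"
      by (simp add: power2_eq_square algebra_simps)
    finally show ?thesis unfolding e1 by simp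
  qed
  have comb: "(\<Sum>j<d. (b j + \<sigma> * e j i * t) * e' j k) = (\<Sum>j<d. b j * e j k)"
    if t: "t = (\<Sum>j<d. b j * e j i)" for b t k
  proof -
    have "(\<Sum>j<d. (b j + \<sigma> * e j i * t) * e' j k) =
      (\<Sum>j<d. b j * e j k + \<sigma> * t * (e j i * e j k) - \<rho> * w k * (b j * e j i) - \<sigma> * t * \<rho> * w k * (e j i)\<^sup>2)"
      unfolding e'_def by (intro sum.cong) (auto simp: power2_eq_square algebra_simps)
    also have "\<dots> = (\<Sum>j<d. b j * e j k) + \<sigma> * t * w k - \<rho> * w k * t - \<sigma> * t * \<rho> * w k * S"
      unfolding S_def w_def t by (simp add: sum.distrib sum_subtractf sum_distrib_left)
    also have "\<dots> = (\<Sum>j<d. b j * e j k) + t * w k * (\<sigma> - \<rho> - \<sigma> * \<rho> * S)"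
      by (simp add: algebra_simps)
    finally show ?thesis unfolding e2 by simp
  qed
  have nrm: "(\<Sum>j<d. (b j + \<sigma> * e j i * t)\<^sup>2) = (\<Sum>j<d. (b j)\<^sup>2) + t\<^sup>2"
    if t: "t = (\<Sum>j<d. b j * e j i)" for b t
  proof -
    have "(\<Sum>j<d. (b j + \<sigma> * e j i * t)\<^sup>2) =
      (\<Sum>j<d. (b j)\<^sup>2 + 2 * \<sigma> * t * (b j * e j i) + \<sigma>\<^sup>2 * t\<^sup>2 * (e j i)\<^sup>2)"
      by (intro sum.cong) (auto simp: power2_eq_square algebra_simps)
    also have "\<dots> = (\<Sum>j<d. (b j)\<^sup>2) + 2 * \<sigma> * t * t + \<sigma>\<^sup>2 * t\<^sup>2 * S"
      unfolding S_def t by (simp add: sum.distrib sum_subtractf sum_distrib_left)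
    also have "\<dots> = (\<Sum>j<d. (b j)\<^sup>2) + t\<^sup>2 * (2 * \<sigma> + \<sigma>\<^sup>2 * S)"
      by (simp add: power2_eq_square algebra_simps)
    finally show ?thesis unfolding e3 by simp
  qed
  have q: "qf (insert i T) c = qf T c + (ev c i)\<^sup>2" for c
    using i fin by (simp add: qf_def)
  have "frame (insert i T) e'"
    unfolding frame_def
  proof (intro conjI allI)
    fix c
    obtain b where b: "\<And>k. ev c k = (\<Sum>j<d. b j * e j k)" "(\<Sum>j<d. (b j)\<^sup>2) = qf T c"
      using frame_coords[OF fr] by blast
    show "\<exists>b. (\<forall>k. ev c k = (\<Sum>j<d. b j * e' j k)) \<and> (\<Sum>j<d. (b j)\<^sup>2) = qf (insert i T) c"
      by (rule exI[of _ "\<lambda>j. b j + \<sigma> * e j i * ev c i"]) (use b in \<open>auto simp: comb nrm q\<close>)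
  next
    fix b'
    define t' where "t' = (\<Sum>j<d. b' j * e j i)"
    define b where "b = (\<lambda>j. b' j - \<rho> * e j i * t')"
    have t: "(\<Sum>j<d. b j * e j i) = t' - \<rho> * t' * S"
    proof -
      have "(\<Sum>j<d. b j * e j i) = (\<Sum>j<d. b' j * e j i - \<rho> * t' * (e j i)\<^sup>2)"
        unfolding b_def by (intro sum.cong) (auto simp: power2_eq_square algebra_simps)
      thus ?thesis unfolding t'_def S_def by (simp add: sum_subtractf sum_distrib_left)
    qed
    have bb: "b' j = b j + \<sigma> * e j i * (\<Sum>j<d. b j * e j i)" for j
    proof -
      have "b j + \<sigma> * e j i * (t' - \<rho> * t' * S) = b' j + e j i * t' * (\<sigma> - \<rho> - \<sigma> * \<rho> * S)"
        unfolding b_def by (simp add: algebra_simps)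
      thus ?thesis unfolding t e2 by simp
    qed
    obtain c where c: "\<And>k. ev c k = (\<Sum>j<d. b j * e j k)" "(\<Sum>j<d. (b j)\<^sup>2) = qf T c"
      using frame_vector[OF fr] by blast
    show "\<exists>c. (\<forall>k. ev c k = (\<Sum>j<d. b' j * e' j k)) \<and> (\<Sum>j<d. (b' j)\<^sup>2) = qf (insert i T) c"
      unfolding bb by (rule exI[of _ c]) (use c in \<open>auto simp: comb nrm q\<close>)
  qed
  thus ?thesis using sq that unfolding w_def S_def by blast
qed

lemma frame_exists: "finite T \<Longrightarrow> \<exists>e. frame T e"
proof (induction T rule: finite_induct)
  case empty thus ?case using frame_empty by blast
next
  case (insert x F) then obtain e where "frame F e" by blast
  from frame_insert[OF this] insert show ?case by blast
qed

lemma lev_nonneg: "finite T \<Longrightarrow> lev T i \<ge> 0"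
  using frame_exists[of T] by (auto simp: lev_frame intro!: sum_nonneg)

lemma lev_insert_self:
  assumes "finite T" "i \<notin> T"
  shows "lev (insert i T) i = lev T i / (1 + lev T i)"
proof -
  obtain e where e: "frame T e" using frame_exists assms(1) by blast
  obtain e' where e': "frame (insert i T) e'"
    "\<And>k. (\<Sum>j<d. (e' j k)\<^sup>2) =
       (\<Sum>j<d. (e j k)\<^sup>2) - (\<Sum>j<d. e j i * e j k)\<^sup>2 / (1 + (\<Sum>j<d. (e j i)\<^sup>2))"
    by (rule frame_insert[OF e assms(2,1)]) (rule that)
  have "lev (insert i T) i = lev T i - (lev T i)\<^sup>2 / (1 + lev T i)"
    using e'(2)[of i] lev_frame[OF e] lev_frame[OF e'(1)] by (simp add: power2_eq_square)
  also have "\<dots> = lev T i / (1 + lev T i)"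
    using lev_nonneg[OF assms(1), of i] by (simp add: field_simps power2_eq_square)
  finally show ?thesis .
qed

text \<open>Both sides equal the two by two determinant (1 + \<open>lev T i\<close>)(1 +
  \<open>lev T k\<close>) minus the squared inner product of the frame columns at \<open>i\<close>
  and \<open>k\<close>, which is symmetric in the two points. This makes \<open>vol\<close>
  independent of the order of insertion.\<close>

lemma lev_insert_swap:
  assumes "finite T" "i \<notin> T" "k \<notin> T"
  shows "(1 + lev T i) * (1 + lev (insert i T) k) = (1 + lev T k) * (1 + lev (insert k T) i)"
proof -
  obtain e where e: "frame T e" using frame_exists assms(1) by blast
  define g where "g = (\<Sum>j<d. e j i * e j k)"
  have g': "g = (\<Sum>j<d. e j k * e j i)" unfolding g_def by (simp add: mult.commute)
  have "(1 + lev T a) * (1 + lev (insert a T) b) = (1 + lev T a) * (1 + lev T b) - (\<Sum>j<d. e j a * e j b)\<^sup>2"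
    if "a \<notin> T" for a b
  proof -
    obtain e' where e': "frame (insert a T) e'"
      "\<And>k. (\<Sum>j<d. (e' j k)\<^sup>2) =
         (\<Sum>j<d. (e j k)\<^sup>2) - (\<Sum>j<d. e j a * e j k)\<^sup>2 / (1 + (\<Sum>j<d. (e j a)\<^sup>2))"
      by (rule frame_insert[OF e \<open>a \<notin> T\<close> assms(1)]) blast
    have "lev (insert a T) b = lev T b - (\<Sum>j<d. e j a * e j b)\<^sup>2 / (1 + lev T a)"
      using e'(2)[of b] lev_frame[OF e] lev_frame[OF e'(1)] by simp
    moreover have "1 + lev T a > 0" using lev_nonneg[OF assms(1), of a] by simp
    ultimately show ?thesis by (simp add: field_simps)
  qed
  from this[OF assms(2), of k] this[OF assms(3), of i] show ?thesis
    using g_def g' by (simp add: mult.commute)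
qed

text \<open>A trace bound: each of the \<open>d\<close> orthonormal functions has squared mass at
  most 1 on \<open>T\<close>, the remainder of its norm being the ridge term.\<close>

lemma sum_lev_le:
  assumes "finite T"
  shows "(\<Sum>i\<in>T. lev T i) \<le> real d"
proof -
  obtain e where e: "frame T e" using frame_exists assms(1) by blast
  have "(\<Sum>i\<in>T. (e j i)\<^sup>2) \<le> 1" if "j < d" for j
  proof -
    obtain c where c: "\<And>i. ev c i = (\<Sum>l<d. (if l = j then 1 else 0) * e l i)"
       "(\<Sum>l<d. (if l = j then 1 else (0::real))\<^sup>2) = qf T c"
      by (rule frame_vector[OF e, where b = "\<lambda>l. if l = j then 1 else 0"]) (rule that)
    have 1: "ev c i = e j i" for i
      unfolding c(1) using that by (simp add: if_distrib[of "\<lambda>x. x * _"] sum.delta cong: if_cong)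
    have "(\<Sum>l<d. (if l = j then 1 else (0::real))\<^sup>2) = 1"
      using that by (simp add: if_distrib[of "\<lambda>x. x ^ 2"] sum.delta cong: if_cong)
    hence "qf T c = 1" using c(2) by simp
    moreover have "\<eta> * (\<Sum>j<d. (c j)\<^sup>2) \<ge> 0" using eta_pos by (simp add: sum_nonneg)
    ultimately show ?thesis unfolding qf_def 1 by linarith
  qed
  hence "(\<Sum>j<d. \<Sum>i\<in>T. (e j i)\<^sup>2) \<le> (\<Sum>j<d. 1)" by (intro sum_mono) auto
  thus ?thesis unfolding lev_frame[OF e] by (subst sum.swap) simp
qed

text \<open>The determinant of the quadratic form \<open>qf T\<close>, relative to that of \<open>qf {}\<close>.\<close>

definition vol :: "nat set \<Rightarrow> real" where
  "vol T = (\<Prod>i\<in>T. 1 + lev (T \<inter> {..<i}) i)"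

text \<open>The product defining \<open>vol\<close> runs through the indices in increasing order; an
  insertion below the maximum is brought to the top by \<open>lev_insert_swap\<close>.\<close>

lemma vol_insert:
  assumes "finite T" "i \<notin> T"
  shows "vol (insert i T) = vol T * (1 + lev T i)"
  using assms
proof (induction T rule: finite_linorder_max_induct)
  case empty thus ?case by (simp add: vol_def)
next
  case (insert m A)
  have mA: "m \<notin> A" using insert by auto
  have max: "vol (insert k B) = vol B * (1 + lev B k)" if "finite B" "\<forall>b\<in>B. b < k" for B k
  proof -
    have k: "k \<notin> B" using that by auto
    have "insert k B \<inter> {..<k} = B" using that by auto
    moreover have "insert k B \<inter> {..<b} = B \<inter> {..<b}" if "b \<in> B" for b
      using that \<open>\<forall>b\<in>B. b < k\<close> by auto
    ultimately show ?thesis unfolding vol_def using that k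
      by (simp add: mult.commute cong: prod.cong)
  qed
  show ?case
  proof (cases "m < i")
    case True
    hence "\<forall>b\<in>insert m A. b < i" using insert by auto
    thus ?thesis using max[of "insert m A" i] insert by simp
  next
    case False
    hence im: "i < m" using insert by auto
    have "insert i (insert m A) = insert m (insert i A)" by auto
    hence "vol (insert i (insert m A)) = vol (insert i A) * (1 + lev (insert i A) m)"
      using max[of "insert i A" m] insert im by auto
    also have "\<dots> = vol A * ((1 + lev A i) * (1 + lev (insert i A) m))"
      using insert by simp
    also have "\<dots> = vol A * ((1 + lev A m) * (1 + lev (insert m A) i))"
      using lev_insert_swap[of A i m] insert mA by simp
    also have "\<dots> = vol (insert m A) * (1 + lev (insert m A) i)"
      using max[of A m] insert by simp
    finally show ?thesis .
  qed
qed

lemma vol_pos: "finite T \<Longrightarrow> vol T > 0"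
  unfolding vol_def by (intro prod_pos) (auto intro!: add_pos_nonneg lev_nonneg)

text \<open>Deleting one row multiplies the determinant by \<open>1 - lev T i\<close>. Leverages
  inside \<open>T\<close> are thereby increments of \<open>vol\<close>, which drives both averaging
  bounds for random subsets.\<close>

lemma vol_diff:
  assumes "finite T" "i \<in> T"
  shows "vol T - vol (T - {i}) = vol T * lev T i"
proof -
  have T: "T = insert i (T - {i})" using assms by auto
  have l: "1 + lev (T - {i}) i > 0" using lev_nonneg[of "T - {i}" i] assms by simp
  have "vol T = vol (T - {i}) * (1 + lev (T - {i}) i)"
    by (subst T, rule vol_insert) (use assms in auto)
  moreover have "lev T i = lev (T - {i}) i / (1 + lev (T - {i}) i)"
    by (subst T, rule lev_insert_self) (use assms in auto)
  ultimately have "vol T * lev T i = vol (T - {i}) * lev (T - {i}) i" using l by simp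
  thus ?thesis using \<open>vol T = _\<close> by (simp add: algebra_simps)
qed

lemma vol_mono:
  assumes "finite G" "T \<subseteq> G"
  shows "vol T \<le> vol G"
proof -
  have "finite (G - T)" using assms by auto
  hence "vol T \<le> vol (T \<union> (G - T))"
    using finite_subset[OF assms(2,1)]
  proof (induction "G - T" arbitrary: G rule: finite_induct)
    case empty
    hence "T \<union> (G - T) = T" by auto
    thus ?case by simp
  next
    case (insert x F)
    have x: "x \<in> G" "x \<notin> T" using insert by auto
    have F: "F = (G - {x}) - T" using insert by auto
    have IH: "vol T \<le> vol (T \<union> (G - {x} - T))" using insert(3)[OF F] insert by simp
    have fin: "finite (T \<union> (G - {x} - T))" using insert F by (metis finite_UnI)
    have "T \<union> (G - T) = insert x (T \<union> (G - {x} - T))" using x by auto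
    hence "vol (T \<union> (G - T)) = vol (T \<union> (G - {x} - T)) * (1 + lev (T \<union> (G - {x} - T)) x)"
      using vol_insert[OF fin, of x] x by simp
    also have "\<dots> \<ge> vol (T \<union> (G - {x} - T)) * 1"
      using vol_pos[OF fin] lev_nonneg[OF fin] by (intro mult_left_mono) auto
    finally show ?case using IH by simp
  qed
  thus ?thesis using assms(2) by (simp add: Un_absorb1)
qed

end

section \<open>Random subsets\<close>

definition bern :: "real \<Rightarrow> nat set \<Rightarrow> nat set \<Rightarrow> real" where
  "bern p G T = p ^ card T * (1 - p) ^ card (G - T)"

lemma bern_nonneg: "0 \<le> p \<Longrightarrow> p \<le> 1 \<Longrightarrow> bern p G T \<ge> 0"
  by (simp add: bern_def)

lemma sum_Pow_insert:
  assumes "finite F" "x \<notin> F"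
  shows "(\<Sum>T\<in>Pow (insert x F). h T) = (\<Sum>T\<in>Pow F. h T + h (insert x T))"
proof -
  have "(\<Sum>T\<in>Pow (insert x F). h T) = sum h (Pow F) + sum h (insert x ` Pow F)"
    unfolding Pow_insert using assms by (intro sum.union_disjoint) auto
  also have "sum h (insert x ` Pow F) = (\<Sum>T\<in>Pow F. h (insert x T))"
    by (subst sum.reindex) (use assms in \<open>auto intro!: inj_onI\<close>)
  finally show ?thesis by (simp add: sum.distrib)
qed

lemma sum_bern:
  assumes "finite G"
  shows "(\<Sum>T\<in>Pow G. bern p G T) = 1"
  using assms
proof (induction G rule: finite_induct)
  case empty thus ?case by (simp add: bern_def)
next
  case (insert x F)
  have "bern p (insert x F) T + bern p (insert x F) (insert x T) = bern p F T" if "T \<in> Pow F" for T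
  proof -
    have fT: "finite T" and x: "x \<notin> T" using that insert finite_subset by auto
    have "insert x F - T = insert x (F - T)" "insert x F - insert x T = F - T" "x \<notin> F - T"
      using insert x by auto
    thus ?thesis using fT x insert by (simp add: bern_def algebra_simps)
  qed
  thus ?case using insert by (simp add: sum_Pow_insert)
qed

text \<open>Both sides run over pairs of nested subsets that differ in one point. Sums over points
  outside the random set become sums over points inside it.\<close>

lemma sum_Pow_remove:
  assumes "finite G"
  shows "(\<Sum>T\<in>Pow G. \<Sum>i\<in>G - T. h T i) = (\<Sum>T\<in>Pow G. \<Sum>i\<in>T. h (T - {i}) i)"
proof -
  have "(\<Sum>T\<in>Pow G. \<Sum>i\<in>G - T. h T i) = (\<Sum>(T, i)\<in>Sigma (Pow G) (\<lambda>T. G - T). h T i)"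
    using assms by (intro sum.Sigma) (auto intro: finite_subset)
  also have "\<dots> = (\<Sum>(T, i)\<in>Sigma (Pow G) (\<lambda>T. T). h (T - {i}) i)"
    by (rule sum.reindex_bij_witness[of _ "\<lambda>(T, i). (T - {i}, i)" "\<lambda>(T, i). (insert i T, i)"]) auto
  also have "\<dots> = (\<Sum>T\<in>Pow G. \<Sum>i\<in>T. h (T - {i}) i)"
    using assms by (intro sum.Sigma[symmetric]) (auto intro: finite_subset)
  finally show ?thesis .
qed

context features
begin

text \<open>Inside \<open>T\<close> the leverages sum to at most \<open>d\<close>. For a point
  outside, \<open>vol T * lev T i\<close> is the increment of \<open>vol\<close> at
  \<open>insert i T\<close>, hence equals the volume of the larger set times the leverage of
  \<open>i\<close> in it. Moving \<open>i\<close> into the set changes its probability by the factor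
  \<open>(1 - p) / p\<close>, so the outer part is that multiple of the inner part, and the two add
  up to the inner part divided by \<open>p\<close>.\<close>

lemma bern_lev_le:
  assumes G: "finite G" and p: "0 < p" "p \<le> 1"
  shows "(\<Sum>T\<in>Pow G. bern p G T * vol T * (\<Sum>i\<in>G. lev T i)) \<le> real d / p * (\<Sum>T\<in>Pow G. bern p G T * vol T)"
proof -
  define E where "E = (\<Sum>T\<in>Pow G. bern p G T * vol T)"
  define L where "L = (\<Sum>T\<in>Pow G. bern p G T * vol T * (\<Sum>i\<in>T. lev T i))"
  have fin: "finite T" if "T \<in> Pow G" for T using that G finite_subset by auto
  have "L \<le> (\<Sum>T\<in>Pow G. real d * (bern p G T * vol T))"
    unfolding L_def
  proof (rule sum_mono)
    fix T assume T: "T \<in> Pow G"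
    have "bern p G T * vol T \<ge> 0"
      using vol_pos[OF fin[OF T]] bern_nonneg[of p G T] p by simp
    from mult_left_mono[OF sum_lev_le[OF fin[OF T]] this]
    show "bern p G T * vol T * (\<Sum>i\<in>T. lev T i) \<le> real d * (bern p G T * vol T)"
      by (simp add: mult.commute)
  qed
  hence L: "L \<le> real d * E" unfolding E_def by (simp add: sum_distrib_left)
  have split: "(\<Sum>i\<in>G. lev T i) = (\<Sum>i\<in>T. lev T i) + (\<Sum>i\<in>G - T. lev T i)" if "T \<in> Pow G" for T
    using sum.subset_diff[of T G "lev T"] that G by auto
  have "(\<Sum>T\<in>Pow G. \<Sum>i\<in>G - T. bern p G T * vol T * lev T i)
      = (\<Sum>T\<in>Pow G. \<Sum>i\<in>G - T. bern p G T * (vol (insert i T) - vol T))"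
    using fin by (intro sum.cong refl) (auto simp: vol_insert algebra_simps)
  also have "\<dots> = (\<Sum>T\<in>Pow G. \<Sum>i\<in>T. bern p G (T - {i}) * (vol (insert i (T - {i})) - vol (T - {i})))"
    by (rule sum_Pow_remove[OF G])
  also have "\<dots> = (\<Sum>T\<in>Pow G. \<Sum>i\<in>T. (1 - p) / p * (bern p G T * vol T * lev T i))"
  proof (intro sum.cong refl)
    fix T i assume T: "T \<in> Pow G" and i: "i \<in> T"
    have "card T = Suc (card (T - {i}))" using fin[OF T] i by (metis card_Suc_Diff1)
    moreover have "G - (T - {i}) = insert i (G - T)" "i \<notin> G - T" using T i by auto
    ultimately have "bern p G (T - {i}) = (1 - p) / p * bern p G T"
      using G p by (simp add: bern_def)
    moreover have "insert i (T - {i}) = T" using i by auto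
    ultimately show "bern p G (T - {i}) * (vol (insert i (T - {i})) - vol (T - {i})) =
        (1 - p) / p * (bern p G T * vol T * lev T i)"
      using vol_diff[OF fin[OF T] i] by simp
  qed
  also have "\<dots> = (1 - p) / p * L"
    unfolding L_def sum_distrib_left by simp
  finally have 1: "(\<Sum>T\<in>Pow G. bern p G T * vol T * (\<Sum>i\<in>G - T. lev T i)) = (1 - p) / p * L"
    by (simp add: sum_distrib_left)
  have "(\<Sum>T\<in>Pow G. bern p G T * vol T * (\<Sum>i\<in>G. lev T i))
      = (\<Sum>T\<in>Pow G. bern p G T * vol T * (\<Sum>i\<in>T. lev T i) + bern p G T * vol T * (\<Sum>i\<in>G - T. lev T i))"
    by (intro sum.cong refl) (simp only: split distrib_left)
  also have "\<dots> = L + (1 - p) / p * L"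
    unfolding sum.distrib 1 L_def[symmetric] ..
  also have "\<dots> = L / p" using p by (simp add: field_simps)
  also have "\<dots> \<le> real d * E / p" using L p by (intro divide_right_mono) auto
  finally show ?thesis unfolding E_def by simp
qed

text \<open>Without the ridge term Cauchy-Binet would give equality for Gram determinants. Here the
  induction removes one point at a time: by \<open>vol_diff\<close> the volumes of the sets
  \<open>T - {i}\<close> sum to \<open>vol T\<close> times \<open>card T\<close> minus the total
  leverage, and that leverage is at most \<open>d\<close>.\<close>

lemma sum_vol_card_ge:
  assumes G: "finite G" and r: "d \<le> r" "r \<le> card G"
  shows "real ((card G - d) choose (r - d)) * vol G \<le> (\<Sum>T | T \<in> Pow G \<and> card T = r. vol T)"
  using r(2,1)
proof (induction r rule: inc_induct)
  case base
  have "{T. T \<in> Pow G \<and> card T = card G} = {G}" using card_subset_eq[OF G] by auto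
  thus ?case by simp
next
  case (step r)
  define S where "S r = (\<Sum>T | T \<in> Pow G \<and> card T = r. vol T)" for r
  let ?N = "card G"
  have fin: "finite T" if "T \<in> Pow G" for T using that G finite_subset by auto
  have S': "S r = (\<Sum>T\<in>Pow G. if card T = r then vol T else 0)" for r
    unfolding S_def using G by (simp add: sum.If_cases Int_def)
  have "(\<Sum>T\<in>Pow G. \<Sum>i\<in>G - T. if card T = r then vol T else 0) = (\<Sum>T\<in>Pow G. real (?N - r) * (if card T = r then vol T else 0))"
    using G by (intro sum.cong refl) (auto simp: card_Diff_subset fin)
  hence "real (?N - r) * S r = (\<Sum>T\<in>Pow G. \<Sum>i\<in>G - T. if card T = r then vol T else 0)"
    unfolding S' sum_distrib_left by simp
  also have "\<dots> = (\<Sum>T\<in>Pow G. \<Sum>i\<in>T. if card (T - {i}) = r then vol (T - {i}) else 0)"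
    by (rule sum_Pow_remove[OF G])
  also have "\<dots> \<ge> (\<Sum>T\<in>Pow G. real (Suc r - d) * (if card T = Suc r then vol T else 0))"
  proof (intro sum_mono)
    fix T assume T: "T \<in> Pow G"
    have c: "card (T - {i}) = r \<longleftrightarrow> card T = Suc r" if "i \<in> T" for i
      using fin[OF T] that by (metis card_Suc_Diff1 nat.inject)
    show "real (Suc r - d) * (if card T = Suc r then vol T else 0) \<le> (\<Sum>i\<in>T. if card (T - {i}) = r then vol (T - {i}) else 0)"
    proof (cases "card T = Suc r")
      case True
      have "(\<Sum>i\<in>T. vol (T - {i})) = (\<Sum>i\<in>T. vol T - vol T * lev T i)"
        using vol_diff[OF fin[OF T]] by (intro sum.cong refl) (simp add: algebra_simps)
      also have "\<dots> = vol T * (real (Suc r) - (\<Sum>i\<in>T. lev T i))"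
        using True by (simp add: sum_subtractf sum_distrib_left algebra_simps)
      also have "\<dots> \<ge> vol T * (real (Suc r) - real d)"
        using sum_lev_le[OF fin[OF T]] vol_pos[OF fin[OF T]] by (intro mult_left_mono) auto
      finally show ?thesis using True c step.prems by (simp add: of_nat_diff algebra_simps cong: sum.cong)
    next
      case False thus ?thesis using c by (simp cong: sum.cong)
    qed
  qed
  finally have 1: "real (Suc r - d) * S (Suc r) \<le> real (?N - r) * S r"
    unfolding S' sum_distrib_left by simp
  have IH: "real ((?N - d) choose (Suc r - d)) * vol G \<le> S (Suc r)"
    using step unfolding S_def by simp
  have id: "(Suc r - d) * ((?N - d) choose (Suc r - d)) = (?N - r) * ((?N - d) choose (r - d))"
    using step.hyps step.prems binomial_absorb_comp[of "?N - d" "r - d"] binomial_absorption[of "r - d" "?N - d"]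
    by (simp add: Suc_diff_le)
  have "real (?N - r) * (real ((?N - d) choose (r - d)) * vol G) = real (Suc r - d) * (real ((?N - d) choose (Suc r - d)) * vol G)"
    unfolding mult.assoc[symmetric] of_nat_mult[symmetric] id ..
  also have "\<dots> \<le> real (Suc r - d) * S (Suc r)" using IH by (intro mult_left_mono) auto
  also note 1
  finally show ?case using step.hyps unfolding S_def by simp
qed

text \<open>The subsets are grouped by size; after \<open>p ^ d\<close> is split off, the lower
  bounds for the groups add up to the binomial expansion of
  \<open>(p + (1 - p)) ^ (card G - d)\<close>, which is 1. If \<open>G\<close> has fewer than
  \<open>d\<close> points, the outcome \<open>T = G\<close> alone suffices.\<close>

lemma bern_vol_ge:
  assumes G: "finite G" and p: "0 < p" "p \<le> 1"
  shows "p ^ d * vol G \<le> (\<Sum>T\<in>Pow G. bern p G T * vol T)"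
proof (cases "d \<le> card G")
  case False
  have fin: "finite T" if "T \<in> Pow G" for T using that G finite_subset by auto
  have "p ^ d * vol G \<le> p ^ card G * vol G"
    using False p vol_pos[OF G] by (intro mult_right_mono power_decreasing) auto
  also have "\<dots> = (\<Sum>T\<in>{G}. bern p G T * vol T)" by (simp add: bern_def)
  also have "\<dots> \<le> (\<Sum>T\<in>Pow G. bern p G T * vol T)"
    using G p less_imp_le[OF vol_pos[OF fin]] bern_nonneg[of p G] by (intro sum_mono2) auto
  finally show ?thesis .
next
  case True
  let ?N = "card G"
  have fin: "finite T" if "T \<in> Pow G" for T using that G finite_subset by auto
  define S where "S r = (\<Sum>T | T \<in> Pow G \<and> card T = r. vol T)" for r
  have "S r \<ge> 0" for r unfolding S_def using vol_pos fin by (intro sum_nonneg) (auto intro: less_imp_le)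
  have "1 = (p + (1 - p)) ^ (?N - d)" by simp
  also have "\<dots> = (\<Sum>k\<le>?N - d. real ((?N - d) choose k) * p ^ k * (1 - p) ^ (?N - d - k))"
    by (rule binomial_ring)
  finally have "p ^ d * vol G = p ^ d * vol G * (\<Sum>k\<le>?N - d. real ((?N - d) choose k) * p ^ k * (1 - p) ^ (?N - d - k))"
    by (metis mult.right_neutral)
  also have "\<dots> = (\<Sum>k\<le>?N - d. p ^ (k + d) * (1 - p) ^ (?N - (k + d)) * (real ((?N - d) choose k) * vol G))"
    unfolding sum_distrib_left by (intro sum.cong refl) (simp add: power_add mult_ac add.commute)
  also have "\<dots> \<le> (\<Sum>k\<le>?N - d. p ^ (k + d) * (1 - p) ^ (?N - (k + d)) * S (k + d))"
  proof (intro sum_mono mult_left_mono)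
    fix k assume "k \<in> {..?N - d}"
    thus "real ((?N - d) choose k) * vol G \<le> S (k + d)"
      using sum_vol_card_ge[OF G, of "k + d"] True unfolding S_def by simp
  qed (use p in auto)
  also have "\<dots> = (\<Sum>r\<in>(\<lambda>k. k + d) ` {..?N - d}. p ^ r * (1 - p) ^ (?N - r) * S r)"
    by (subst sum.reindex) auto
  also have "\<dots> \<le> (\<Sum>r\<in>{..?N}. p ^ r * (1 - p) ^ (?N - r) * S r)"
    using True p \<open>\<And>r. S r \<ge> 0\<close> by (intro sum_mono2) auto
  also have "\<dots> = (\<Sum>r\<in>{..?N}. \<Sum>T | T \<in> Pow G \<and> card T = r. bern p G T * vol T)"
    unfolding S_def sum_distrib_left
    using G by (intro sum.cong refl) (auto simp: bern_def card_Diff_subset fin)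
  also have "\<dots> = (\<Sum>T\<in>Pow G. bern p G T * vol T)"
    using G by (intro sum.group) (auto simp: card_mono)
  finally show ?thesis .
qed

text \<open>Markov's inequality under the law tilted by \<open>vol\<close> shows that good sets
  carry at least half of the tilted mass. The bound \<open>vol T \<le> vol G\<close> then removes
  the tilt, and \<open>bern_vol_ge\<close> compares the tilted mass with
  \<open>vol G\<close>.\<close>

lemma bern_good_ge:
  assumes G: "finite G" and p: "0 < p" "p \<le> 1" and d: "d > 0"
  shows "p ^ d / 2 \<le> (\<Sum>T | T \<in> Pow G \<and> (\<Sum>i\<in>G. lev T i) \<le> 2 * real d / p. bern p G T)"
proof -
  define E where "E = (\<Sum>T\<in>Pow G. bern p G T * vol T)"
  define good where "good = {T. T \<in> Pow G \<and> (\<Sum>i\<in>G. lev T i) \<le> 2 * real d / p}"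
  have fin: "finite T" if "T \<in> Pow G" for T using that G finite_subset by auto
  have fg: "finite good" "good \<subseteq> Pow G" using G unfolding good_def by auto
  have nn: "bern p G T * vol T \<ge> 0" if "T \<in> Pow G" for T
    using vol_pos[OF fin[OF that]] bern_nonneg[of p G T] p by auto
  define Bd where "Bd = (\<Sum>T\<in>Pow G - good. bern p G T * vol T)"
  have "(\<Sum>T\<in>Pow G - good. 2 * real d / p * (bern p G T * vol T)) \<le> (\<Sum>T\<in>Pow G - good. bern p G T * vol T * (\<Sum>i\<in>G. lev T i))"
  proof (intro sum_mono)
    fix T assume T: "T \<in> Pow G - good"
    hence "2 * real d / p \<le> (\<Sum>i\<in>G. lev T i)" unfolding good_def by auto
    from mult_left_mono[OF this nn[of T]] T
    show "2 * real d / p * (bern p G T * vol T) \<le> bern p G T * vol T * (\<Sum>i\<in>G. lev T i)"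
      by (simp add: mult_ac)
  qed
  hence "2 * real d / p * Bd \<le> (\<Sum>T\<in>Pow G - good. bern p G T * vol T * (\<Sum>i\<in>G. lev T i))"
    unfolding Bd_def by (simp add: sum_distrib_left)
  also have "\<dots> \<le> (\<Sum>T\<in>Pow G. bern p G T * vol T * (\<Sum>i\<in>G. lev T i))"
    using G nn fin lev_nonneg by (intro sum_mono2 mult_nonneg_nonneg[of "bern p G _ * vol _"] sum_nonneg) auto
  also have "\<dots> \<le> real d / p * E" unfolding E_def by (rule bern_lev_le[OF G p])
  finally have "real d / p * (2 * Bd) \<le> real d / p * E" by (simp add: mult_ac)
  hence B: "2 * Bd \<le> E" using d p by (subst (asm) mult_le_cancel_left_pos) auto
  have "E = Bd + (\<Sum>T\<in>good. bern p G T * vol T)"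
    unfolding E_def Bd_def using G fg by (intro sum.subset_diff) auto
  hence "E / 2 \<le> (\<Sum>T\<in>good. bern p G T * vol T)" using B by simp
  also have "\<dots> \<le> (\<Sum>T\<in>good. bern p G T * vol G)"
    using fg G p by (intro sum_mono mult_left_mono vol_mono bern_nonneg) auto
  also have "\<dots> = (\<Sum>T\<in>good. bern p G T) * vol G" by (simp add: sum_distrib_right)
  finally have "p ^ d / 2 * vol G \<le> (\<Sum>T\<in>good. bern p G T) * vol G"
    using bern_vol_ge[OF G p] unfolding E_def by simp
  thus ?thesis using vol_pos[OF G] unfolding good_def by simp
qed

text \<open>Avoiding \<open>P - G\<close> is independent of the choice inside \<open>G\<close>, so
  the two probabilities multiply. The law of the label lives on \<open>P\<close> and does not know
  \<open>G\<close>; this permits a different \<open>G\<close> for each function.\<close>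

lemma bern_good_avoid:
  assumes P: "finite P" and GP: "G \<subseteq> P" and p: "0 < p" "p \<le> 1" and d: "d > 0"
  shows "(1 - p) ^ card (P - G) * p ^ d / 2
    \<le> (\<Sum>T | T \<in> Pow P \<and> T \<subseteq> G \<and> (\<Sum>i\<in>G. lev T i) \<le> 2 * real d / p. bern p P T)"
proof -
  have G: "finite G" using P GP finite_subset by auto
  have "bern p P T = (1 - p) ^ card (P - G) * bern p G T" if "T \<subseteq> G" for T
  proof -
    have "P - T = (P - G) \<union> (G - T)" "(P - G) \<inter> (G - T) = {}" using that GP by auto
    hence "card (P - T) = card (P - G) + card (G - T)" using P G by (simp add: card_Un_disjoint)
    thus ?thesis by (simp add: bern_def power_add)
  qed
  hence "(\<Sum>T | T \<in> Pow G \<and> (\<Sum>i\<in>G. lev T i) \<le> 2 * real d / p. (1 - p) ^ card (P - G) * bern p G T)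
     = (\<Sum>T | T \<in> Pow G \<and> (\<Sum>i\<in>G. lev T i) \<le> 2 * real d / p. bern p P T)"
    by (intro sum.cong refl) auto
  moreover have "{T. T \<in> Pow P \<and> T \<subseteq> G \<and> (\<Sum>i\<in>G. lev T i) \<le> 2 * real d / p}
     = {T. T \<in> Pow G \<and> (\<Sum>i\<in>G. lev T i) \<le> 2 * real d / p}" using GP by auto
  moreover have "(1 - p) ^ card (P - G) * (p ^ d / 2) \<le> (1 - p) ^ card (P - G) *
      (\<Sum>T | T \<in> Pow G \<and> (\<Sum>i\<in>G. lev T i) \<le> 2 * real d / p. bern p G T)"
    using bern_good_ge[OF G p d] p by (intro mult_left_mono) auto
  ultimately show ?thesis by (simp add: sum_distrib_left)
qed

end

section \<open>Rounding to a lattice\<close>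

lemma tanh_lipschitz: "\<bar>tanh x - tanh y\<bar> \<le> \<bar>x - y\<bar>" for x y :: real
proof -
  have "\<bar>tanh x - tanh y\<bar> \<le> x - y" if yx: "y < x" for x y :: real
  proof -
    have D: "(tanh has_field_derivative 1 - tanh z ^ 2) (at z)" for z :: real
      by (auto intro!: derivative_eq_intros)
    obtain z where "tanh x - tanh y = (x - y) * (1 - tanh z ^ 2)"
      using MVT2[OF yx D] by auto
    moreover have "0 \<le> 1 - tanh z ^ 2" "1 - tanh z ^ 2 \<le> 1"
      using tanh_real_bounds[of z] by (auto simp: abs_square_le_1 abs_le_iff)
    ultimately show ?thesis using yx
      by (simp add: abs_mult mult_left_le)
  qed
  from this[of x y] this[of y x] show ?thesis by (cases x y rule: linorder_cases) auto
qed

lemma cosh_le_exp_square: "cosh x \<le> exp (x\<^sup>2 / 2)" for x :: real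
proof -
  have *: "cosh x \<le> exp (x\<^sup>2 / 2)" if "x \<ge> 0" for x :: real
  proof -
    have "0\<^sup>2 / 2 - ln (cosh 0) \<le> x\<^sup>2 / 2 - ln (cosh x)"
    proof (rule DERIV_nonneg_imp_nondecreasing[OF that])
      fix z :: real assume z: "0 \<le> z" "z \<le> x"
      have "((\<lambda>z. z\<^sup>2 / 2 - ln (cosh z)) has_field_derivative z - tanh z) (at z)"
        by (auto intro!: derivative_eq_intros simp: tanh_def cosh_real_pos)
      moreover have "tanh z \<le> z" using tanh_lipschitz[of z 0] z by auto
      ultimately show "\<exists>y. ((\<lambda>z. z\<^sup>2 / 2 - ln (cosh z)) has_real_derivative y) (at z) \<and> 0 \<le> y"
        by (intro exI[of _ "z - tanh z"]) auto
    qed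
    hence "ln (cosh x) \<le> x\<^sup>2 / 2" by simp
    thus ?thesis using cosh_real_pos[of x] by (metis exp_le_cancel_iff exp_ln)
  qed
  show ?thesis using *[of x] *[of "- x"] by (cases "x \<ge> 0") auto
qed

lemma tanh_ge_half: "\<bar>y\<bar> \<le> 1 \<Longrightarrow> \<bar>y\<bar> / 2 \<le> \<bar>tanh y\<bar>" for y :: real
proof -
  have *: "y / 2 \<le> tanh y" if "0 \<le> y" "y \<le> 1" for y :: real
  proof -
    have "1 + 2 * y \<le> exp (2 * y)" by (rule exp_ge_add_one_self)
    hence 1: "exp (- 2 * y) \<le> 1 / (1 + 2 * y)"
      using that by (simp add: exp_minus field_simps)
    define z where "z = exp (- 2 * y)"
    have z: "z > 0" "z * (1 + 2 * y) \<le> 1" using 1 that unfolding z_def by (auto simp: field_simps)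
    have "z * (2 + y) \<le> 2 - y"
    proof -
      have "(1 + 2 * y) * (z * (2 + y)) \<le> 1 * (2 + y)" using z that
        using mult_right_mono[of "z * (1 + 2 * y)" 1 "2 + y"] by (simp add: mult_ac)
      also have "\<dots> \<le> (1 + 2 * y) * (2 - y)"
        using mult_left_mono[of y 1 y] that by (simp add: algebra_simps)
      finally show ?thesis using that by simp
    qed
    thus ?thesis unfolding tanh_real_altdef z_def[symmetric] using z(1) by (simp add: field_simps)
  qed
  assume "\<bar>y\<bar> \<le> 1"
  thus ?thesis using *[of "\<bar>y\<bar>"] by (simp flip: tanh_real_abs)
qed

lemma tanh_square_wild: "\<bar>y\<bar> > 1 \<Longrightarrow> 1 / 4 \<le> (tanh y)\<^sup>2" for y :: real
proof -
  assume "\<bar>y\<bar> > 1"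
  hence "tanh 1 \<le> tanh \<bar>y\<bar>" by (simp del: tanh_real_abs)
  moreover have "1 / 2 \<le> tanh (1 :: real)" using tanh_ge_half[of 1] by simp
  ultimately have "1 / 2 \<le> \<bar>tanh y\<bar>" by simp
  from power_mono[OF this, of 2] show ?thesis by (simp add: power2_eq_square)
qed

lemma square_le_tanh_square:
  fixes y :: real
  assumes "\<bar>y\<bar> \<le> 1"
  shows "y\<^sup>2 \<le> 4 * (tanh y)\<^sup>2"
proof -
  have "(\<bar>y\<bar> / 2)\<^sup>2 \<le> \<bar>tanh y\<bar>\<^sup>2" using tanh_ge_half[OF assms] by (intro power_mono) auto
  thus ?thesis by (simp only: power_divide power2_abs) simp
qed

text \<open>Rounding the argument in the direction in which the linear term is nonnegative loses only the
  quadratic term.\<close>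

lemma tanh_quadratic_lower:
  fixes s \<gamma> x :: real
  assumes "\<bar>s\<bar> \<le> 1" "0 \<le> \<gamma>" "\<gamma> \<le> 1"
  shows "\<exists>D. \<forall>y. s * tanh y - \<gamma> * (tanh y)\<^sup>2 \<ge> s * tanh x - \<gamma> * (tanh x)\<^sup>2 + D * (y - x) - 8 * (y - x)\<^sup>2"
proof -
  define F where "F = (\<lambda>y. s * tanh y - \<gamma> * (tanh y)\<^sup>2)"
  define F' where "F' = (\<lambda>y. (1 - (tanh y)\<^sup>2) * (s - 2 * \<gamma> * tanh y))"
  have D: "(F has_field_derivative F' z) (at z)" for z
    unfolding F_def F'_def by (auto intro!: derivative_eq_intros simp: algebra_simps power2_eq_square)
  have b: "\<bar>tanh z\<bar> \<le> 1" for z :: real using tanh_real_bounds[of z] by auto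
  \<comment> \<open>The derivative of \<open>F\<close> is a polynomial in \<open>tanh\<close>. Its
    difference quotient in that variable is bounded by a product of at most 2 times 3 plus a term of
    at most 2, which gives 8, and \<open>tanh\<close> is itself 1-Lipschitz.\<close>
  have lip: "\<bar>F' y - F' x\<bar> \<le> 8 * \<bar>y - x\<bar>" for y
  proof -
    define a where "a = tanh x"
    define c where "c = tanh y"
    have ac: "\<bar>a\<bar> \<le> 1" "\<bar>c\<bar> \<le> 1" using b unfolding a_def c_def by auto
    have "F' y - F' x = (c - a) * (- (c + a) * (s - 2 * \<gamma> * c) - 2 * \<gamma> * (1 - a\<^sup>2))"
      unfolding F'_def a_def[symmetric] c_def[symmetric] by (simp add: algebra_simps power2_eq_square)
    moreover have "\<bar>- (c + a) * (s - 2 * \<gamma> * c) - 2 * \<gamma> * (1 - a\<^sup>2)\<bar> \<le> 8"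
    proof -
      have g: "\<bar>\<gamma> * c\<bar> \<le> 1" using assms ac by (simp add: abs_mult mult_le_one)
      have 1: "\<bar>c + a\<bar> \<le> 2" using ac by linarith
      have 2: "\<bar>s - 2 * \<gamma> * c\<bar> \<le> 3" using g assms by linarith
      have "\<bar>- (c + a) * (s - 2 * \<gamma> * c)\<bar> \<le> 2 * 3"
        unfolding abs_mult abs_minus_cancel using 1 2 by (intro mult_mono) auto
      moreover have "\<bar>2 * \<gamma> * (1 - a\<^sup>2)\<bar> \<le> 2"
      proof -
        have "0 \<le> 1 - a\<^sup>2" "1 - a\<^sup>2 \<le> 1" using ac by (auto simp: abs_square_le_1)
        thus ?thesis using assms by (simp add: abs_mult mult_le_one)
      qed
      ultimately show ?thesis by linarith
    qed
    ultimately have "\<bar>F' y - F' x\<bar> \<le> \<bar>c - a\<bar> * 8" by (simp add: abs_mult mult_left_mono)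
    also have "\<dots> \<le> \<bar>y - x\<bar> * 8" using tanh_lipschitz[of y x] unfolding a_def c_def by simp
    finally show ?thesis by simp
  qed
  have "F y \<ge> F x + F' x * (y - x) - 8 * (y - x)\<^sup>2" for y
  proof -
    have key: "F y - F x - F' x * (y - x) \<ge> - (8 * (y - x)\<^sup>2)" if z: "F y - F x = (y - x) * F' z" "\<bar>z - x\<bar> \<le> \<bar>y - x\<bar>" for z
    proof -
      have "\<bar>(y - x) * (F' z - F' x)\<bar> \<le> \<bar>y - x\<bar> * (8 * \<bar>y - x\<bar>)"
        unfolding abs_mult using lip[of z] z(2) by (intro mult_left_mono) auto
      moreover have "\<bar>t\<bar> * (8 * \<bar>t\<bar>) = 8 * t\<^sup>2" for t :: real
        by (cases "t \<ge> 0") (auto simp: power2_eq_square)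
      ultimately have "\<bar>(y - x) * (F' z - F' x)\<bar> \<le> 8 * (y - x)\<^sup>2" by metis
      moreover have "F y - F x - F' x * (y - x) = (y - x) * (F' z - F' x)"
        using z(1) by (simp add: algebra_simps)
      ultimately show ?thesis by linarith
    qed
    consider "y = x" | "x < y" | "y < x" by linarith
    thus ?thesis
    proof cases
      case 2
      from MVT2[OF 2 D] obtain z where "x < z" "z < y" "F y - F x = (y - x) * F' z" by auto
      thus ?thesis using key[of z] by auto
    next
      case 3
      from MVT2[OF 3 D] obtain z where z: "y < z" "z < x" "F x - F y = (x - y) * F' z" by auto
      have "F y - F x = (y - x) * F' z" using z(3) by (simp add: algebra_simps)
      thus ?thesis using key[of z] z by auto
    qed simp
  qed
  thus ?thesis unfolding F_def by blast
qed

lemma round_coordinate: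
  fixes \<zeta> :: "nat \<Rightarrow> real \<Rightarrow> real"
  assumes \<zeta>: "\<And>i x. \<exists>D. \<forall>y. \<zeta> i y \<ge> \<zeta> i x + D * (y - x) - L * (y - x)\<^sup>2"
    and a: "a > 0" and L: "L \<ge> 0"
  shows "\<exists>k::int. \<bar>a * k - c\<bar> \<le> a \<and>
    (\<Sum>i\<in>G. \<zeta> i (x i + (a * k - c) * u i)) \<ge> (\<Sum>i\<in>G. \<zeta> i (x i)) - L * a\<^sup>2 * (\<Sum>i\<in>G. (u i)\<^sup>2)"
proof -
  obtain D where D: "\<And>i y. \<zeta> i y \<ge> \<zeta> i (x i) + D i * (y - x i) - L * (y - x i)\<^sup>2"
    using choice[of "\<lambda>i D. \<forall>y. \<zeta> i y \<ge> \<zeta> i (x i) + D * (y - x i) - L * (y - x i)\<^sup>2"] \<zeta> by blast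
  define m where "m = (\<Sum>i\<in>G. D i * u i)"
  define k where "k = (if m \<ge> 0 then \<lceil>c / a\<rceil> else \<lfloor>c / a\<rfloor>)"
  define t where "t = a * k - c"
  have k1: "of_int \<lceil>c / a\<rceil> * a \<ge> c" "of_int \<lceil>c / a\<rceil> * a \<le> c + a" "of_int \<lfloor>c / a\<rfloor> * a \<le> c" "of_int \<lfloor>c / a\<rfloor> * a \<ge> c - a"
  proof -
    have c: "c = c / a * a" using a by simp
    show "of_int \<lceil>c / a\<rceil> * a \<ge> c" by (subst c) (use a in \<open>intro mult_right_mono\<close>, auto)
    show "of_int \<lfloor>c / a\<rfloor> * a \<le> c" by (subst (2) c) (use a in \<open>intro mult_right_mono\<close>, auto)
    have "of_int \<lceil>c / a\<rceil> * a \<le> (c / a + 1) * a" using a by (intro mult_right_mono) linarith+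
    thus "of_int \<lceil>c / a\<rceil> * a \<le> c + a" using a by (simp add: distrib_right)
    have "(c / a - 1) * a \<le> of_int \<lfloor>c / a\<rfloor> * a" using a by (intro mult_right_mono) linarith+
    thus "of_int \<lfloor>c / a\<rfloor> * a \<ge> c - a" using a by (simp add: left_diff_distrib)
  qed
  have t: "\<bar>t\<bar> \<le> a" "t * m \<ge> 0"
    using k1 unfolding t_def k_def by (auto simp: mult.commute abs_le_iff zero_le_mult_iff)
  have t2: "t\<^sup>2 \<le> a\<^sup>2" using power_mono[OF t(1), of 2] by simp
  have "(\<Sum>i\<in>G. \<zeta> i (x i)) - L * a\<^sup>2 * (\<Sum>i\<in>G. (u i)\<^sup>2) \<le> (\<Sum>i\<in>G. \<zeta> i (x i)) + t * m - L * t\<^sup>2 * (\<Sum>i\<in>G. (u i)\<^sup>2)"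
    using t(2) t2 L by (intro diff_mono mult_right_mono mult_left_mono sum_nonneg) auto
  also have "\<dots> = (\<Sum>i\<in>G. \<zeta> i (x i) + D i * (t * u i) - L * (t * u i)\<^sup>2)"
    unfolding m_def by (simp add: sum.distrib sum_subtractf sum_distrib_left power_mult_distrib mult_ac)
  also have "\<dots> \<le> (\<Sum>i\<in>G. \<zeta> i (x i + t * u i))"
  proof (intro sum_mono)
    fix i assume "i \<in> G"
    show "\<zeta> i (x i) + D i * (t * u i) - L * (t * u i)\<^sup>2 \<le> \<zeta> i (x i + t * u i)"
      using D[where i = i and y = "x i + t * u i"] by simp
  qed
  finally show ?thesis using t(1) unfolding t_def by (intro exI[of _ k]) auto
qed

text \<open>Coordinates are rounded one at a time, \<open>z\<close> carrying those already rounded.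
  Each direction is chosen at the current point, so no cross terms appear and the total loss is a
  sum of squares; for a frame this is a sum of leverage scores.\<close>

lemma round_coordinates:
  fixes \<zeta> :: "nat \<Rightarrow> real \<Rightarrow> real" and e :: "nat \<Rightarrow> nat \<Rightarrow> real"
  assumes \<zeta>: "\<And>i x. \<exists>D. \<forall>y. \<zeta> i y \<ge> \<zeta> i x + D * (y - x) - L * (y - x)\<^sup>2"
    and a: "a > 0" and L: "L \<ge> 0"
  shows "\<exists>k::nat \<Rightarrow> int. (\<forall>j<d. \<bar>a * k j - c j\<bar> \<le> a) \<and>
    (\<Sum>i\<in>G. \<zeta> i ((\<Sum>j<d. a * k j * e j i) + z i)) \<ge>
    (\<Sum>i\<in>G. \<zeta> i ((\<Sum>j<d. c j * e j i) + z i)) - L * a\<^sup>2 * (\<Sum>j<d. \<Sum>i\<in>G. (e j i)\<^sup>2)"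
proof (induction d arbitrary: z)
  case 0 show ?case by simp
next
  case (Suc d)
  obtain k0 :: int where k0: "\<bar>a * k0 - c d\<bar> \<le> a"
    "(\<Sum>i\<in>G. \<zeta> i (((\<Sum>j<Suc d. c j * e j i) + z i) + (a * k0 - c d) * e d i)) \<ge>
     (\<Sum>i\<in>G. \<zeta> i ((\<Sum>j<Suc d. c j * e j i) + z i)) - L * a\<^sup>2 * (\<Sum>i\<in>G. (e d i)\<^sup>2)"
    using round_coordinate[of \<zeta> L a "c d" "\<lambda>i. (\<Sum>j<Suc d. c j * e j i) + z i" G "e d", OF \<zeta> a L] by blast
  have eq: "((\<Sum>j<Suc d. c j * e j i) + z i) + (a * k0 - c d) * e d i = (\<Sum>j<d. c j * e j i) + (z i + a * k0 * e d i)" for i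
    by (simp add: algebra_simps)
  obtain k :: "nat \<Rightarrow> int" where k: "\<forall>j<d. \<bar>a * k j - c j\<bar> \<le> a"
    "(\<Sum>i\<in>G. \<zeta> i ((\<Sum>j<d. a * k j * e j i) + (z i + a * k0 * e d i))) \<ge>
     (\<Sum>i\<in>G. \<zeta> i ((\<Sum>j<d. c j * e j i) + (z i + a * k0 * e d i))) - L * a\<^sup>2 * (\<Sum>j<d. \<Sum>i\<in>G. (e j i)\<^sup>2)"
    using Suc.IH[of "\<lambda>i. z i + a * k0 * e d i"] by blast
  have 1: "(\<Sum>j<Suc d. a * real_of_int ((k(d := k0)) j) * e j i) + z i = (\<Sum>j<d. a * k j * e j i) + (z i + a * k0 * e d i)" for i
    by simp
  show ?case
  proof (intro exI[of _ "k(d := k0)"] conjI)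
    show "\<forall>j<Suc d. \<bar>a * (k(d := k0)) j - c j\<bar> \<le> a" using k(1) k0(1) by (auto simp: less_Suc_eq)
    show "(\<Sum>i\<in>G. \<zeta> i ((\<Sum>j<Suc d. c j * e j i) + z i)) - L * a\<^sup>2 * (\<Sum>j<Suc d. \<Sum>i\<in>G. (e j i)\<^sup>2)
      \<le> (\<Sum>i\<in>G. \<zeta> i ((\<Sum>j<Suc d. a * (k(d := k0)) j * e j i) + z i))"
      unfolding 1 using k(2) k0(2) unfolding eq by (simp add: algebra_simps)
  qed
qed

text \<open>The subtracted geometric term makes the induction close, by
  \<open>2 \<le> exp 1\<close>; only the consequence that the sums stay below 3 is used.\<close>

lemma sum_exp_abs_int: "(\<Sum>k\<in>{- int m..int m}. exp (- real_of_int \<bar>k\<bar>)) \<le> 3 - 2 * (1 / 2) ^ m"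
proof (induction m)
  case 0 show ?case by simp
next
  case (Suc m)
  have e: "exp (- (1 + real m)) \<le> (1 / 2) ^ Suc m"
  proof -
    have "(2::real) ^ Suc m \<le> exp 1 ^ Suc m" using exp_ge_add_one_self[of 1] by (intro power_mono) auto
    also have "\<dots> = exp (1 + real m)" by (simp add: exp_add flip: exp_of_nat_mult)
    finally have "1 / exp (1 + real m) \<le> 1 / 2 ^ Suc m" by (intro divide_left_mono) auto
    thus ?thesis by (simp only: exp_minus inverse_eq_divide power_one_over)
  qed
  have "{- int (Suc m)..int (Suc m)} = insert (int (Suc m)) (insert (- int (Suc m)) {- int m..int m})"
    by auto
  hence "(\<Sum>k\<in>{- int (Suc m)..int (Suc m)}. exp (- real_of_int \<bar>k\<bar>))
      = 2 * exp (- (1 + real m)) + (\<Sum>k\<in>{- int m..int m}. exp (- real_of_int \<bar>k\<bar>))"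
    by simp
  thus ?case using Suc e by simp
qed

definition lattice_ball :: "nat \<Rightarrow> real \<Rightarrow> (nat \<Rightarrow> int) set" where
  "lattice_ball d R = {k \<in> {..<d} \<rightarrow>\<^sub>E UNIV. (\<Sum>j<d. real_of_int \<bar>k j\<bar>) \<le> R}"

text \<open>Exponential Markov for counting measure: on the ball \<open>exp R\<close> times the
  product of the weights \<open>exp (- \<bar>k j\<bar>)\<close> is at least 1, and the sum of these
  products factorizes over the coordinates.\<close>

lemma lattice_ball_card:
  shows "finite (lattice_ball d R)" "real (card (lattice_ball d R)) \<le> 3 ^ d * exp R"
proof -
  define m where "m = nat \<lceil>R\<rceil>"
  define Q where "Q = PiE {..<d} (\<lambda>_. {- int m..int m})"
  have fQ: "finite Q" unfolding Q_def by (intro finite_PiE) auto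
  have sub: "lattice_ball d R \<subseteq> Q"
  proof
    fix k assume k: "k \<in> lattice_ball d R"
    have "\<bar>k j\<bar> \<le> int m" if "j < d" for j
    proof -
      have "real_of_int \<bar>k j\<bar> \<le> (\<Sum>j<d. real_of_int \<bar>k j\<bar>)"
        using that by (intro member_le_sum) auto
      also have "\<dots> \<le> R" using k unfolding lattice_ball_def by auto
      finally show ?thesis unfolding m_def by linarith
    qed
    thus "k \<in> Q" using k unfolding Q_def lattice_ball_def by (force simp: PiE_def Pi_def)
  qed
  thus "finite (lattice_ball d R)" using fQ finite_subset by blast
  have "real (card (lattice_ball d R)) = (\<Sum>k\<in>lattice_ball d R. 1)" by simp
  also have "\<dots> \<le> (\<Sum>k\<in>lattice_ball d R. exp R * (\<Prod>j<d. exp (- real_of_int \<bar>k j\<bar>)))"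
  proof (intro sum_mono)
    fix k assume k: "k \<in> lattice_ball d R"
    have "exp R * (\<Prod>j<d. exp (- real_of_int \<bar>k j\<bar>)) = exp (R - (\<Sum>j<d. real_of_int \<bar>k j\<bar>))"
      by (simp add: exp_diff exp_sum exp_minus divide_inverse prod_inversef[symmetric, unfolded o_def])
    also have "\<dots> \<ge> 1" using k unfolding lattice_ball_def by simp
    finally show "1 \<le> exp R * (\<Prod>j<d. exp (- real_of_int \<bar>k j\<bar>))" .
  qed
  also have "\<dots> \<le> (\<Sum>k\<in>Q. exp R * (\<Prod>j<d. exp (- real_of_int \<bar>k j\<bar>)))"
    using sub fQ by (intro sum_mono2) (auto intro!: prod_nonneg mult_nonneg_nonneg)
  also have "\<dots> = exp R * (\<Prod>j<d. \<Sum>k\<in>{- int m..int m}. exp (- real_of_int \<bar>k\<bar>))"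
    unfolding Q_def by (subst prod_sum_PiE) (auto simp: sum_distrib_left)
  also have "\<dots> \<le> exp R * (\<Prod>j<d. 3)"
  proof (intro mult_left_mono prod_mono conjI sum_nonneg)
    have "(0::real) \<le> (1 / 2) ^ m" by simp
    thus "(\<Sum>k = - int m..int m. exp (- real_of_int \<bar>k\<bar>)) \<le> 3"
      using sum_exp_abs_int[of m] by linarith
  qed auto
  finally show "real (card (lattice_ball d R)) \<le> 3 ^ d * exp R" by (simp add: mult.commute)
qed

section \<open>Half spaces and shattering\<close>

definition shattered :: "nat set set \<Rightarrow> nat set \<Rightarrow> bool" where
  "shattered \<H> A \<longleftrightarrow> (\<forall>B\<subseteq>A. \<exists>H\<in>\<H>. H \<inter> A = B)"

text \<open>Pajor's form of the Sauer-Shelah lemma. Deleting \<open>x\<close> from all members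
  merges exactly the pairs that differ in \<open>x\<close> only; \<open>H1\<close> holds the results
  and \<open>H2\<close> the merged ones. What \<open>H1\<close> shatters is shattered by the family,
  and what \<open>H2\<close> shatters remains shattered after \<open>x\<close> is added.\<close>

lemma card_le_card_shattered:
  assumes "finite S" "\<H> \<subseteq> Pow S"
  shows "card \<H> \<le> card {A. A \<subseteq> S \<and> shattered \<H> A}"
  using assms
proof (induction S arbitrary: \<H> rule: finite_induct)
  case empty
  show ?case
  proof (cases "\<H> = {}")
    case False
    hence "\<H> = {{}}" using empty by auto
    hence "{A. A \<subseteq> {} \<and> shattered \<H> A} = {{}}" by (auto simp: shattered_def)
    thus ?thesis using \<open>\<H> = {{}}\<close> by simp
  qed simp
next
  case (insert x F)
  define H1 where "H1 = (\<lambda>H. H - {x}) ` \<H>"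
  define H2 where "H2 = {H. x \<notin> H \<and> H \<in> \<H> \<and> insert x H \<in> \<H>}"
  have fin: "finite \<H>" using insert by (meson finite_Pow_iff finite_insert finite_subset)
  have sub: "H1 \<subseteq> Pow F" "H2 \<subseteq> Pow F" unfolding H1_def H2_def using insert by auto
  define N where "N = {H \<in> \<H>. x \<notin> H}"
  define Y where "Y = (\<lambda>H. H - {x}) ` {H \<in> \<H>. x \<in> H}"
  have inj: "inj_on (\<lambda>H. H - {x}) {H \<in> \<H>. x \<in> H}" by (rule inj_onI) (metis (mono_tags, lifting) insert_Diff mem_Collect_eq)
  have "card \<H> = card N + card {H \<in> \<H>. x \<in> H}"
    unfolding N_def using fin by (subst card_Un_disjoint[symmetric]) (auto intro: arg_cong[of _ _ card])
  also have "card {H \<in> \<H>. x \<in> H} = card Y" unfolding Y_def using inj by (simp add: card_image)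
  also have "card N + card Y = card (N \<union> Y) + card (N \<inter> Y)"
    using fin by (intro card_Un_Int) (auto simp: N_def Y_def)
  also have "N \<union> Y = H1"
  proof -
    define Q where "Q = {H \<in> \<H>. x \<in> H}"
    have 1: "N \<union> Q = \<H>" unfolding N_def Q_def by auto
    have 2: "(\<lambda>H. H - {x}) ` N = N"
    proof -
      have "(\<lambda>H. H - {x}) ` N = (\<lambda>H. H) ` N" by (rule image_cong) (auto simp: N_def)
      thus ?thesis by simp
    qed
    have "(\<lambda>H. H - {x}) ` (N \<union> Q) = N \<union> Y" unfolding image_Un 2 Y_def Q_def ..
    thus ?thesis unfolding 1 H1_def by (rule sym)
  qed
  also have "N \<inter> Y = H2"
  proof -
    have "H \<in> Y \<longleftrightarrow> insert x H \<in> \<H>" if "x \<notin> H" for H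
    proof
      assume "H \<in> Y"
      then obtain K where "K \<in> \<H>" "x \<in> K" "H = K - {x}" unfolding Y_def by auto
      thus "insert x H \<in> \<H>" by (simp add: insert_absorb)
    next
      assume "insert x H \<in> \<H>"
      moreover have "H = insert x H - {x}" using that by auto
      ultimately show "H \<in> Y" unfolding Y_def by blast
    qed
    thus ?thesis unfolding N_def H2_def by auto
  qed
  finally have c: "card \<H> = card H1 + card H2" .
  define S1 where "S1 = {A. A \<subseteq> F \<and> shattered H1 A}"
  define S2 where "S2 = {A. A \<subseteq> F \<and> shattered H2 A}"
  have fS: "finite S1" "finite S2" unfolding S1_def S2_def using insert(1) by auto
  have a1: "shattered \<H> A" if AS: "A \<in> S1" for A
    unfolding shattered_def
  proof (intro allI impI)
    fix B assume "B \<subseteq> A"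
    then obtain H where "H \<in> \<H>" "(H - {x}) \<inter> A = B" using AS unfolding S1_def shattered_def H1_def by blast
    moreover have "x \<notin> A" using AS insert unfolding S1_def by auto
    ultimately show "\<exists>H\<in>\<H>. H \<inter> A = B" by auto
  qed
  have a2: "shattered \<H> (insert x A)" if AS: "A \<in> S2" for A
    unfolding shattered_def
  proof (intro allI impI)
    fix B assume B: "B \<subseteq> insert x A"
    have xA: "x \<notin> A" using AS insert unfolding S2_def by auto
    have "B - {x} \<subseteq> A" using B by auto
    then obtain H where H: "H \<in> H2" "H \<inter> A = B - {x}" using AS unfolding S2_def shattered_def by blast
    show "\<exists>H\<in>\<H>. H \<inter> insert x A = B"
    proof (cases "x \<in> B")
      case True
      thus ?thesis using H xA B unfolding H2_def by (intro bexI[of _ "insert x H"]) auto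
    next
      case False
      thus ?thesis using H xA B unfolding H2_def by (intro bexI[of _ H]) auto
    qed
  qed
  have xS: "x \<notin> A" if "A \<in> S1 \<union> S2" for A using that insert unfolding S1_def S2_def by auto
  have inj2: "inj_on (insert x) S2"
    by (rule inj_onI) (metis Diff_insert_absorb UnCI xS)
  have "card S1 + card S2 = card (S1 \<union> insert x ` S2)"
    using fS xS inj2 by (subst card_Un_disjoint) (auto simp: card_image)
  also have "\<dots> \<le> card {A. A \<subseteq> insert x F \<and> shattered \<H> A}"
    using a1 a2 insert(1) by (intro card_mono) (auto simp: S1_def S2_def)
  finally show ?case using insert.IH[OF sub(1)] insert.IH[OF sub(2)] c unfolding S1_def S2_def by linarith
qed

lemma linear_dependence:
  fixes \<phi> :: "nat \<Rightarrow> nat \<Rightarrow> real"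
  assumes "finite A" "card A > d"
  shows "\<exists>l. (\<exists>i\<in>A. l i \<noteq> 0) \<and> (\<forall>j<d. (\<Sum>i\<in>A. l i * \<phi> i j) = 0)"
  using assms
proof (induction d arbitrary: A \<phi>)
  case 0
  hence "A \<noteq> {}" by auto
  thus ?case by (intro exI[of _ "\<lambda>_. 1"]) auto
next
  case (Suc d)
  show ?case
  proof (cases "\<exists>i\<in>A. \<phi> i d \<noteq> 0")
    case False
    obtain l where "\<exists>i\<in>A. l i \<noteq> 0" "\<forall>j<d. (\<Sum>i\<in>A. l i * \<phi> i j) = 0"
      using Suc.IH[OF Suc.prems(1), of \<phi>] Suc.prems(2) by auto
    thus ?thesis using False by (intro exI[of _ l]) (auto simp: less_Suc_eq)
  next
    case True
    then obtain z where z: "z \<in> A" "\<phi> z d \<noteq> 0" by auto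
    define \<psi> where "\<psi> = (\<lambda>i j. \<phi> i j - \<phi> i d / \<phi> z d * \<phi> z j)"
    have "card (A - {z}) > d" using Suc.prems z by simp
    then obtain l where l: "\<exists>i\<in>A - {z}. l i \<noteq> 0" "\<forall>j<d. (\<Sum>i\<in>A - {z}. l i * \<psi> i j) = 0"
      using Suc.IH[of "A - {z}" \<psi>] Suc.prems(1) by auto
    define t where "t = (\<Sum>i\<in>A - {z}. l i * (\<phi> i d / \<phi> z d))"
    have s: "(\<Sum>i\<in>A. (l(z := - t)) i * \<phi> i j) = (\<Sum>i\<in>A - {z}. l i * \<psi> i j)" for j
    proof -
      have "(\<Sum>i\<in>A. (l(z := - t)) i * \<phi> i j) = - t * \<phi> z j + (\<Sum>i\<in>A - {z}. (l(z := - t)) i * \<phi> i j)"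
        using z(1) Suc.prems(1) by (subst sum.remove[of A z]) auto
      also have "(\<Sum>i\<in>A - {z}. (l(z := - t)) i * \<phi> i j) = (\<Sum>i\<in>A - {z}. l i * \<phi> i j)"
        by (intro sum.cong) auto
      finally show ?thesis
        unfolding \<psi>_def t_def by (simp add: right_diff_distrib sum_subtractf sum_distrib_right mult.assoc)
    qed
    show ?thesis
    proof (intro exI[of _ "l(z := - t)"] conjI allI impI)
      show "\<exists>i\<in>A. (l(z := - t)) i \<noteq> 0" using l(1) by auto
      fix j assume "j < Suc d"
      show "(\<Sum>i\<in>A. (l(z := - t)) i * \<phi> i j) = 0"
      proof (cases "j = d")
        case True
        have "\<psi> i d = 0" for i unfolding \<psi>_def using z(2) by simp
        thus ?thesis unfolding s True by simp
      next
        case False thus ?thesis unfolding s using l(2) \<open>j < Suc d\<close> by auto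
      qed
    qed
  qed
qed

text \<open>More than \<open>d\<close> points satisfy a linear relation with coefficients
  \<open>l\<close>. A half space that cut out exactly the points with \<open>l i > 0\<close> would
  make every term of the relation nonnegative and one of them positive. If no coefficient is
  positive, the negated relation is used.\<close>

lemma shattered_halfspaces_card:
  assumes S: "finite S" and A: "A \<subseteq> S"
    and sh: "shattered {{i \<in> S. lin d \<phi> c i > 0} | c. True} A"
  shows "card A \<le> d"
proof (rule ccontr)
  assume "\<not> card A \<le> d"
  moreover have fA: "finite A" using S A finite_subset by auto
  ultimately obtain l where l: "\<exists>i\<in>A. l i \<noteq> 0" "\<forall>j<d. (\<Sum>i\<in>A. l i * \<phi> i j) = 0"
    using linear_dependence[of A d \<phi>] by auto
  have contr: False if l: "\<exists>i\<in>A. l i > 0" "\<forall>j<d. (\<Sum>i\<in>A. l i * \<phi> i j) = 0" for l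
  proof -
    define B where "B = {i \<in> A. l i > 0}"
    have "B \<subseteq> A" unfolding B_def by auto
    with sh obtain H where H: "H \<in> {{i \<in> S. lin d \<phi> c i > 0} | c. True}" "H \<inter> A = B"
      unfolding shattered_def by meson
    from H(1) obtain c where "H = {i \<in> S. lin d \<phi> c i > 0}" by blast
    hence c: "{i \<in> S. lin d \<phi> c i > 0} \<inter> A = B" using H(2) by simp
    have "(\<Sum>i\<in>A. l i * lin d \<phi> c i) = (\<Sum>i\<in>A. \<Sum>j<d. c j * (l i * \<phi> i j))"
      unfolding lin_def by (simp add: sum_distrib_left mult_ac)
    also have "\<dots> = (\<Sum>j<d. c j * (\<Sum>i\<in>A. l i * \<phi> i j))"
      by (subst sum.swap) (simp add: sum_distrib_left)
    also have "\<dots> = 0" using l(2) by simp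
    finally have z: "(\<Sum>i\<in>A. l i * lin d \<phi> c i) = 0" .
    have pos: "i \<in> A \<Longrightarrow> l i * lin d \<phi> c i \<ge> 0" for i
    proof (cases "i \<in> B")
      case True
      hence "l i > 0" "lin d \<phi> c i > 0" using c unfolding B_def by auto
      thus ?thesis by simp
    next
      assume "i \<in> A"
      case False
      hence "l i \<le> 0" "lin d \<phi> c i \<le> 0" using c A \<open>i \<in> A\<close> unfolding B_def by force+
      thus ?thesis by (simp add: mult_nonpos_nonpos)
    qed
    obtain i where i: "i \<in> A" "l i > 0" using l(1) by auto
    hence "lin d \<phi> c i > 0" using c unfolding B_def by auto
    hence "l i * lin d \<phi> c i > 0" using i by simp
    moreover have "l i * lin d \<phi> c i = 0"
      using sum_nonneg_0[of A "\<lambda>i. l i * lin d \<phi> c i" i] z pos fA i by auto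
    ultimately show False by simp
  qed
  from l(1) obtain i where i: "i \<in> A" "l i \<noteq> 0" by auto
  show False
  proof (cases "l i > 0")
    case True thus ?thesis using contr[of l] l i by auto
  next
    case False
    have "\<forall>j<d. (\<Sum>i\<in>A. - l i * \<phi> i j) = 0" using l(2) by (simp add: sum_negf)
    moreover have "\<exists>i\<in>A. - l i > 0" using i False by (intro bexI[of _ i]) auto
    ultimately show ?thesis using contr[of "\<lambda>i. - l i"] by blast
  qed
qed

lemma sum_Pow_power_card:
  fixes x :: real
  assumes "finite S"
  shows "(\<Sum>A\<in>Pow S. x ^ card A) = (1 + x) ^ card S"
  using assms
proof (induction S rule: finite_induct)
  case (insert y F)
  have "x ^ card T + x ^ card (insert y T) = (1 + x) * x ^ card T" if "T \<in> Pow F" for T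
  proof -
    have "finite T" "y \<notin> T" using that insert finite_subset by auto
    thus ?thesis by (simp add: algebra_simps)
  qed
  thus ?case using insert by (simp add: sum_Pow_insert flip: sum_distrib_left)
qed simp

text \<open>Shattered sets have at most \<open>d\<close> points, so each is counted with weight at
  least 1 by \<open>(1 / x) ^ d * x ^ card A\<close>. The free parameter \<open>x\<close> trades the
  dimension against the number of points; later it is taken small, so that the second factor stays
  below the Rademacher tail.\<close>

lemma card_halfspaces:
  assumes S: "finite S" and x: "0 < x" "x \<le> 1"
  shows "finite {{i \<in> S. lin d \<phi> c i > 0} | c. True}"
    "real (card {{i \<in> S. lin d \<phi> c i > 0} | c. True}) \<le> (1 / x) ^ d * exp (x * real (card S))"
proof -
  define \<H> where "\<H> = {{i \<in> S. lin d \<phi> c i > 0} | c. True}"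
  have sub: "\<H> \<subseteq> Pow S" unfolding \<H>_def by auto
  thus "finite {{i \<in> S. lin d \<phi> c i > 0} | c. True}"
    unfolding \<H>_def using S by (meson finite_Pow_iff finite_subset)
  define Sh where "Sh = {A. A \<subseteq> S \<and> shattered \<H> A}"
  have "real (card \<H>) \<le> real (card Sh)"
    using card_le_card_shattered[OF S sub] unfolding Sh_def by simp
  also have "\<dots> = (\<Sum>A\<in>Sh. 1)" by simp
  also have "\<dots> \<le> (\<Sum>A\<in>Sh. (1 / x) ^ d * x ^ card A)"
  proof (intro sum_mono)
    fix A assume "A \<in> Sh"
    hence "card A \<le> d" using shattered_halfspaces_card[OF S, of A d \<phi>] unfolding Sh_def \<H>_def by auto
    hence "x ^ d \<le> x ^ card A" using x by (intro power_decreasing) auto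
    hence "(1 / x) ^ d * x ^ d \<le> (1 / x) ^ d * x ^ card A" using x by (intro mult_left_mono) auto
    thus "1 \<le> (1 / x) ^ d * x ^ card A" using x by (simp flip: power_mult_distrib)
  qed
  also have "\<dots> \<le> (\<Sum>A\<in>Pow S. (1 / x) ^ d * x ^ card A)"
    using S x unfolding Sh_def by (intro sum_mono2) auto
  also have "\<dots> = (1 / x) ^ d * (1 + x) ^ card S"
    by (simp add: sum_Pow_power_card[OF S] flip: sum_distrib_left)
  also have "\<dots> \<le> (1 / x) ^ d * exp x ^ card S"
    using x by (intro mult_left_mono power_mono) auto
  also have "exp x ^ card S = exp (x * real (card S))"
    by (simp add: exp_of_nat2_mult mult.commute)
  finally show "real (card {{i \<in> S. lin d \<phi> c i > 0} | c. True}) \<le> (1 / x) ^ d * exp (x * real (card S))"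
    unfolding \<H>_def .
qed

section \<open>Symmetrization\<close>

text \<open>The Rademacher signs are indexed by subsets of \<open>{1..n}\<close>: swapping the coordinates \<open>i\<close> and
  \<open>i + n\<close> for all \<open>i \<in> E\<close> multiplies the \<open>i\<close>-th difference by \<open>- 1\<close>.\<close>

definition swap_sign :: "nat \<Rightarrow> nat set \<Rightarrow> nat \<Rightarrow> real" where
  "swap_sign n E i = (if i \<le> n then (if i \<in> E then - 1 else 1) else (if i - n \<in> E then 1 else - 1))"

lemma sum_halves: "(\<Sum>i\<in>{1..2 * n}. g i) = (\<Sum>i\<in>{1..n}. g i + g (i + n))" for g :: "nat \<Rightarrow> real"
proof -
  have "(\<Sum>i\<in>{1..2 * n}. g i) = (\<Sum>i\<in>{1..n}. g i) + (\<Sum>i\<in>{1 + n..n + n}. g i)"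
    by (subst sum.union_disjoint[symmetric]) (auto intro!: sum.cong)
  also have "(\<Sum>i\<in>{1 + n..n + n}. g i) = (\<Sum>i\<in>{1..n}. g (i + n))"
    by (rule sum.shift_bounds_cl_nat_ivl)
  finally show ?thesis by (simp add: sum.distrib)
qed

lemma sum_swap_sign:
  "(\<Sum>i\<in>{1..2 * n}. swap_sign n E i * u i) = (\<Sum>i\<in>{1..n}. (if i \<in> E then - 1 else 1) * (u i - u (i + n)))"
  unfolding sum_halves by (intro sum.cong refl) (auto simp: swap_sign_def)

lemma rademacher_mgf:
  fixes x :: "nat \<Rightarrow> real"
  assumes "finite I"
  shows "(\<Sum>E\<in>Pow I. exp (\<Sum>i\<in>I. (if i \<in> E then - 1 else 1) * x i)) \<le> 2 ^ card I * exp (\<Sum>i\<in>I. (x i)\<^sup>2 / 2)"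
proof -
  have "(\<Sum>E\<in>Pow I. exp (\<Sum>i\<in>I. (if i \<in> E then - 1 else 1) * x i)) = (\<Prod>i\<in>I. exp (x i) + exp (- x i))"
    using assms
  proof (induction I rule: finite_induct)
    case (insert y F)
    have "exp (\<Sum>i\<in>insert y F. (if i \<in> E then - 1 else 1) * x i) + exp (\<Sum>i\<in>insert y F. (if i \<in> insert y E then - 1 else 1) * x i)
       = (exp (x y) + exp (- x y)) * exp (\<Sum>i\<in>F. (if i \<in> E then - 1 else 1) * x i)" if "E \<in> Pow F" for E
    proof -
      have "y \<notin> E" using that insert by auto
      moreover have "(\<Sum>i\<in>F. (if i \<in> insert y E then - 1 else 1) * x i) = (\<Sum>i\<in>F. (if i \<in> E then - 1 else 1) * x i)"
        using insert by (intro sum.cong) auto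
      ultimately show ?thesis using insert by (simp add: exp_add exp_diff exp_minus field_simps)
    qed
    thus ?case using insert by (simp add: sum_Pow_insert flip: sum_distrib_left)
  qed simp
  also have "\<dots> \<le> (\<Prod>i\<in>I. 2 * exp ((x i)\<^sup>2 / 2))"
  proof (intro prod_mono conjI)
    fix i
    have "exp (x i) + exp (- x i) = 2 * cosh (x i)" by (simp add: cosh_field_def)
    thus "exp (x i) + exp (- x i) \<le> 2 * exp ((x i)\<^sup>2 / 2)" using cosh_le_exp_square[of "x i"] by simp
  qed (auto intro: add_nonneg_nonneg)
  also have "\<dots> = 2 ^ card I * exp (\<Sum>i\<in>I. (x i)\<^sup>2 / 2)"
    using assms by (simp add: prod.distrib exp_sum)
  finally show ?thesis .
qed

text \<open>A self-normalized bound: the exponential moment is taken at the very parameter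
  \<open>\<gamma>\<close> that multiplies the sum of squares. The variance term is then cancelled by
  the penalty, and nothing has to be known about the size of \<open>u\<close>.\<close>

lemma rademacher_tail:
  assumes "\<gamma> \<ge> 0"
  shows "real (card {E \<in> Pow {1..n}. t \<le> (\<Sum>i\<in>{1..2 * n}. swap_sign n E i * u i) - \<gamma> * (\<Sum>i\<in>{1..2 * n}. (u i)\<^sup>2)})
    \<le> 2 ^ n * exp (- \<gamma> * t)"
proof -
  define U where "U = (\<Sum>i\<in>{1..2 * n}. (u i)\<^sup>2)"
  define S where "S E = (\<Sum>i\<in>{1..n}. (if i \<in> E then - 1 else 1) * (\<gamma> * (u i - u (i + n))))" for E :: "nat set"
  have S: "\<gamma> * (\<Sum>i\<in>{1..2 * n}. swap_sign n E i * u i) = S E" for E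
    unfolding S_def sum_swap_sign sum_distrib_left by (intro sum.cong refl) simp
  let ?A = "{E \<in> Pow {1..n}. t \<le> (\<Sum>i\<in>{1..2 * n}. swap_sign n E i * u i) - \<gamma> * U}"
  have "(\<Sum>i\<in>{1..n}. (\<gamma> * (u i - u (i + n)))\<^sup>2 / 2) \<le> (\<Sum>i\<in>{1..n}. \<gamma>\<^sup>2 * ((u i)\<^sup>2 + (u (i + n))\<^sup>2))"
  proof (intro sum_mono)
    fix i
    have "(u i - u (i + n))\<^sup>2 / 2 \<le> (u i)\<^sup>2 + (u (i + n))\<^sup>2"
      using sum_squares_bound[of "u i" "- u (i + n)"] by (simp add: power2_diff)
    hence "\<gamma>\<^sup>2 * ((u i - u (i + n))\<^sup>2 / 2) \<le> \<gamma>\<^sup>2 * ((u i)\<^sup>2 + (u (i + n))\<^sup>2)"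
      by (intro mult_left_mono) auto
    thus "(\<gamma> * (u i - u (i + n)))\<^sup>2 / 2 \<le> \<gamma>\<^sup>2 * ((u i)\<^sup>2 + (u (i + n))\<^sup>2)"
      by (simp add: power_mult_distrib)
  qed
  also have "\<dots> = \<gamma>\<^sup>2 * U" unfolding U_def sum_halves sum_distrib_left ..
  finally have v: "(\<Sum>i\<in>{1..n}. (\<gamma> * (u i - u (i + n)))\<^sup>2 / 2) \<le> \<gamma>\<^sup>2 * U" .
  have "real (card ?A) = (\<Sum>E\<in>?A. 1)" by simp
  also have "\<dots> \<le> (\<Sum>E\<in>?A. exp (- \<gamma> * t - \<gamma>\<^sup>2 * U) * exp (S E))"
  proof (intro sum_mono)
    fix E assume "E \<in> ?A"
    hence "\<gamma> * t \<le> \<gamma> * ((\<Sum>i\<in>{1..2 * n}. swap_sign n E i * u i) - \<gamma> * U)" using assms by (intro mult_left_mono) auto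
    hence "\<gamma> * t \<le> S E - \<gamma>\<^sup>2 * U" unfolding right_diff_distrib S by (simp add: power2_eq_square)
    thus "1 \<le> exp (- \<gamma> * t - \<gamma>\<^sup>2 * U) * exp (S E)" by (simp flip: exp_add)
  qed
  also have "\<dots> \<le> (\<Sum>E\<in>Pow {1..n}. exp (- \<gamma> * t - \<gamma>\<^sup>2 * U) * exp (S E))"
    by (intro sum_mono2) auto
  also have "\<dots> = exp (- \<gamma> * t - \<gamma>\<^sup>2 * U) * (\<Sum>E\<in>Pow {1..n}. exp (S E))"
    by (simp add: sum_distrib_left)
  also have "\<dots> \<le> exp (- \<gamma> * t - \<gamma>\<^sup>2 * U) * (2 ^ n * exp (\<gamma>\<^sup>2 * U))"
  proof (intro mult_left_mono)
    have "(\<Sum>E\<in>Pow {1..n}. exp (S E)) \<le> 2 ^ n * exp (\<Sum>i\<in>{1..n}. (\<gamma> * (u i - u (i + n)))\<^sup>2 / 2)"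
      unfolding S_def using rademacher_mgf[of "{1..n}" "\<lambda>i. \<gamma> * (u i - u (i + n))"] by simp
    also have "\<dots> \<le> 2 ^ n * exp (\<gamma>\<^sup>2 * U)" using v by simp
    finally show "(\<Sum>E\<in>Pow {1..n}. exp (S E)) \<le> 2 ^ n * exp (\<gamma>\<^sup>2 * U)" .
  qed simp
  also have "\<dots> = 2 ^ n * exp (- \<gamma> * t)" by (simp flip: exp_add)
  finally show ?thesis unfolding U_def .
qed

lemma rademacher_tail_set:
  assumes "0 \<le> \<gamma>" "H \<subseteq> {1..2 * n}" "\<bar>\<sigma>\<bar> = 1"
  shows "real (card {E \<in> Pow {1..n}. t \<le> (\<Sum>i\<in>H. swap_sign n E i * \<sigma>)}) \<le> 2 ^ n * exp (- \<gamma> * (t - \<gamma> * real (card H)))"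
proof -
  define u where "u = (\<lambda>i. if i \<in> H then \<sigma> else 0)"
  have H: "{1..2 * n} \<inter> H = H" using assms(2) by auto
  have 1: "(\<Sum>i\<in>{1..2 * n}. swap_sign n E i * u i) = (\<Sum>i\<in>H. swap_sign n E i * \<sigma>)" for E
    unfolding u_def using H by (simp add: if_distrib[of "\<lambda>x. _ * x"] sum.If_cases cong: if_cong)
  have "\<sigma>\<^sup>2 = 1" using assms(3) by (metis power2_abs power_one)
  hence 2: "(\<Sum>i\<in>{1..2 * n}. (u i)\<^sup>2) = real (card H)"
    unfolding u_def using H by (simp add: if_distrib[of "\<lambda>x. x ^ 2"] sum.If_cases cong: if_cong)
  show ?thesis using rademacher_tail[OF assms(1), of n "t - \<gamma> * real (card H)" u] unfolding 1 2 by simp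
qed

section \<open>Counting sign vectors that correlate with a linear family\<close>

context features
begin

definition tame :: "nat \<Rightarrow> (nat \<Rightarrow> real) \<Rightarrow> nat set" where
  "tame n a = {i \<in> {1..2 * n}. \<bar>ev a i\<bar> \<le> 1}"

lemma card_wild:
  assumes "(\<Sum>i\<in>{1..2 * n}. (tanh (ev a i))\<^sup>2) \<le> s"
  shows "real (card ({1..2 * n} - tame n a)) \<le> 4 * s"
proof -
  have "real (card ({1..2 * n} - tame n a)) / 4 = (\<Sum>i\<in>{1..2 * n} - tame n a. 1 / 4)" by simp
  also have "\<dots> \<le> (\<Sum>i\<in>{1..2 * n} - tame n a. (tanh (ev a i))\<^sup>2)"
    by (intro sum_mono tanh_square_wild) (auto simp: tame_def)
  also have "\<dots> \<le> (\<Sum>i\<in>{1..2 * n}. (tanh (ev a i))\<^sup>2)" by (intro sum_mono2) auto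
  finally show ?thesis using assms by simp
qed

text \<open>As \<open>T\<close> consists of tame points of \<open>a\<close>, the frame coordinates
  of \<open>a\<close> have squared norm at most \<open>s + 4 * s\<close>, hence few lattice points
  can arise. The loss is measured on \<open>G0\<close>, which need not be the tame set of
  \<open>a\<close>: only the total leverage on \<open>G0\<close> enters.\<close>

lemma frame_lattice_approx:
  assumes fr: "frame T e" and T: "T \<subseteq> tame n a"
    and s: "(\<Sum>i\<in>{1..2 * n}. (tanh (ev a i))\<^sup>2) \<le> s" and small: "\<eta> * (\<Sum>j<d. (a j)\<^sup>2) \<le> s"
    and G0: "G0 \<subseteq> {1..2 * n}" and tr: "(\<Sum>i\<in>G0. lev T i) \<le> \<tau>"
    and h: "h > 0" and \<gamma>: "0 \<le> \<gamma>" "\<gamma> \<le> 1" and S: "\<And>i. \<bar>S i\<bar> \<le> 1"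
  obtains k where "k \<in> lattice_ball d (10 * s / h\<^sup>2 + 2 * real d)"
    "(\<Sum>i\<in>G0. S i * tanh (\<Sum>j<d. h * of_int (k j) * e j i) - \<gamma> * (tanh (\<Sum>j<d. h * of_int (k j) * e j i))\<^sup>2)
      \<ge> (\<Sum>i\<in>G0. S i * tanh (ev a i) - \<gamma> * (tanh (ev a i))\<^sup>2) - 8 * h\<^sup>2 * \<tau>"
proof -
  obtain b where b: "\<And>i. ev a i = (\<Sum>j<d. b j * e j i)" "(\<Sum>j<d. (b j)\<^sup>2) = qf T a"
    using frame_coords[OF fr] by blast
  have "(\<Sum>i\<in>T. (ev a i)\<^sup>2) \<le> (\<Sum>i\<in>T. 4 * (tanh (ev a i))\<^sup>2)"
    using T by (intro sum_mono square_le_tanh_square) (auto simp: tame_def)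
  also have "\<dots> \<le> (\<Sum>i\<in>{1..2 * n}. 4 * (tanh (ev a i))\<^sup>2)"
    using T by (intro sum_mono2) (auto simp: tame_def)
  also have "\<dots> \<le> 4 * s" using s by (simp flip: sum_distrib_left)
  finally have bs: "(\<Sum>j<d. (b j)\<^sup>2) \<le> 5 * s" unfolding b(2) qf_def using small by simp
  obtain k :: "nat \<Rightarrow> int" where k: "\<forall>j<d. \<bar>h * k j - b j\<bar> \<le> h"
    "(\<Sum>i\<in>G0. S i * tanh ((\<Sum>j<d. h * k j * e j i) + 0) - \<gamma> * (tanh ((\<Sum>j<d. h * k j * e j i) + 0))\<^sup>2) \<ge>
     (\<Sum>i\<in>G0. S i * tanh ((\<Sum>j<d. b j * e j i) + 0) - \<gamma> * (tanh ((\<Sum>j<d. b j * e j i) + 0))\<^sup>2) - 8 * h\<^sup>2 * (\<Sum>j<d. \<Sum>i\<in>G0. (e j i)\<^sup>2)"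
    using round_coordinates[of "\<lambda>i y. S i * tanh y - \<gamma> * (tanh y)\<^sup>2" 8 h d b e "\<lambda>_. 0" G0, OF tanh_quadratic_lower[OF S \<gamma>] h]
    by auto
  have t: "(\<Sum>j<d. \<Sum>i\<in>G0. (e j i)\<^sup>2) \<le> \<tau>"
    using tr unfolding lev_frame[OF fr] by (subst sum.swap)
  have "(\<Sum>j<d. real_of_int \<bar>k j\<bar>) \<le> (\<Sum>j<d. 2 * (b j)\<^sup>2 / h\<^sup>2 + 2)"
  proof (intro sum_mono)
    fix j assume "j \<in> {..<d}"
    hence "\<bar>h * k j - b j\<bar> \<le> h" using k(1) by auto
    hence 1: "(h * k j - b j)\<^sup>2 \<le> h\<^sup>2" using power_mono[of "\<bar>h * k j - b j\<bar>" h 2] by simp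
    have "(h * k j)\<^sup>2 \<le> 2 * (b j)\<^sup>2 + 2 * (h * k j - b j)\<^sup>2"
    proof -
      have "2 * (b j)\<^sup>2 + 2 * (h * k j - b j)\<^sup>2 - (h * k j)\<^sup>2 = (2 * b j - h * k j)\<^sup>2"
        by (simp add: power2_eq_square algebra_simps)
      thus ?thesis by (metis diff_ge_0_iff_ge zero_le_power2)
    qed
    hence "h\<^sup>2 * (real_of_int (k j))\<^sup>2 \<le> 2 * (b j)\<^sup>2 + 2 * h\<^sup>2" using 1 by (simp add: power_mult_distrib)
    hence "(real_of_int (k j))\<^sup>2 \<le> (2 * (b j)\<^sup>2 + 2 * h\<^sup>2) / h\<^sup>2" using h by (simp add: field_simps)
    also have "\<dots> = 2 * (b j)\<^sup>2 / h\<^sup>2 + 2" using h by (simp add: add_divide_distrib)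
    finally have 2: "real_of_int ((k j)\<^sup>2) \<le> 2 * (b j)\<^sup>2 / h\<^sup>2 + 2" by simp
    \<comment> \<open>For integers the absolute value is at most the square; this carries the
      Euclidean bound on the coordinates over to the l1 ball of lattice points.\<close>
    have "\<bar>k j\<bar> \<le> (k j)\<^sup>2"
    proof (cases "k j = 0")
      case False
      hence "\<bar>k j\<bar> * 1 \<le> \<bar>k j\<bar> * \<bar>k j\<bar>" by (intro mult_left_mono) auto
      thus ?thesis by (simp add: power2_eq_square abs_mult_self_eq)
    qed simp
    thus "real_of_int \<bar>k j\<bar> \<le> 2 * (b j)\<^sup>2 / h\<^sup>2 + 2" using 2 by linarith
  qed
  also have "\<dots> = 2 * (\<Sum>j<d. (b j)\<^sup>2) / h\<^sup>2 + 2 * real d"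
    by (simp add: sum.distrib sum_distrib_left sum_divide_distrib)
  also have "\<dots> \<le> 10 * s / h\<^sup>2 + 2 * real d" using bs by (intro add_right_mono divide_right_mono) auto
  finally have R: "(\<Sum>j<d. real_of_int \<bar>k j\<bar>) \<le> 10 * s / h\<^sup>2 + 2 * real d" .
  define k' where "k' = restrict k {..<d}"
  have k'k: "(\<Sum>j<d. h * of_int (k' j) * e j i) = (\<Sum>j<d. h * of_int (k j) * e j i)" for i
    unfolding k'_def by (intro sum.cong) auto
  have "8 * h\<^sup>2 * (\<Sum>j<d. \<Sum>i\<in>G0. (e j i)\<^sup>2) \<le> 8 * h\<^sup>2 * \<tau>" using t by (intro mult_left_mono) auto
  thus ?thesis using k(2) R by (intro that[of k']) (auto simp: k'k b(1) lattice_ball_def k'_def)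
qed

end

lemma tanh_surj:
  fixes v :: real
  assumes "- 1 < v" "v < 1"
  obtains t where "tanh t = v"
proof
  define x where "x = sqrt ((1 + v) / (1 - v))"
  have x: "x > 0" "x\<^sup>2 = (1 + v) / (1 - v)" unfolding x_def using assms by auto
  have "tanh (ln x) = (x\<^sup>2 - 1) / (x\<^sup>2 + 1)" by (rule tanh_ln_real[OF x(1)])
  also have "\<dots> = v" unfolding x(2) using assms by (simp add: divide_simps)
  finally show "tanh (ln x) = v" .
qed

text \<open>With \<open>N i\<close> the number of thresholds below \<open>y i\<close>, the staircase
  \<open>2 / m * N i - 1\<close> approximates \<open>y i\<close> up to \<open>2 / m\<close>. The
  constant part contributes \<open>t\<close>, and the levels, fewer than \<open>m\<close> and each
  with factor \<open>2 / m\<close>, contribute \<open>2 * t\<close>.\<close>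

lemma threshold_approximation:
  fixes w y :: "nat \<Rightarrow> real"
  assumes \<Omega>: "finite \<Omega>" and m: "m \<ge> 1" and w: "\<And>i. i \<in> \<Omega> \<Longrightarrow> \<bar>w i\<bar> \<le> 1"
    and y: "\<And>i. i \<in> \<Omega> \<Longrightarrow> - 1 < y i \<and> y i < 1" and t: "t \<ge> 0"
    and lev: "\<And>l. l \<in> {1..<m} \<Longrightarrow> (\<Sum>i | i \<in> \<Omega> \<and> y i > 2 * real l / real m - 1. w i) \<le> t"
    and all: "- (\<Sum>i\<in>\<Omega>. w i) \<le> t"
  shows "(\<Sum>i\<in>\<Omega>. w i * y i) \<le> 3 * t + 2 * real (card \<Omega>) / real m"
proof -
  define N where "N i = real (card {l \<in> {1..<m}. y i > 2 * real l / real m - 1})" for i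
  have N: "\<bar>y i + 1 - 2 / real m * N i\<bar> \<le> 2 / real m" if i: "i \<in> \<Omega>" for i
  proof -
    define z where "z = (y i + 1) * real m / 2"
    have "(y i + 1) * real m < 2 * real m" using y[OF i] m by (intro mult_strict_right_mono) auto
    hence z: "0 < z" "z < real m" using y[OF i] m unfolding z_def by auto
    have yz: "y i > 2 * real l / real m - 1 \<longleftrightarrow> real l < z" for l
      using m unfolding z_def by (simp add: field_simps)
    have lz: "l < nat \<lceil>z\<rceil> \<longleftrightarrow> real l < z" for l by (simp add: zless_nat_eq_int_zless less_ceiling_iff)
    have lm: "l < m" if "real l < z" for l using that z(2) by linarith
    have "{l \<in> {1..<m}. y i > 2 * real l / real m - 1} = {1..<nat \<lceil>z\<rceil>}"
      unfolding yz using lm by (auto simp: lz)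
    moreover have "nat \<lceil>z\<rceil> \<ge> 1" using z(1) by linarith
    ultimately have "N i = real_of_int \<lceil>z\<rceil> - 1" unfolding N_def using z(1) by (simp add: of_nat_diff)
    hence "\<bar>z - N i\<bar> \<le> 1" by linarith
    hence "2 / real m * \<bar>z - N i\<bar> \<le> 2 / real m * 1" using m by (intro mult_left_mono) auto
    hence 1: "\<bar>2 / real m * (z - N i)\<bar> \<le> 2 / real m" unfolding abs_mult by simp
    have 2: "2 / real m * (z - N i) = y i + 1 - 2 / real m * N i"
      unfolding z_def using m by (simp add: field_simps)
    show ?thesis using 1 unfolding 2 .
  qed
  have "(\<Sum>i\<in>\<Omega>. w i * y i) = (\<Sum>i\<in>\<Omega>. - w i + 2 / real m * (w i * N i) + w i * (y i + 1 - 2 / real m * N i))"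
    by (intro sum.cong refl) (simp add: algebra_simps)
  also have "\<dots> = - (\<Sum>i\<in>\<Omega>. w i) + 2 / real m * (\<Sum>i\<in>\<Omega>. w i * N i) + (\<Sum>i\<in>\<Omega>. w i * (y i + 1 - 2 / real m * N i))"
    by (simp add: sum.distrib sum_subtractf sum_negf sum_distrib_left)
  also have "(\<Sum>i\<in>\<Omega>. w i * (y i + 1 - 2 / real m * N i)) \<le> (\<Sum>i\<in>\<Omega>. 2 / real m)"
  proof (intro sum_mono)
    fix i assume i: "i \<in> \<Omega>"
    have "w i * (y i + 1 - 2 / real m * N i) \<le> \<bar>w i\<bar> * \<bar>y i + 1 - 2 / real m * N i\<bar>"
      by (metis abs_ge_self abs_mult)
    also have "\<dots> \<le> 1 * (2 / real m)" using w[OF i] N[OF i] by (intro mult_mono) auto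
    finally show "w i * (y i + 1 - 2 / real m * N i) \<le> 2 / real m" by simp
  qed
  also have "(\<Sum>i\<in>\<Omega>. w i * N i) \<le> real m * t"
  proof -
    have "(\<Sum>i\<in>\<Omega>. w i * N i) = (\<Sum>i\<in>\<Omega>. \<Sum>l\<in>{1..<m}. if y i > 2 * real l / real m - 1 then w i else 0)"
      unfolding N_def by (intro sum.cong refl) (simp add: sum.If_cases Int_def mult.commute)
    also have "\<dots> = (\<Sum>l\<in>{1..<m}. \<Sum>i\<in>\<Omega>. if y i > 2 * real l / real m - 1 then w i else 0)"
      by (rule sum.swap)
    also have "\<dots> \<le> (\<Sum>l\<in>{1..<m}. t)"
      using lev \<Omega> by (intro sum_mono) (simp add: sum.If_cases Int_def)
    also have "\<dots> \<le> real m * t" using m t by (simp add: mult_right_mono)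
    finally show ?thesis .
  qed
  hence "2 / real m * (\<Sum>i\<in>\<Omega>. w i * N i) \<le> 2 / real m * (real m * t)" by (intro mult_left_mono) auto
  hence "2 / real m * (\<Sum>i\<in>\<Omega>. w i * N i) \<le> 2 * t" using m by simp
  hence "- (\<Sum>i\<in>\<Omega>. w i) + 2 / real m * (\<Sum>i\<in>\<Omega>. w i * N i) + (\<Sum>i\<in>\<Omega>. 2 / real m) \<le> 3 * t + 2 * real (card \<Omega>) / real m"
    using all by (simp add: mult.commute)
  finally show ?thesis by simp
qed

lemma abs_swap_sign: "\<bar>swap_sign n E i\<bar> = 1"
  by (simp add: swap_sign_def)

context features
begin

text \<open>All members of \<open>F\<close> share the label \<open>T\<close>, so one frame serves
  them all. The correlation is split over \<open>G0\<close>, where the members are rounded to a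
  common lattice, and over its complement \<open>\<Omega>\<close>, where \<open>tanh\<close> is
  replaced by its level sets.\<close>

lemma card_bad_signs_label:
  assumes c: "0 < c" "c \<le> 1" and p: "0 < p" "p \<le> 1" and x: "0 < x" "x \<le> 1"
    and T: "finite T" and s: "s > 0" and d: "d > 0"
    and F: "\<And>a. a \<in> F \<Longrightarrow> T \<subseteq> tame n a \<and> (\<Sum>i\<in>{1..2 * n}. (tanh (ev a i))\<^sup>2) \<le> s \<and>
      \<eta> * (\<Sum>j<d. (a j)\<^sup>2) \<le> s \<and> (\<Sum>i\<in>tame n a. lev T i) \<le> 2 * real d / p"
    and const: "\<And>a t. \<exists>a'. \<forall>i. ev a' i = ev a i - t"
  shows "real (card {E \<in> Pow {1..n}. \<exists>a\<in>F. c * s \<le> (\<Sum>i\<in>{1..2 * n}. swap_sign n E i * tanh (ev a i))})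
    \<le> 2 ^ n * (3 ^ d * exp ((1280 / (c * p) + 2) * real d) * exp (- (c\<^sup>2 * s / 32))
        + ((1 / x) ^ d * exp (4 * x * s) + 1) * exp (- (c\<^sup>2 * s / 1024)))"
proof (cases "F = {}")
  case True thus ?thesis using x by (simp add: add_nonneg_nonneg)
next
  case False
  then obtain f0 where f0: "f0 \<in> F" by auto
  define P where "P = {1..2 * n}"
  \<comment> \<open>The tame set of one arbitrary member is used for the whole class. Another member
    may be wild on part of \<open>G0\<close> or tame on part of \<open>\<Omega>\<close>, which does
    no harm: rounding needs only its own norm in the frame of \<open>T\<close> and the leverage
    total on \<open>G0\<close>, and the level sets need only that \<open>\<Omega>\<close> is
    small.\<close>
  define G0 where "G0 = tame n f0"
  define \<Omega> where "\<Omega> = P - G0"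
  have G0P: "G0 \<subseteq> P" unfolding G0_def P_def tame_def by auto
  have fin: "finite P" "finite G0" "finite \<Omega>" using G0P finite_subset unfolding P_def \<Omega>_def by auto
  have c\<Omega>: "real (card \<Omega>) \<le> 4 * s" unfolding \<Omega>_def P_def G0_def using card_wild F[OF f0] by auto
  obtain e where e: "frame T e" using frame_exists[OF T] by blast
  \<comment> \<open>The mesh at which the rounding loss on \<open>G0\<close> is exactly
    \<open>c * s / 8\<close>.\<close>
  define h where "h = sqrt (c * s * p / (128 * real d))"
  have h: "h > 0" "h\<^sup>2 = c * s * p / (128 * real d)" unfolding h_def using c s p d by auto
  \<comment> \<open>The penalty is then at most \<open>c * s / 8\<close>. If \<open>G0\<close>
    carries half of the correlation \<open>c * s\<close>, the rounding loss and the penalty leave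
    \<open>c * s / 4\<close>, the threshold in \<open>A\<close>.\<close>
  define \<gamma> where "\<gamma> = c / 8"
  have \<gamma>: "0 \<le> \<gamma>" "\<gamma> \<le> 1" using c unfolding \<gamma>_def by auto
  define R where "R = 10 * s / h\<^sup>2 + 2 * real d"
  have R: "R = (1280 / (c * p) + 2) * real d" unfolding R_def h(2) using c s p d by (simp add: field_simps)
  have loss: "8 * h\<^sup>2 * (2 * real d / p) = c * s / 8" unfolding h(2) using p d by (simp add: field_simps)
  define g where "g k i = (\<Sum>j<d. h * of_int (k j) * e j i)" for k i
  define u where "u k i = (if i \<in> G0 then tanh (g k i) else 0)" for k i
  define A where "A k = {E \<in> Pow {1..n}. c * s / 4 \<le> (\<Sum>i\<in>{1..2 * n}. swap_sign n E i * u k i) - \<gamma> * (\<Sum>i\<in>{1..2 * n}. (u k i)\<^sup>2)}" for k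
  define B where "B \<sigma> H = {E \<in> Pow {1..n}. c * s / 8 \<le> (\<Sum>i\<in>H. swap_sign n E i * \<sigma>)}" for \<sigma> :: real and H
  define \<H> where "\<H> = {{i \<in> \<Omega>. ev a i > 0} | a. True}"
  define K where "K = lattice_ball d R"
  have fH: "finite \<H>" "real (card \<H>) \<le> (1 / x) ^ d * exp (x * real (card \<Omega>))"
    unfolding \<H>_def using card_halfspaces[OF fin(3) x] by auto
  have fK: "finite K" "real (card K) \<le> 3 ^ d * exp R" unfolding K_def by (rule lattice_ball_card)+
  \<comment> \<open>Since \<open>\<Omega>\<close> has at most \<open>4 * s\<close> points, the
    staircase error is at most \<open>c * s / 8\<close>. Together with three times the threshold
    \<open>c * s / 8\<close> in \<open>B\<close> this makes \<open>c * s / 2\<close>, the share of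
    \<open>\<Omega>\<close>.\<close>
  define m where "m = nat \<lceil>64 / c\<rceil>"
  have m: "m \<ge> 1" "real m \<ge> 64 / c"
  proof -
    have "0 < 64 / c" using c by simp
    thus "real m \<ge> 64 / c" "m \<ge> 1" unfolding m_def by linarith+
  qed
  have cover: "{E \<in> Pow {1..n}. \<exists>a\<in>F. c * s \<le> (\<Sum>i\<in>{1..2 * n}. swap_sign n E i * tanh (ev a i))}
      \<subseteq> (\<Union>k\<in>K. A k) \<union> ((\<Union>H\<in>\<H>. B 1 H) \<union> B (- 1) \<Omega>)"
  proof
    fix E assume "E \<in> {E \<in> Pow {1..n}. \<exists>a\<in>F. c * s \<le> (\<Sum>i\<in>{1..2 * n}. swap_sign n E i * tanh (ev a i))}"
    then obtain a where E: "E \<in> Pow {1..n}" and a: "a \<in> F"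
      and big: "c * s \<le> (\<Sum>i\<in>P. swap_sign n E i * tanh (ev a i))" unfolding P_def by auto
    note Fa = F[OF a]
    have split: "(\<Sum>i\<in>P. swap_sign n E i * tanh (ev a i)) =
        (\<Sum>i\<in>\<Omega>. swap_sign n E i * tanh (ev a i)) + (\<Sum>i\<in>G0. swap_sign n E i * tanh (ev a i))"
      unfolding \<Omega>_def using G0P fin by (intro sum.subset_diff) auto
    show "E \<in> (\<Union>k\<in>K. A k) \<union> ((\<Union>H\<in>\<H>. B 1 H) \<union> B (- 1) \<Omega>)"
    proof (cases "c * s / 2 \<le> (\<Sum>i\<in>G0. swap_sign n E i * tanh (ev a i))")
      case True
      have tr: "(\<Sum>i\<in>G0. lev T i) \<le> 2 * real d / p" using F[OF f0] unfolding G0_def by auto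
      obtain k where k: "k \<in> K" "(\<Sum>i\<in>G0. swap_sign n E i * tanh (g k i) - \<gamma> * (tanh (g k i))\<^sup>2)
          \<ge> (\<Sum>i\<in>G0. swap_sign n E i * tanh (ev a i) - \<gamma> * (tanh (ev a i))\<^sup>2) - c * s / 8"
        using frame_lattice_approx[OF e, of n a s G0 "2 * real d / p" h \<gamma> "swap_sign n E"] Fa G0P tr h(1) \<gamma> abs_swap_sign
        unfolding g_def K_def R_def loss P_def by auto
      have "(\<Sum>i\<in>G0. (tanh (ev a i))\<^sup>2) \<le> (\<Sum>i\<in>P. (tanh (ev a i))\<^sup>2)" using G0P fin by (intro sum_mono2) auto
      also have "\<dots> \<le> s" using Fa unfolding P_def by simp
      finally have "\<gamma> * (\<Sum>i\<in>G0. (tanh (ev a i))\<^sup>2) \<le> c * s / 8" unfolding \<gamma>_def using c by (simp add: mult_left_mono)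
      hence "c * s / 4 \<le> (\<Sum>i\<in>G0. swap_sign n E i * tanh (ev a i) - \<gamma> * (tanh (ev a i))\<^sup>2) - c * s / 8"
        using True by (simp add: sum_subtractf sum_distrib_left)
      also note k(2)
      also have "(\<Sum>i\<in>G0. swap_sign n E i * tanh (g k i) - \<gamma> * (tanh (g k i))\<^sup>2)
          = (\<Sum>i\<in>P. swap_sign n E i * u k i) - \<gamma> * (\<Sum>i\<in>P. (u k i)\<^sup>2)"
      proof -
        have PG: "P \<inter> G0 = G0" using G0P by auto
        have "(\<Sum>i\<in>P. swap_sign n E i * u k i) = (\<Sum>i\<in>G0. swap_sign n E i * tanh (g k i))"
          unfolding u_def using PG fin by (simp add: if_distrib[of "\<lambda>x. _ * x"] sum.If_cases cong: if_cong)
        moreover have "(\<Sum>i\<in>P. (u k i)\<^sup>2) = (\<Sum>i\<in>G0. (tanh (g k i))\<^sup>2)"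
          unfolding u_def using PG fin by (simp add: if_distrib[of "\<lambda>x. x ^ 2"] sum.If_cases cong: if_cong)
        ultimately show ?thesis by (simp add: sum_subtractf sum_distrib_left)
      qed
      finally have "E \<in> A k" unfolding A_def P_def using E by auto
      thus ?thesis using k(1) by auto
    next
      case False
      hence big\<Omega>: "c * s / 2 < (\<Sum>i\<in>\<Omega>. swap_sign n E i * tanh (ev a i))" using big split by simp
      show ?thesis
      proof (rule ccontr)
        assume no: "E \<notin> (\<Union>k\<in>K. A k) \<union> ((\<Union>H\<in>\<H>. B 1 H) \<union> B (- 1) \<Omega>)"
        have "(\<Sum>i\<in>\<Omega>. swap_sign n E i * tanh (ev a i)) \<le> 3 * (c * s / 8) + 2 * real (card \<Omega>) / real m"
        proof (rule threshold_approximation[OF fin(3) m(1)])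
          show "\<bar>swap_sign n E i\<bar> \<le> 1" for i by (simp add: abs_swap_sign)
          show "- 1 < tanh (ev a i) \<and> tanh (ev a i) < 1" for i using tanh_real_bounds[of "ev a i"] by auto
          show "0 \<le> c * s / 8" using c s by simp
          show "- (\<Sum>i\<in>\<Omega>. swap_sign n E i) \<le> c * s / 8"
            using no E unfolding B_def by (simp add: sum_negf)
          fix l assume l: "l \<in> {1..<m}"
          obtain t where t: "tanh t = 2 * real l / real m - 1"
            by (rule tanh_surj[of "2 * real l / real m - 1"]) (use l in \<open>auto simp: field_simps\<close>)
          \<comment> \<open>Constants belong to the family, so a level set of
            \<open>tanh (ev a i)\<close> is a homogeneous half space for a shifted coefficient
            vector.\<close>
          obtain a' where a': "\<And>i. ev a' i = ev a i - t" using const by blast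
          have "{i. i \<in> \<Omega> \<and> 2 * real l / real m - 1 < tanh (ev a i)} = {i \<in> \<Omega>. ev a' i > 0}"
            unfolding t[symmetric] a' by auto
          moreover have "{i \<in> \<Omega>. ev a' i > 0} \<in> \<H>" unfolding \<H>_def by blast
          ultimately show "(\<Sum>i | i \<in> \<Omega> \<and> 2 * real l / real m - 1 < tanh (ev a i). swap_sign n E i) \<le> c * s / 8"
            using no E unfolding B_def by fastforce
        qed
        also have "2 * real (card \<Omega>) / real m \<le> 2 * (4 * s) / (64 / c)"
          using c\<Omega> m c s by (intro frac_le) auto
        finally show False using big\<Omega> c by (simp add: field_simps)
      qed
    qed
  qed
  have cA: "real (card (A k)) \<le> 2 ^ n * exp (- (c\<^sup>2 * s / 32))" for k
    using rademacher_tail[OF \<gamma>(1), of n "c * s / 4" "u k"] unfolding A_def \<gamma>_def by (simp add: power2_eq_square mult_ac)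
  have cB: "real (card (B \<sigma> H)) \<le> 2 ^ n * exp (- (c\<^sup>2 * s / 1024))" if H: "H \<subseteq> \<Omega>" and \<sigma>: "\<bar>\<sigma>\<bar> = 1" for H \<sigma>
  proof -
    have "card H \<le> card \<Omega>" using H fin by (intro card_mono) auto
    hence cH: "real (card H) \<le> 4 * s" using c\<Omega> by simp
    \<comment> \<open>The parameter \<open>c / 64\<close> makes the variance term for
      \<open>4 * s\<close> points equal to half of the threshold, leaving the exponent
      \<open>c / 64 * (c * s / 16)\<close>.\<close>
    have "real (card (B \<sigma> H)) \<le> 2 ^ n * exp (- (c / 64) * (c * s / 8 - c / 64 * real (card H)))"
      unfolding B_def using H c \<sigma> by (intro rademacher_tail_set) (auto simp: \<Omega>_def P_def)
    also have "\<dots> \<le> 2 ^ n * exp (- (c / 64) * (c * s / 8 - c / 64 * (4 * s)))"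
    proof -
      have "c / 64 * (c * s / 8 - c / 64 * (4 * s)) \<le> c / 64 * (c * s / 8 - c / 64 * real (card H))"
        using cH c by (intro mult_left_mono diff_mono) auto
      thus ?thesis by simp
    qed
    also have "\<dots> \<le> 2 ^ n * exp (- (c\<^sup>2 * s / 1024))"
    proof -
      have "c\<^sup>2 * s / 1024 = c / 64 * (c * s / 16)" by (simp add: power2_eq_square)
      also have "\<dots> \<le> c / 64 * (c * s / 8 - c / 64 * (4 * s))" by simp
      finally show ?thesis by simp
    qed
    finally show ?thesis .
  qed
  have finB: "finite (A k)" "finite (B \<sigma> H)" for k \<sigma> H unfolding A_def B_def by auto
  have "card {E \<in> Pow {1..n}. \<exists>a\<in>F. c * s \<le> (\<Sum>i\<in>{1..2 * n}. swap_sign n E i * tanh (ev a i))}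
    \<le> card ((\<Union>k\<in>K. A k) \<union> ((\<Union>H\<in>\<H>. B 1 H) \<union> B (- 1) \<Omega>))"
    using fK fH finB by (intro card_mono[OF _ cover]) auto
  also have "\<dots> \<le> (\<Sum>k\<in>K. card (A k)) + ((\<Sum>H\<in>\<H>. card (B 1 H)) + card (B (- 1) \<Omega>))"
    by (intro order_trans[OF card_Un_le] add_mono card_UN_le fK fH order_refl)
  finally have "real (card {E \<in> Pow {1..n}. \<exists>a\<in>F. c * s \<le> (\<Sum>i\<in>{1..2 * n}. swap_sign n E i * tanh (ev a i))})
    \<le> (\<Sum>k\<in>K. real (card (A k))) + ((\<Sum>H\<in>\<H>. real (card (B 1 H))) + real (card (B (- 1) \<Omega>)))"
    by (simp flip: of_nat_sum of_nat_add)
  also have "\<dots> \<le> (\<Sum>k\<in>K. 2 ^ n * exp (- (c\<^sup>2 * s / 32))) + ((\<Sum>H\<in>\<H>. 2 ^ n * exp (- (c\<^sup>2 * s / 1024))) + 2 ^ n * exp (- (c\<^sup>2 * s / 1024)))"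
    using cA cB by (intro add_mono sum_mono) (auto simp: \<H>_def)
  also have "\<dots> = 2 ^ n * (real (card K) * exp (- (c\<^sup>2 * s / 32)) + (real (card \<H>) + 1) * exp (- (c\<^sup>2 * s / 1024)))"
    by (simp add: algebra_simps)
  also have "\<dots> \<le> 2 ^ n * (3 ^ d * exp R * exp (- (c\<^sup>2 * s / 32))
        + ((1 / x) ^ d * exp (4 * x * s) + 1) * exp (- (c\<^sup>2 * s / 1024)))"
  proof (intro mult_left_mono add_mono mult_right_mono)
    have "exp (x * real (card \<Omega>)) \<le> exp (4 * x * s)" using c\<Omega> x by (simp add: mult.left_commute)
    hence "(1 / x) ^ d * exp (x * real (card \<Omega>)) \<le> (1 / x) ^ d * exp (4 * x * s)" using x by (intro mult_left_mono) auto
    thus "real (card \<H>) \<le> (1 / x) ^ d * exp (4 * x * s)" using fH(2) by linarith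
  qed (use fK in auto)
  finally show ?thesis unfolding R .
qed

text \<open>Double counting over pairs of a bad sign vector and a label. Each bad vector has a
  witness with at most \<open>4 * s\<close> wild points, so a random label suits that witness with
  probability at least \<open>exp (- (8 * p * s)) * p ^ d / 2\<close>. For a fixed label the
  previous bound applies, whichever witnesses it suits.\<close>

lemma card_bad_signs:
  assumes c: "0 < c" "c \<le> 1" and p: "0 < p" "p \<le> 1 / 2" and s: "s > 0" and d: "d > 0"
    and F: "\<And>a. a \<in> F \<Longrightarrow> (\<Sum>i\<in>{1..2 * n}. (tanh (ev a i))\<^sup>2) \<le> s \<and> \<eta> * (\<Sum>j<d. (a j)\<^sup>2) \<le> s"
    and const: "\<And>a t. \<exists>a'. \<forall>i. ev a' i = ev a i - t"
  shows "real (card {E \<in> Pow {1..n}. \<exists>a\<in>F. c * s \<le> (\<Sum>i\<in>{1..2 * n}. swap_sign n E i * tanh (ev a i))})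
    * (exp (- (8 * p * s)) * p ^ d / 2)
    \<le> 2 ^ n * (3 ^ d * exp ((1280 / (c * p) + 2) * real d) * exp (- (c\<^sup>2 * s / 32))
        + ((1 / p) ^ d * exp (4 * p * s) + 1) * exp (- (c\<^sup>2 * s / 1024)))"
    (is "real (card ?Bad) * ?q \<le> ?R")
proof -
  define P where "P = {1..2 * n}"
  define good where "good T = {a \<in> F. T \<subseteq> tame n a \<and> (\<Sum>i\<in>tame n a. lev T i) \<le> 2 * real d / p}" for T
  define Bd where "Bd T = {E \<in> Pow {1..n}. \<exists>a\<in>good T. c * s \<le> (\<Sum>i\<in>{1..2 * n}. swap_sign n E i * tanh (ev a i))}" for T
  have fP: "finite P" unfolding P_def by simp
  have fB: "finite ?Bad" by (rule finite_subset[of _ "Pow {1..n}"]) auto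
  have p1: "p \<le> 1" using p by simp
  have q: "?q \<le> (\<Sum>T\<in>Pow P. if E \<in> Bd T then bern p P T else 0)" if E: "E \<in> ?Bad" for E
  proof -
    obtain a where a: "a \<in> F" "c * s \<le> (\<Sum>i\<in>{1..2 * n}. swap_sign n E i * tanh (ev a i))" using E by auto
    have tP: "tame n a \<subseteq> P" unfolding tame_def P_def by auto
    have w: "real (card (P - tame n a)) \<le> 4 * s" unfolding P_def using card_wild F[OF a(1)] by auto
    have "exp (- (2 * p)) \<le> 1 - p"
    proof -
      have "1 \<le> (1 - p) * (1 + 2 * p)" using p mult_left_mono[of p "1 / 2" p] by (simp add: algebra_simps)
      also have "\<dots> \<le> (1 - p) * exp (2 * p)" using p by (intro mult_left_mono) auto
      finally show ?thesis by (simp add: exp_minus field_simps)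
    qed
    hence "exp (- (2 * p)) ^ card (P - tame n a) \<le> (1 - p) ^ card (P - tame n a)" by (intro power_mono) auto
    moreover have "exp (- (8 * p * s)) \<le> exp (- (2 * p)) ^ card (P - tame n a)"
    proof -
      have "2 * p * real (card (P - tame n a)) \<le> 2 * p * (4 * s)" using w p by (intro mult_left_mono) auto
      thus ?thesis by (simp add: exp_of_nat2_mult[symmetric])
    qed
    ultimately have "?q \<le> (1 - p) ^ card (P - tame n a) * p ^ d / 2"
      using p by (intro divide_right_mono mult_right_mono) auto
    also have "\<dots> \<le> (\<Sum>T | T \<in> Pow P \<and> T \<subseteq> tame n a \<and> (\<Sum>i\<in>tame n a. lev T i) \<le> 2 * real d / p. bern p P T)"
      by (rule bern_good_avoid[OF fP tP p(1) p1 d])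
    also have "\<dots> \<le> (\<Sum>T | T \<in> Pow P \<and> E \<in> Bd T. bern p P T)"
    proof (rule sum_mono2)
      show "{T. T \<in> Pow P \<and> T \<subseteq> tame n a \<and> (\<Sum>i\<in>tame n a. lev T i) \<le> 2 * real d / p} \<subseteq> {T. T \<in> Pow P \<and> E \<in> Bd T}"
        using a E unfolding Bd_def good_def by auto
    qed (use fP p p1 in \<open>auto intro: bern_nonneg\<close>)
    also have "\<dots> = (\<Sum>T\<in>Pow P. if E \<in> Bd T then bern p P T else 0)"
      using fP by (simp add: sum.If_cases Int_def)
    finally show ?thesis .
  qed
  have "real (card ?Bad) * ?q = (\<Sum>E\<in>?Bad. ?q)" by simp
  also have "\<dots> \<le> (\<Sum>E\<in>?Bad. \<Sum>T\<in>Pow P. if E \<in> Bd T then bern p P T else 0)"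
    by (rule sum_mono) (rule q)
  also have "\<dots> = (\<Sum>T\<in>Pow P. \<Sum>E\<in>?Bad. if E \<in> Bd T then bern p P T else 0)" by (rule sum.swap)
  also have "\<dots> = (\<Sum>T\<in>Pow P. bern p P T * real (card (?Bad \<inter> Bd T)))"
    using fB by (intro sum.cong refl) (simp add: sum.If_cases)
  also have "\<dots> \<le> (\<Sum>T\<in>Pow P. bern p P T * ?R)"
  proof (intro sum_mono mult_left_mono)
    fix T assume T: "T \<in> Pow P"
    have "card (?Bad \<inter> Bd T) \<le> card (Bd T)" unfolding Bd_def by (intro card_mono) auto
    hence "real (card (?Bad \<inter> Bd T)) \<le> real (card (Bd T))" by simp
    also have "\<dots> \<le> ?R"
      unfolding Bd_def
    proof (rule card_bad_signs_label[OF c p(1) p1 p(1) p1 _ s d _ const])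
      show "finite T" using T fP finite_subset by auto
      show "T \<subseteq> tame n a \<and> (\<Sum>i\<in>{1..2 * n}. (tanh (ev a i))\<^sup>2) \<le> s \<and>
         \<eta> * (\<Sum>j<d. (a j)\<^sup>2) \<le> s \<and> (\<Sum>i\<in>tame n a. lev T i) \<le> 2 * real d / p" if "a \<in> good T" for a
        using that F unfolding good_def by auto
    qed
    finally show "real (card (?Bad \<inter> Bd T)) \<le> ?R" .
  qed (use p p1 in \<open>auto intro: bern_nonneg\<close>)
  also have "\<dots> = ?R" by (simp add: sum_bern[OF fP] flip: sum_distrib_right)
  finally show ?thesis .
qed

end

text \<open>Three tasks remain after \<open>card_bad_signs\<close>: to choose \<open>p\<close>, to
  eliminate \<open>\<eta>\<close>, and to absorb all factors exponential in \<open>d\<close> by the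
  condition \<open>B * real d \<le> s\<close>.\<close>

lemma linear_family_rademacher:
  fixes c :: real
  assumes c: "0 < c" "c \<le> 1"
  shows "\<exists>B r. 0 < B \<and> 0 < r \<and> (\<forall>d \<phi> n F s. d > 0 \<longrightarrow> B * real d \<le> s \<longrightarrow>
     (\<forall>a t. \<exists>a'. \<forall>i. lin d \<phi> a' i = lin d \<phi> a i - t) \<longrightarrow>
     (\<forall>a\<in>F. (\<Sum>i\<in>{1..2 * n}. (tanh (lin d \<phi> a i))\<^sup>2) \<le> s) \<longrightarrow>
     real (card {E \<in> Pow {1..n}. \<exists>a\<in>F. c * s \<le> (\<Sum>i\<in>{1..2 * n}. swap_sign n E i * tanh (lin d \<phi> a i))})
       \<le> 2 ^ n * exp (- r * s))"
proof -
  \<comment> \<open>With \<open>y\<close> the square of \<open>c\<close> times \<open>s\<close>, the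
    loss of the label is \<open>exp (y / 2048)\<close> and that of the half spaces
    \<open>exp (y / 4096)\<close>. Against the tail \<open>exp (- (y / 1024))\<close> this leaves
    \<open>exp (- (y / 4096))\<close>.\<close>
  define p where "p = c\<^sup>2 / 16384"
  have c2: "c\<^sup>2 \<le> 1" "c\<^sup>2 > 0" using c by (auto simp: power_le_one)
  have p: "0 < p" "p \<le> 1 / 2" "p \<le> 1" using c2 unfolding p_def by auto
  define K where "K = 1280 / (c * p) + 2"
  define W where "W = 3 * exp K / p\<^sup>2"
  have K: "K > 0" using c p unfolding K_def by (simp add: add_pos_pos)
  have ip: "1 \<le> 1 / p" using p by simp
  have W: "3 * exp K * (1 / p) \<le> W" "(1 / p) * (1 / p) \<le> W" "1 / p \<le> W"
  proof -
    have "1 \<le> exp K" using K by simp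
    hence eK: "1 \<le> 3 * exp K" by linarith
    have W': "W = 3 * exp K * ((1 / p) * (1 / p))" unfolding W_def by (simp add: power2_eq_square)
    have i2: "1 / p \<le> (1 / p) * (1 / p)" using mult_left_mono[OF ip, of "1 / p"] p by simp
    show "3 * exp K * (1 / p) \<le> W" unfolding W' using i2 eK by (intro mult_left_mono) auto
    have "1 * ((1 / p) * (1 / p)) \<le> 3 * exp K * ((1 / p) * (1 / p))" using eK p by (intro mult_right_mono) auto
    thus "(1 / p) * (1 / p) \<le> W" unfolding W' by simp
    thus "1 / p \<le> W" using i2 by linarith
  qed
  have W1: "W \<ge> 1" using W(3) ip by linarith
  \<comment> \<open>\<open>W\<close> dominates the bases of all three powers with exponent
    \<open>d\<close>. This \<open>B\<close> gives \<open>W ^ d \<le> exp (y / 8192)\<close> and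
    \<open>6 \<le> exp (y / 16384)\<close>, so that \<open>exp (- (y / 16384))\<close>
    survives.\<close>
  define B where "B = (8192 * ln W + 6 * 16384) / c\<^sup>2"
  define r where "r = c\<^sup>2 / 16384"
  have B: "B > 0" unfolding B_def using c2 W1 by (intro divide_pos_pos add_nonneg_pos) auto
  have r: "r > 0" unfolding r_def using c2 by simp
  have main: "real (card {E \<in> Pow {1..n}. \<exists>a\<in>F. c * s \<le> (\<Sum>i\<in>{1..2 * n}. swap_sign n E i * tanh (lin d \<phi> a i))})
       \<le> 2 ^ n * exp (- r * s)"
    if d: "d > 0" and s: "B * real d \<le> s" and const: "\<forall>a t. \<exists>a'. \<forall>i. lin d \<phi> a' i = lin d \<phi> a i - t"
      and F: "\<forall>a\<in>F. (\<Sum>i\<in>{1..2 * n}. (tanh (lin d \<phi> a i))\<^sup>2) \<le> s"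
    for d \<phi> n F s
  proof -
    have "B * 1 \<le> B * real d" using B d by (intro mult_left_mono) auto
    hence "B \<le> s" using s by simp
    hence s0: "s > 0" using B by simp
    define Bad where "Bad = {E \<in> Pow {1..n}. \<exists>a\<in>F. c * s \<le> (\<Sum>i\<in>{1..2 * n}. swap_sign n E i * tanh (lin d \<phi> a i))}"
    have fB: "finite Bad" unfolding Bad_def by (rule finite_subset[of _ "Pow {1..n}"]) auto
    have "\<forall>E\<in>Bad. \<exists>a. a \<in> F \<and> c * s \<le> (\<Sum>i\<in>{1..2 * n}. swap_sign n E i * tanh (lin d \<phi> a i))"
      unfolding Bad_def by blast
    then obtain w where w: "\<And>E. E \<in> Bad \<Longrightarrow> w E \<in> F \<and> c * s \<le> (\<Sum>i\<in>{1..2 * n}. swap_sign n E i * tanh (lin d \<phi> (w E) i))"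
      by (auto dest!: bchoice)
    \<comment> \<open>There are only finitely many sign vectors. One witness is fixed for each bad
      one, and \<open>\<eta>\<close> is then taken so small that the ridge term of every witness is
      at most \<open>s\<close>, although the coefficients in \<open>F\<close> are unbounded.\<close>
    define Q where "Q = 1 + (\<Sum>E\<in>Bad. \<Sum>j<d. (w E j)\<^sup>2)"
    have Q: "Q > 0" unfolding Q_def by (intro add_pos_nonneg sum_nonneg) auto
    define \<eta> where "\<eta> = s / Q"
    interpret features d \<phi> \<eta> by unfold_locales (use s0 Q in \<open>simp add: \<eta>_def\<close>)
    have Bad_eq: "Bad = {E \<in> Pow {1..n}. \<exists>a\<in>w ` Bad. c * s \<le> (\<Sum>i\<in>{1..2 * n}. swap_sign n E i * tanh (lin d \<phi> a i))}"
    proof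
      show "Bad \<subseteq> {E \<in> Pow {1..n}. \<exists>a\<in>w ` Bad. c * s \<le> (\<Sum>i\<in>{1..2 * n}. swap_sign n E i * tanh (lin d \<phi> a i))}"
        using w unfolding Bad_def by blast
      show "{E \<in> Pow {1..n}. \<exists>a\<in>w ` Bad. c * s \<le> (\<Sum>i\<in>{1..2 * n}. swap_sign n E i * tanh (lin d \<phi> a i))} \<subseteq> Bad"
        using w unfolding Bad_def by blast
    qed
    have small: "(\<Sum>i\<in>{1..2 * n}. (tanh (ev a i))\<^sup>2) \<le> s \<and> \<eta> * (\<Sum>j<d. (a j)\<^sup>2) \<le> s" if "a \<in> w ` Bad" for a
    proof
      from that obtain E where E: "E \<in> Bad" "a = w E" by auto
      show "(\<Sum>i\<in>{1..2 * n}. (tanh (ev a i))\<^sup>2) \<le> s" using F w[OF E(1)] E(2) by auto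
      have "(\<Sum>j<d. (a j)\<^sup>2) \<le> (\<Sum>E\<in>Bad. \<Sum>j<d. (w E j)\<^sup>2)"
        unfolding E(2) using fB E(1) by (intro member_le_sum) (auto intro: sum_nonneg)
      hence "(\<Sum>j<d. (a j)\<^sup>2) \<le> Q" unfolding Q_def by simp
      hence "\<eta> * (\<Sum>j<d. (a j)\<^sup>2) \<le> \<eta> * Q" using eta_pos by (intro mult_left_mono) auto
      thus "\<eta> * (\<Sum>j<d. (a j)\<^sup>2) \<le> s" using Q by (simp add: \<eta>_def)
    qed
    define y where "y = c\<^sup>2 * s"
    have y8: "8 * p * s = y / 2048" "4 * p * s = y / 4096" unfolding p_def y_def by auto
    have y0: "y > 0" unfolding y_def using c2 s0 by simp
    have *: "real (card Bad) * (exp (- (8 * p * s)) * p ^ d / 2)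
      \<le> 2 ^ n * (3 ^ d * exp (K * real d) * exp (- (y / 32)) + ((1 / p) ^ d * exp (4 * p * s) + 1) * exp (- (y / 1024)))"
    proof -
      have const': "\<exists>a'. \<forall>i. ev a' i = ev a i - t" for a t using const by blast
      from card_bad_signs[where n = n and F = "w ` Bad", OF c p(1,2) s0 d small const'] show ?thesis
        unfolding Bad_eq[symmetric] K_def[symmetric] y_def[symmetric] .
    qed
    have "real (card Bad) = real (card Bad) * (exp (- (8 * p * s)) * p ^ d / 2) * (2 * (1 / p) ^ d * exp (y / 2048))"
      using p unfolding y8 by (simp add: power_divide exp_minus)
    also have "\<dots> \<le> 2 ^ n * (3 ^ d * exp (K * real d) * exp (- (y / 32)) + ((1 / p) ^ d * exp (4 * p * s) + 1) * exp (- (y / 1024)))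
        * (2 * (1 / p) ^ d * exp (y / 2048))"
      using p by (intro mult_right_mono[OF *]) auto
    also have "\<dots> = 2 * 2 ^ n * ((3 * exp K * (1 / p)) ^ d * (exp (- (y / 32)) * exp (y / 2048))
        + ((1 / p) * (1 / p)) ^ d * (exp (y / 4096) * exp (- (y / 1024)) * exp (y / 2048))
        + (1 / p) ^ d * (exp (- (y / 1024)) * exp (y / 2048)))"
    proof -
      have alg: "N * (t * k * e1 + (P * e2 + 1) * e3) * (2 * P * e4)
          = 2 * N * ((t * k * P) * (e1 * e4) + (P * P) * (e2 * e3 * e4) + P * (e3 * e4))"
        for N t k e1 P e2 e3 e4 :: real by (simp add: algebra_simps)
      have 1: "(3 * exp K * (1 / p)) ^ d = 3 ^ d * exp (K * real d) * (1 / p) ^ d"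
        unfolding power_mult_distrib by (simp add: exp_of_nat2_mult[symmetric])
      have 2: "((1 / p) * (1 / p)) ^ d = (1 / p) ^ d * (1 / p) ^ d" by (rule power_mult_distrib)
      show ?thesis unfolding 1 2 y8 alg ..
    qed
    also have "\<dots> \<le> 2 * 2 ^ n * (W ^ d * exp (- (y / 4096)) + W ^ d * exp (- (y / 4096)) + W ^ d * exp (- (y / 4096)))"
      using W W1 p y0 by (intro mult_left_mono add_mono mult_mono power_mono) (auto simp flip: exp_add)
    also have "\<dots> = 2 ^ n * (6 * W ^ d * exp (- (y / 4096)))" by simp
    also have "\<dots> \<le> 2 ^ n * exp (- r * s)"
    proof (intro mult_left_mono)
      have "B * c\<^sup>2 = 8192 * ln W + 6 * 16384" unfolding B_def using c2 by simp
      moreover have "(B * c\<^sup>2) * real d \<le> y"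
        using mult_right_mono[OF s, of "c\<^sup>2"] c2 unfolding y_def by (simp add: mult_ac)
      ultimately have "(8192 * ln W + 6 * 16384) * real d \<le> y" by metis
      hence yd: "8192 * (ln W * real d) + 6 * 16384 * real d \<le> y" by (simp add: algebra_simps)
      have "0 \<le> ln W * real d" using W1 by simp
      have "W ^ d = exp (ln W * real d)" using W1 by (simp add: exp_of_nat2_mult)
      also have "\<dots> \<le> exp (y / 8192)" using yd d by simp
      finally have Wd: "W ^ d \<le> exp (y / 8192)" .
      have "6 * 16384 * 1 \<le> 6 * 16384 * real d" using d by (intro mult_left_mono) auto
      hence "6 \<le> y / 16384" using yd \<open>0 \<le> ln W * real d\<close> by simp
      hence "6 \<le> exp (y / 16384)" using exp_ge_add_one_self[of "y / 16384"] by linarith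
      hence "6 * W ^ d * exp (- (y / 4096)) \<le> exp (y / 16384) * exp (y / 8192) * exp (- (y / 4096))"
        using Wd W1 by (intro mult_right_mono mult_mono) auto
      also have "\<dots> = exp (- r * s)" unfolding r_def by (simp add: y_def flip: exp_add)
      finally show "6 * W ^ d * exp (- (y / 4096)) \<le> exp (- r * s)" .
    qed simp
    finally show ?thesis unfolding Bad_def .
  qed
  show ?thesis
    by (rule exI[of _ B], rule exI[of _ r]) (use B r main in blast)
qed

text \<open>Dyadic peeling removes the common bound on the sum of squares: on the slice where this
  sum is of the order \<open>2 ^ k * D\<close>, the data-dependent threshold is comparable to the
  level of the slice.\<close>

lemma linear_family_rademacher_peeled:
  "\<exists>B r. 0 < B \<and> 0 < r \<and> (\<forall>d \<phi> n F D. d > 0 \<longrightarrow> B * real d \<le> D \<longrightarrow>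
     (\<forall>a t. \<exists>a'. \<forall>i. lin d \<phi> a' i = lin d \<phi> a i - t) \<longrightarrow>
     real (card {E \<in> Pow {1..n}. \<exists>a\<in>F. ((\<Sum>i\<in>{1..2 * n}. (tanh (lin d \<phi> a i))\<^sup>2) + D) / 64
          \<le> (\<Sum>i\<in>{1..2 * n}. swap_sign n E i * tanh (lin d \<phi> a i))})
       \<le> 2 ^ n * (2 * exp (- r * D)))"
proof -
  have c: "0 < (1 / 128 :: real)" "1 / 128 \<le> (1 :: real)" by auto
  obtain B r where B: "0 < B" and r: "0 < r" and Br: "\<forall>d \<phi> n F s. d > 0 \<longrightarrow> B * real d \<le> s \<longrightarrow>
     (\<forall>a t. \<exists>a'. \<forall>i. lin d \<phi> a' i = lin d \<phi> a i - t) \<longrightarrow>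
     (\<forall>a\<in>F. (\<Sum>i\<in>{1..2 * n}. (tanh (lin d \<phi> a i))\<^sup>2) \<le> s) \<longrightarrow>
     real (card {E \<in> Pow {1..n}. \<exists>a\<in>F. 1 / 128 * s \<le> (\<Sum>i\<in>{1..2 * n}. swap_sign n E i * tanh (lin d \<phi> a i))})
       \<le> 2 ^ n * exp (- r * s)"
    using linear_family_rademacher[OF c] by blast
  \<comment> \<open>The lower bounds 1 and \<open>1 / r\<close> ensure that the top slice contains
    all functions and that successive slice bounds decrease at least by a factor 2.\<close>
  define B' where "B' = max B (max 1 (1 / r))"
  have B': "B' \<ge> B" "B' \<ge> 1" "B' \<ge> 1 / r" unfolding B'_def by auto
  have main: "real (card {E \<in> Pow {1..n}. \<exists>a\<in>F. ((\<Sum>i\<in>{1..2 * n}. (tanh (lin d \<phi> a i))\<^sup>2) + D) / 64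
          \<le> (\<Sum>i\<in>{1..2 * n}. swap_sign n E i * tanh (lin d \<phi> a i))}) \<le> 2 ^ n * (2 * exp (- r * D))"
    if d: "d > 0" and D: "B' * real d \<le> D" and const: "\<forall>a t. \<exists>a'. \<forall>i. lin d \<phi> a' i = lin d \<phi> a i - t"
    for d \<phi> n F D
  proof -
    have "B' * 1 \<le> B' * real d" using d B' by (intro mult_left_mono) auto
    hence "B' \<le> D" using D by simp
    hence D1: "D \<ge> 1" "r * D \<ge> 1" using B' r by (auto simp: divide_le_eq mult.commute intro: order_trans)
    have BD: "B * real d \<le> D" using D B' by (meson mult_right_mono of_nat_0_le_iff order_trans)
    define tot where "tot a = (\<Sum>i\<in>{1..2 * n}. (tanh (lin d \<phi> a i))\<^sup>2)" for a
    define Y where "Y E a = (\<Sum>i\<in>{1..2 * n}. swap_sign n E i * tanh (lin d \<phi> a i))" for E a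
    define s where "s k = 2 ^ k * D" for k :: nat
    define A where "A k = {E \<in> Pow {1..n}. \<exists>a\<in>{a \<in> F. tot a \<le> s k}. 1 / 128 * s k \<le> Y E a}" for k
    have s: "s k \<ge> (real k + 1) * D" for k
    proof -
      have "real k + 1 \<le> 2 ^ k" by (induction k) auto
      thus ?thesis unfolding s_def using D1 by (intro mult_right_mono) auto
    qed
    have tot2n: "tot a \<le> 2 * real n" for a
    proof -
      have "(tanh y)\<^sup>2 \<le> 1" for y :: real using tanh_real_bounds[of y] by (auto simp: abs_square_le_1 abs_le_iff)
      hence "tot a \<le> (\<Sum>i\<in>{1..2 * n}. 1)" unfolding tot_def by (intro sum_mono) auto
      thus ?thesis by simp
    qed
    have cA: "real (card (A k)) \<le> 2 ^ n * exp (- r * D) ^ Suc k" for k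
    proof -
      have "1 * D \<le> (real k + 1) * D" using D1 by (intro mult_right_mono) auto
      hence "D \<le> s k" using s[of k] by simp
      hence "real (card (A k)) \<le> 2 ^ n * exp (- r * s k)"
        unfolding A_def Y_def using Br[rule_format, of d "s k" \<phi> "{a \<in> F. tot a \<le> s k}" n] d BD const by (auto simp: tot_def)
      also have "exp (- r * s k) \<le> exp (- r * ((real k + 1) * D))" using s[of k] r by simp
      also have "\<dots> = exp (- r * D) ^ Suc k" unfolding exp_of_nat_mult[symmetric] by (simp add: algebra_simps)
      finally show ?thesis by simp
    qed
    have "{E \<in> Pow {1..n}. \<exists>a\<in>F. (tot a + D) / 64 \<le> Y E a} \<subseteq> (\<Union>k\<in>{..2 * n}. A k)"
    proof
      fix E assume "E \<in> {E \<in> Pow {1..n}. \<exists>a\<in>F. (tot a + D) / 64 \<le> Y E a}"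
      then obtain a where E: "E \<in> Pow {1..n}" and a: "a \<in> F" "(tot a + D) / 64 \<le> Y E a" by auto
      have "(real (2 * n) + 1) * 1 \<le> (real (2 * n) + 1) * D" using D1 by (intro mult_left_mono) auto
      hence "real (2 * n) + 1 \<le> s (2 * n)" using s[of "2 * n"] by (metis mult_1_right order_trans)
      hence ex: "tot a \<le> s (2 * n)" using tot2n[of a] by simp
      \<comment> \<open>Minimality gives \<open>s k / 2 \<le> tot a + D\<close>, also for
        \<open>k = 0\<close>; hence a correlation of \<open>(tot a + D) / 64\<close> is at least
        \<open>s k / 128\<close>, the source of the level \<open>1 / 128\<close>.\<close>
      define k where "k = (LEAST k. tot a \<le> s k)"
      have k: "tot a \<le> s k" "k \<le> 2 * n" unfolding k_def using ex by (auto intro: LeastI Least_le)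
      have "s k / 2 \<le> tot a + D"
      proof (cases k)
        case 0
        have "tot a \<ge> 0" unfolding tot_def by (intro sum_nonneg) auto
        thus ?thesis using D1 unfolding 0 s_def by simp
      next
        case (Suc l)
        hence "\<not> tot a \<le> s l" unfolding k_def using not_less_Least by (metis lessI)
        moreover have "s k = 2 * s l" unfolding Suc s_def by simp
        ultimately show ?thesis using D1 by simp
      qed
      hence "E \<in> A k" unfolding A_def using E a k by auto
      thus "E \<in> (\<Union>k\<in>{..2 * n}. A k)" using k by auto
    qed
    hence "card {E \<in> Pow {1..n}. \<exists>a\<in>F. (tot a + D) / 64 \<le> Y E a} \<le> card (\<Union>k\<in>{..2 * n}. A k)"
      by (rule card_mono[rotated]) (auto simp: A_def)
    also have "\<dots> \<le> (\<Sum>k\<in>{..2 * n}. card (A k))" by (rule card_UN_le) simp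
    finally have "real (card {E \<in> Pow {1..n}. \<exists>a\<in>F. (tot a + D) / 64 \<le> Y E a}) \<le> (\<Sum>k\<in>{..2 * n}. real (card (A k)))"
      by (simp flip: of_nat_sum)
    also have "\<dots> \<le> (\<Sum>k\<in>{..2 * n}. 2 ^ n * exp (- r * D) ^ Suc k)" by (intro sum_mono cA)
    also have "\<dots> \<le> (\<Sum>k\<in>{..2 * n}. 2 ^ n * (exp (- r * D) * (1 / 2) ^ k))"
    proof (intro sum_mono mult_left_mono)
      fix k
      have "2 \<le> exp (r * D)" using D1 exp_ge_add_one_self[of "r * D"] by linarith
      hence "1 / exp (r * D) \<le> 1 / 2" by (intro divide_left_mono) auto
      hence "exp (- r * D) \<le> 1 / 2" by (simp add: exp_minus inverse_eq_divide)
      thus "exp (- r * D) ^ Suc k \<le> exp (- r * D) * (1 / 2) ^ k"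
        by (simp add: power_mono)
    qed simp
    also have "\<dots> = 2 ^ n * (exp (- r * D) * (\<Sum>k\<in>{..2 * n}. (1 / 2) ^ k))" by (simp add: sum_distrib_left)
    also have "\<dots> \<le> 2 ^ n * (exp (- r * D) * 2)"
    proof (intro mult_left_mono)
      have "(\<Sum>k\<in>{..m}. (1 / 2 :: real) ^ k) = 2 - (1 / 2) ^ m" for m by (induction m) auto
      thus "(\<Sum>k\<in>{..2 * n}. (1 / 2 :: real) ^ k) \<le> 2" by simp
    qed auto
    finally show ?thesis unfolding tot_def Y_def by (simp add: mult.commute)
  qed
  show ?thesis
    by (rule exI[of _ B'], rule exI[of _ r]) (use B'(1) B r main in \<open>auto intro: less_le_trans\<close>)
qed

section \<open>Ghost sample and the error of the first kind\<close>

lemma iid_chernoff: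
  fixes Y :: "'a \<Rightarrow> real" and I :: "nat set"
  assumes M: "prob_space M" and Y[measurable]: "Y \<in> borel_measurable M" and I: "finite I"
  shows "emeasure (PiM I (\<lambda>_. M)) {X \<in> space (PiM I (\<lambda>_. M)). t \<le> (\<Sum>i\<in>I. Y (X i))}
     \<le> ennreal (exp (- t)) * (\<integral>\<^sup>+x. ennreal (exp (Y x)) \<partial>M) ^ card I"
proof -
  interpret prob_space M by fact
  interpret product_sigma_finite "\<lambda>_. M" by standard
  let ?P = "PiM I (\<lambda>_. M)"
  have "emeasure ?P {X \<in> space ?P. t \<le> (\<Sum>i\<in>I. Y (X i))}
      = emeasure ?P {X \<in> space ?P. 1 \<le> ennreal (exp (- t)) * (\<Prod>i\<in>I. ennreal (exp (Y (X i))))}"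
  proof (rule arg_cong[of _ _ "emeasure ?P"], rule Collect_cong, rule conj_cong[OF refl])
    fix X
    have "(\<Prod>i\<in>I. ennreal (exp (Y (X i)))) = ennreal (exp (\<Sum>i\<in>I. Y (X i)))"
      using I by (simp add: prod_ennreal exp_sum)
    hence "ennreal (exp (- t)) * (\<Prod>i\<in>I. ennreal (exp (Y (X i)))) = ennreal (exp (- t + (\<Sum>i\<in>I. Y (X i))))"
      unfolding exp_add by (simp add: ennreal_mult)
    thus "t \<le> (\<Sum>i\<in>I. Y (X i)) \<longleftrightarrow> 1 \<le> ennreal (exp (- t)) * (\<Prod>i\<in>I. ennreal (exp (Y (X i))))"
      by (simp add: one_le_exp_iff flip: ennreal_1)
  qed
  also have "\<dots> \<le> ennreal (exp (- t)) * (\<integral>\<^sup>+X. (\<Prod>i\<in>I. ennreal (exp (Y (X i)))) * indicator (space ?P) X \<partial>?P)"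
    using I by (intro nn_integral_Markov_inequality) auto
  also have "(\<integral>\<^sup>+X. (\<Prod>i\<in>I. ennreal (exp (Y (X i)))) * indicator (space ?P) X \<partial>?P) = (\<integral>\<^sup>+X. (\<Prod>i\<in>I. ennreal (exp (Y (X i)))) \<partial>?P)"
    by (intro nn_integral_cong) auto
  also have "\<dots> = (\<integral>\<^sup>+x. ennreal (exp (Y x)) \<partial>M) ^ card I"
    using I by (subst product_nn_integral_prod) auto
  finally show ?thesis .
qed

lemma swap_halves_distr:
  assumes M: "prob_space M" and E: "E \<subseteq> {1..n::nat}"
  defines "\<sigma> \<equiv> (\<lambda>i. if i \<in> E then i + n else if n < i \<and> i - n \<in> E then i - n else i)"
  shows "distr (PiM {1..2 * n} (\<lambda>_. M)) (PiM {1..2 * n} (\<lambda>_. M)) (\<lambda>Z. \<lambda>i\<in>{1..2 * n}. Z (\<sigma> i)) = PiM {1..2 * n} (\<lambda>_. M)"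
proof (rule distr_PiM_reindex)
  have inv: "\<sigma> (\<sigma> i) = i" for i
    using E unfolding \<sigma>_def by (auto split: if_splits)
  show "inj_on \<sigma> {1..2 * n}" by (rule inj_on_inverseI[of _ \<sigma>]) (rule inv)
  show "\<sigma> \<in> {1..2 * n} \<rightarrow> {1..2 * n}" using E unfolding \<sigma>_def by force
qed (use M in auto)

text \<open>\<open>H a\<close> stands for the squared Hellinger distance, of which only the two
  exponential moment bounds are used. Countability of \<open>F\<close> makes the rejection event
  measurable.\<close>

lemma uniform_type_I_error:
  "\<exists>B r. 0 < B \<and> 0 < r \<and> (\<forall>M b d n F (H :: (nat \<Rightarrow> real) \<Rightarrow> real) D.
     prob_space (M :: 'a measure) \<longrightarrow> d > 0 \<longrightarrow> (\<forall>j<d. b j \<in> borel_measurable M) \<longrightarrow> countable F \<longrightarrow>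
     B * real d \<le> D \<longrightarrow>
     (\<forall>a t. \<exists>a'. \<forall>x. (\<Sum>j<d. a' j * b j x) = (\<Sum>j<d. a j * b j x) - t) \<longrightarrow>
     (\<forall>a\<in>F. D \<le> real n * H a \<and>
        (\<integral>\<^sup>+x. ennreal (exp (tanh (\<Sum>j<d. a j * b j x) / 16)) \<partial>M) \<le> ennreal (exp (- 3 * H a / 256)) \<and>
        (\<integral>\<^sup>+x. ennreal (exp ((tanh (\<Sum>j<d. a j * b j x))\<^sup>2)) \<partial>M) \<le> ennreal (exp (2 * H a))) \<longrightarrow>
     emeasure (PiM {1..n} (\<lambda>_. M)) {X \<in> space (PiM {1..n} (\<lambda>_. M)). \<exists>a\<in>F.
        0 < (\<Sum>i\<in>{1..n}. tanh (\<Sum>j<d. a j * b j (X i)) - (tanh (\<Sum>j<d. a j * b j (X i)))\<^sup>2 / 16)}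
       \<le> ennreal (4 * exp (- r * D)))"
proof -
  obtain B r where B: "0 < B" and r: "0 < r" and Br: "\<And>d \<phi> n F D. d > 0 \<Longrightarrow> B * real d \<le> D \<Longrightarrow>
     (\<And>a t. \<exists>a'. \<forall>i. lin d \<phi> a' i = lin d \<phi> a i - t) \<Longrightarrow>
     real (card {E \<in> Pow {1..n}. \<exists>a\<in>F. ((\<Sum>i\<in>{1..2 * n}. (tanh (lin d \<phi> a i))\<^sup>2) + D) / 64
          \<le> (\<Sum>i\<in>{1..2 * n}. swap_sign n E i * tanh (lin d \<phi> a i))})
       \<le> 2 ^ n * (2 * exp (- r * D))"
    using linear_family_rademacher_peeled by blast
  \<comment> \<open>From \<open>512 \<le> D \<le> real n * H a\<close> it follows that each of the
    two failure events of the ghost sample has probability at most \<open>1 / 4\<close>.\<close>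
  define B' where "B' = max B 512"
  have B': "B' \<ge> B" "B' \<ge> 512" unfolding B'_def by auto
  have main: "emeasure (PiM {1..n} (\<lambda>_. M)) {X \<in> space (PiM {1..n} (\<lambda>_. M)). \<exists>a\<in>F.
        0 < (\<Sum>i\<in>{1..n}. tanh (\<Sum>j<d. a j * b j (X i)) - (tanh (\<Sum>j<d. a j * b j (X i)))\<^sup>2 / 16)}
       \<le> ennreal (4 * exp (- r * D))"
    if M: "prob_space M" and d: "d > 0" and b: "\<forall>j<d. b j \<in> borel_measurable M" and F: "countable F"
      and D: "B' * real d \<le> D"
      and const: "\<forall>a t. \<exists>a'. \<forall>x. (\<Sum>j<d. a' j * b j x) = (\<Sum>j<d. a j * b j x) - t"
      and H: "\<forall>a\<in>F. D \<le> real n * H a \<and>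
        (\<integral>\<^sup>+x. ennreal (exp (tanh (\<Sum>j<d. a j * b j x) / 16)) \<partial>M) \<le> ennreal (exp (- 3 * H a / 256)) \<and>
        (\<integral>\<^sup>+x. ennreal (exp ((tanh (\<Sum>j<d. a j * b j x))\<^sup>2)) \<partial>M) \<le> ennreal (exp (2 * H a))"
    for M :: "'a measure" and b d n F and H :: "(nat \<Rightarrow> real) \<Rightarrow> real" and D
  proof -
    define \<psi> where "\<psi> a x = tanh (\<Sum>j<d. a j * b j x)" for a x
    have [measurable]: "j < d \<Longrightarrow> b j \<in> borel_measurable M" for j using b by auto
    have tm[measurable]: "(tanh :: real \<Rightarrow> real) \<in> borel_measurable borel"
      by (intro borel_measurable_continuous_onI continuous_intros) auto
    have \<psi>[measurable]: "\<psi> a \<in> borel_measurable M" for a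
      unfolding \<psi>_def by (intro measurable_compose[OF _ tm] borel_measurable_sum borel_measurable_times) auto
    interpret prob_space M by fact
    interpret product_sigma_finite "\<lambda>_. M" by standard
    have "B' * 1 \<le> B' * real d" using B' d by (intro mult_left_mono) auto
    hence D512: "D \<ge> 512" using B' D by linarith
    have BD: "B * real d \<le> D" using B' D by (meson mult_right_mono of_nat_0_le_iff order_trans)
    define I where "I = {1..n}"
    define J where "J = {n + 1..2 * n}"
    have IJ: "I \<inter> J = {}" "finite I" "finite J" "I \<union> J = {1..2 * n}" unfolding I_def J_def by auto
    let ?P = "\<lambda>K. PiM K (\<lambda>_. M)"
    have pP: "prob_space (?P K)" for K :: "nat set" by (intro prob_space_PiM M)
    define A where "A = {X \<in> space (?P I). \<exists>a\<in>F. 0 < (\<Sum>i\<in>I. \<psi> a (X i) - (\<psi> a (X i))\<^sup>2 / 16)}"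
    \<comment> \<open>The symmetrized event: a difference of the two half sums in proportion to the
      sum of squares over both halves, with an offset \<open>D\<close>.\<close>
    define Q where "Q a Z \<longleftrightarrow> ((\<Sum>i\<in>{1..2 * n}. (\<psi> a (Z i))\<^sup>2) + D) / 64 \<le> (\<Sum>i\<in>{1..2 * n}. swap_sign n {} i * \<psi> a (Z i))" for a Z
    define A2 where "A2 = {Z \<in> space (?P {1..2 * n}). \<exists>a\<in>F. Q a Z}"
    have A: "A \<in> sets (?P I)"
    proof -
      have "A = (\<Union>a\<in>F. {X \<in> space (?P I). 0 < (\<Sum>i\<in>I. \<psi> a (X i) - (\<psi> a (X i))\<^sup>2 / 16)})" unfolding A_def by auto
      also have "\<dots> \<in> sets (?P I)" using F by (intro sets.countable_UN'') measurable
      finally show ?thesis .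
    qed
    have A2: "A2 \<in> sets (?P {1..2 * n})"
    proof -
      have "A2 = (\<Union>a\<in>F. {Z \<in> space (?P {1..2 * n}). Q a Z})" unfolding A2_def by auto
      also have "\<dots> \<in> sets (?P {1..2 * n})" unfolding Q_def using F by (intro sets.countable_UN'') measurable
      finally show ?thesis .
    qed
    have mg: "{Y \<in> space (?P J). merge I J (X, Y) \<in> A2} \<in> sets (?P J)" if X: "X \<in> space (?P I)" for X
    proof -
      have "(\<lambda>Y. merge I J (X, Y)) \<in> measurable (?P J) (?P {1..2 * n})"
        using measurable_compose[OF measurable_Pair1'[OF X] measurable_merge[of I J "\<lambda>_. M"]] unfolding IJ(4) .
      from measurable_sets[OF this A2] show ?thesis by (simp add: vimage_def Int_def conj_commute)
    qed
    have half: "ennreal (1 / 2) \<le> emeasure (?P J) {Y \<in> space (?P J). merge I J (X, Y) \<in> A2}" if X: "X \<in> A" for X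
    proof -
      interpret PJ: prob_space "?P J" by (rule pP)
      from X obtain a where a: "a \<in> F" "0 < (\<Sum>i\<in>I. \<psi> a (X i) - (\<psi> a (X i))\<^sup>2 / 16)" and Xs: "X \<in> space (?P I)"
        unfolding A_def by auto
      define h where "h = H a"
      have h: "D \<le> real n * h" "(\<integral>\<^sup>+x. ennreal (exp (\<psi> a x / 16)) \<partial>M) \<le> ennreal (exp (- 3 * h / 256))"
        "(\<integral>\<^sup>+x. ennreal (exp ((\<psi> a x)\<^sup>2)) \<partial>M) \<le> ennreal (exp (2 * h))"
        using H a(1) unfolding \<psi>_def h_def by auto
      have cJ: "card J = n" unfolding J_def by simp
      have four: "4 \<le> exp (2 :: real)"
      proof -
        have "2 \<le> exp (1 :: real)" using exp_ge_add_one_self[of 1] by simp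
        hence "2 * 2 \<le> exp 1 * exp (1 :: real)" by (intro mult_mono) auto
        thus ?thesis by (simp flip: exp_add)
      qed
      have small: "exp (- t) \<le> 1 / 4" if "t \<ge> 2" for t :: real
      proof -
        have "4 \<le> exp t" using four that by (meson exp_le_cancel_iff order_trans)
        hence "1 / exp t \<le> 1 / 4" by (intro divide_left_mono) auto
        thus ?thesis by (simp add: exp_minus inverse_eq_divide)
      qed
      define N1 where "N1 = {Y \<in> space (?P J). - (real n * h / 128) \<le> (\<Sum>i\<in>J. \<psi> a (Y i) / 16)}"
      define N2 where "N2 = {Y \<in> space (?P J). 4 * real n * h \<le> (\<Sum>i\<in>J. (\<psi> a (Y i))\<^sup>2)}"
      have Ns: "N1 \<in> sets (?P J)" "N2 \<in> sets (?P J)" unfolding N1_def N2_def by measurable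
      have pw: "ennreal (exp x) * (ennreal (exp y)) ^ n = ennreal (exp (x + real n * y))" for x y
        by (simp add: ennreal_power exp_add ennreal_mult flip: exp_of_nat_mult)
      have "emeasure (?P J) N1 \<le> ennreal (exp (real n * h / 128)) * (\<integral>\<^sup>+x. ennreal (exp (\<psi> a x / 16)) \<partial>M) ^ n"
        unfolding N1_def using iid_chernoff[OF M, of "\<lambda>x. \<psi> a x / 16" J "- (real n * h / 128)"] IJ cJ by simp
      also have "\<dots> \<le> ennreal (exp (real n * h / 128)) * (ennreal (exp (- 3 * h / 256))) ^ n"
        using h(2) by (intro mult_left_mono power_mono) auto
      also have "\<dots> \<le> ennreal (1 / 4)"
        unfolding pw using h(1) D512 small[of "real n * h / 256"] by (intro ennreal_leI) (simp add: algebra_simps)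
      finally have n1: "emeasure (?P J) N1 \<le> ennreal (1 / 4)" .
      have "emeasure (?P J) N2 \<le> ennreal (exp (- (4 * real n * h))) * (\<integral>\<^sup>+x. ennreal (exp ((\<psi> a x)\<^sup>2)) \<partial>M) ^ n"
        unfolding N2_def using iid_chernoff[OF M, of "\<lambda>x. (\<psi> a x)\<^sup>2" J "4 * real n * h"] IJ cJ by simp
      also have "\<dots> \<le> ennreal (exp (- (4 * real n * h))) * (ennreal (exp (2 * h))) ^ n"
        using h(3) by (intro mult_left_mono power_mono) auto
      also have "\<dots> \<le> ennreal (1 / 4)"
        unfolding pw using h(1) D512 small[of "2 * (real n * h)"] by (intro ennreal_leI) (simp add: algebra_simps)
      finally have n2: "emeasure (?P J) N2 \<le> ennreal (1 / 4)" .
      have "emeasure (?P J) (N1 \<union> N2) \<le> emeasure (?P J) N1 + emeasure (?P J) N2"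
        using Ns by (rule emeasure_subadditive)
      also have "\<dots> \<le> ennreal (1 / 4) + ennreal (1 / 4)" by (intro add_mono n1 n2)
      also have "\<dots> = ennreal (1 / 2)" by (simp flip: ennreal_plus)
      finally have "ennreal (PJ.prob (N1 \<union> N2)) \<le> ennreal (1 / 2)" unfolding PJ.emeasure_eq_measure .
      hence "PJ.prob (N1 \<union> N2) \<le> 1 / 2" by (subst (asm) ennreal_le_iff) auto
      hence "1 / 2 \<le> PJ.prob (space (?P J) - (N1 \<union> N2))"
        using Ns by (subst PJ.prob_compl) auto
      hence "ennreal (1 / 2) \<le> emeasure (?P J) (space (?P J) - (N1 \<union> N2))"
        unfolding PJ.emeasure_eq_measure by (rule ennreal_leI)
      also have "\<dots> \<le> emeasure (?P J) {Y \<in> space (?P J). merge I J (X, Y) \<in> A2}"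
      proof (rule emeasure_mono)
        show "{Y \<in> space (?P J). merge I J (X, Y) \<in> A2} \<in> sets (?P J)"
          using Xs by (rule mg)
        show "space (?P J) - (N1 \<union> N2) \<subseteq> {Y \<in> space (?P J). merge I J (X, Y) \<in> A2}"
        proof
          fix Y assume Y: "Y \<in> space (?P J) - (N1 \<union> N2)"
          define Z where "Z = merge I J (X, Y)"
          have Zs: "Z \<in> space (?P {1..2 * n})"
            unfolding Z_def IJ(4)[symmetric] using Xs Y by (auto simp: space_PiM PiE_def Pi_def merge_def extensional_def)
          have ZI: "Z i = X i" if "i \<in> {1..n}" for i using that unfolding Z_def merge_def I_def by auto
          have ZJ: "Z (i + n) = Y (i + n)" if "i \<in> {1..n}" for i using that unfolding Z_def merge_def I_def J_def by auto
          have sJ: "(\<Sum>i\<in>J. g i) = (\<Sum>i\<in>{1..n}. g (i + n))" for g :: "nat \<Rightarrow> real"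
            unfolding J_def using sum.shift_bounds_cl_nat_ivl[of g 1 n n] by (simp add: mult_2 add.commute)
          define s1 where "s1 = (\<Sum>i\<in>{1..n}. (\<psi> a (X i))\<^sup>2)"
          define s2 where "s2 = (\<Sum>i\<in>{1..n}. (\<psi> a (Y (i + n)))\<^sup>2)"
          define t1 where "t1 = (\<Sum>i\<in>{1..n}. \<psi> a (X i))"
          define t2 where "t2 = (\<Sum>i\<in>{1..n}. \<psi> a (Y (i + n)))"
          have e1: "(\<Sum>i\<in>{1..2 * n}. (\<psi> a (Z i))\<^sup>2) = s1 + s2"
            unfolding sum_halves s1_def s2_def sum.distrib[symmetric] by (intro sum.cong refl) (simp add: ZI ZJ)
          have e2: "(\<Sum>i\<in>{1..2 * n}. swap_sign n {} i * \<psi> a (Z i)) = t1 - t2"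
            unfolding sum_swap_sign t1_def t2_def sum_subtractf[symmetric] by (intro sum.cong refl) (simp add: ZI ZJ)
          have "t1 > s1 / 16" using a(2) unfolding I_def t1_def s1_def by (simp add: sum_subtractf sum_divide_distrib)
          moreover have "t2 / 16 < - (real n * h / 128)"
            using Y unfolding N1_def t2_def sJ by (auto simp: sum_divide_distrib)
          moreover have "s2 < 4 * real n * h" using Y unfolding N2_def s2_def sJ by auto
          moreover have "s1 \<ge> 0" unfolding s1_def by (intro sum_nonneg) auto
          \<comment> \<open>The left side is below \<open>s1 / 64 + 5 * v / 64\<close>, and the
            right side exceeds \<open>s1 / 16 + v / 8\<close>.\<close>
          moreover have "(s1 + s2 + D) / 64 \<le> t1 - t2"
            if "s1 / 16 < t1" "t2 / 16 < - (v / 128)" "s2 < 4 * v" "0 \<le> s1" "D \<le> v" for v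
            using that D512 by (simp add: field_simps)
          ultimately have "(s1 + s2 + D) / 64 \<le> t1 - t2" using h(1) by (metis mult.assoc)
          hence "Q a Z" unfolding Q_def e1 e2 .
          thus "Y \<in> {Y \<in> space (?P J). merge I J (X, Y) \<in> A2}"
            unfolding A2_def using a(1) Zs Y unfolding Z_def by auto
        qed
      qed
      finally show ?thesis .
    qed
    have ind[measurable]: "(\<lambda>Z. indicator A2 Z :: ennreal) \<in> borel_measurable (?P (I \<union> J))"
      using A2 IJ(4) by auto
    have "ennreal (1 / 2) * emeasure (?P I) A = (\<integral>\<^sup>+X. ennreal (1 / 2) * indicator A X \<partial>?P I)"
      using A by (simp add: nn_integral_cmult_indicator)
    also have "\<dots> \<le> (\<integral>\<^sup>+X. \<integral>\<^sup>+Y. indicator A2 (merge I J (X, Y)) \<partial>?P J \<partial>?P I)"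
    proof (rule nn_integral_mono)
      fix X assume X: "X \<in> space (?P I)"
      show "ennreal (1 / 2) * indicator A X \<le> (\<integral>\<^sup>+Y. indicator A2 (merge I J (X, Y)) \<partial>?P J)"
      proof (cases "X \<in> A")
        case True
        have meas: "{Y \<in> space (?P J). merge I J (X, Y) \<in> A2} \<in> sets (?P J)"
          using X by (rule mg)
        have "ennreal (1 / 2) * indicator A X \<le> emeasure (?P J) {Y \<in> space (?P J). merge I J (X, Y) \<in> A2}"
          using half[OF True] True by simp
        also have "\<dots> = (\<integral>\<^sup>+Y. indicator {Y \<in> space (?P J). merge I J (X, Y) \<in> A2} Y \<partial>?P J)"
          using meas by simp
        also have "\<dots> = (\<integral>\<^sup>+Y. indicator A2 (merge I J (X, Y)) \<partial>?P J)"
          by (intro nn_integral_cong) (auto simp: indicator_def)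
        finally show ?thesis .
      qed simp
    qed
    also have "\<dots> = (\<integral>\<^sup>+Z. indicator A2 Z \<partial>?P (I \<union> J))"
      by (rule product_nn_integral_fold[symmetric]) (use IJ ind in auto)
    also have "\<dots> = emeasure (?P {1..2 * n}) A2" unfolding IJ(4) using A2 by simp
    finally have sym: "ennreal (1 / 2) * emeasure (?P I) A \<le> emeasure (?P {1..2 * n}) A2" .
    define \<sigma> where "\<sigma> E i = (if i \<in> E then i + n else if n < i \<and> i - n \<in> E then i - n else i)" for E and i :: nat
    define T where "T E Z = (\<lambda>i\<in>{1..2 * n}. Z (\<sigma> E i))" for E and Z :: "nat \<Rightarrow> 'a"
    have \<sigma>r: "\<sigma> E i \<in> {1..2 * n}" if "E \<subseteq> {1..n}" "i \<in> {1..2 * n}" for E i using that unfolding \<sigma>_def by force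
    have Tm: "T E \<in> measurable (?P {1..2 * n}) (?P {1..2 * n})" if "E \<subseteq> {1..n}" for E
      unfolding T_def using \<sigma>r[OF that] by (intro measurable_restrict measurable_component_singleton) auto
    \<comment> \<open>The law of the double sample is invariant under swaps. Averaging over all
      \<open>E\<close> turns the probability of \<open>A2\<close> into the mean proportion of bad
      sign vectors for a fixed \<open>Z\<close>, a purely combinatorial quantity.\<close>
    have inv: "emeasure (?P {1..2 * n}) A2 = (\<integral>\<^sup>+Z. indicator A2 (T E Z) \<partial>?P {1..2 * n})" if E: "E \<subseteq> {1..n}" for E
    proof -
      have "emeasure (?P {1..2 * n}) A2 = (\<integral>\<^sup>+Z. indicator A2 Z \<partial>distr (?P {1..2 * n}) (?P {1..2 * n}) (T E))"
        using A2 swap_halves_distr[OF M E] unfolding T_def \<sigma>_def by simp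
      also have "\<dots> = (\<integral>\<^sup>+Z. indicator A2 (T E Z) \<partial>?P {1..2 * n})"
        by (rule nn_integral_distr[OF Tm[OF E]]) (use A2 in auto)
      finally show ?thesis .
    qed
    have "of_nat (2 ^ n) * emeasure (?P {1..2 * n}) A2 = (\<Sum>E\<in>Pow {1..n}. emeasure (?P {1..2 * n}) A2)"
      by (simp add: card_Pow)
    also have "\<dots> = (\<Sum>E\<in>Pow {1..n}. \<integral>\<^sup>+Z. indicator A2 (T E Z) \<partial>?P {1..2 * n})"
      using inv by (intro sum.cong) auto
    also have "\<dots> = (\<integral>\<^sup>+Z. (\<Sum>E\<in>Pow {1..n}. indicator A2 (T E Z)) \<partial>?P {1..2 * n})"
    proof (rule nn_integral_sum[symmetric])
      fix E assume "E \<in> Pow {1..n}"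
      hence E: "E \<subseteq> {1..n}" by auto
      show "(\<lambda>Z. indicator A2 (T E Z) :: ennreal) \<in> borel_measurable (?P {1..2 * n})"
        by (rule measurable_compose[OF Tm[OF E] borel_measurable_indicator[OF A2]])
    qed
    also have "\<dots> \<le> (\<integral>\<^sup>+Z. ennreal (2 ^ n * (2 * exp (- r * D))) \<partial>?P {1..2 * n})"
    proof (rule nn_integral_mono)
      fix Z assume Z: "Z \<in> space (?P {1..2 * n})"
      \<comment> \<open>For fixed data the functions are seen only through their values at the
        sample points, which form a linear family in the index \<open>i\<close>.\<close>
      define \<phi> where "\<phi> i j = b j (Z i)" for i j
      have lin: "\<psi> a (Z i) = tanh (lin d \<phi> a i)" for a i unfolding \<psi>_def lin_def \<phi>_def ..
      have const': "\<exists>a'. \<forall>i. lin d \<phi> a' i = lin d \<phi> a i - t" for a t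
      proof -
        from const[rule_format, of a t] obtain a' where
          a': "\<forall>x. (\<Sum>j<d. a' j * b j x) = (\<Sum>j<d. a j * b j x) - t" by (elim exE)
        show ?thesis unfolding lin_def \<phi>_def by (rule exI[of _ a']) (simp add: a')
      qed
      have "Q a (T E Z) \<longleftrightarrow> ((\<Sum>i\<in>{1..2 * n}. (tanh (lin d \<phi> a i))\<^sup>2) + D) / 64
          \<le> (\<Sum>i\<in>{1..2 * n}. swap_sign n E i * tanh (lin d \<phi> a i))" if E: "E \<subseteq> {1..n}" for E a
      proof -
        have t1: "T E Z i = (if i \<in> E then Z (i + n) else Z i)" if "i \<in> {1..n}" for i
          using that unfolding T_def \<sigma>_def by auto
        have t2: "T E Z (i + n) = (if i \<in> E then Z i else Z (i + n))" if "i \<in> {1..n}" for i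
          using that E unfolding T_def \<sigma>_def by force
        have "(\<Sum>i\<in>{1..2 * n}. (\<psi> a (T E Z i))\<^sup>2) = (\<Sum>i\<in>{1..2 * n}. (\<psi> a (Z i))\<^sup>2)"
          unfolding sum_halves by (intro sum.cong refl) (simp add: t1 t2)
        moreover have "(\<Sum>i\<in>{1..2 * n}. swap_sign n {} i * \<psi> a (T E Z i)) = (\<Sum>i\<in>{1..2 * n}. swap_sign n E i * \<psi> a (Z i))"
          unfolding sum_swap_sign by (intro sum.cong refl) (simp add: t1 t2)
        ultimately show ?thesis unfolding Q_def by (simp add: lin)
      qed
      hence "E \<in> Pow {1..n} \<Longrightarrow> T E Z \<in> A2 \<Longrightarrow> E \<in> {E \<in> Pow {1..n}. \<exists>a\<in>F. ((\<Sum>i\<in>{1..2 * n}. (tanh (lin d \<phi> a i))\<^sup>2) + D) / 64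
          \<le> (\<Sum>i\<in>{1..2 * n}. swap_sign n E i * tanh (lin d \<phi> a i))}" for E
        unfolding A2_def by auto
      hence "card {E \<in> Pow {1..n}. T E Z \<in> A2} \<le> card {E \<in> Pow {1..n}. \<exists>a\<in>F. ((\<Sum>i\<in>{1..2 * n}. (tanh (lin d \<phi> a i))\<^sup>2) + D) / 64
          \<le> (\<Sum>i\<in>{1..2 * n}. swap_sign n E i * tanh (lin d \<phi> a i))}"
        by (intro card_mono) auto
      hence le: "real (card {E \<in> Pow {1..n}. T E Z \<in> A2}) \<le> 2 ^ n * (2 * exp (- r * D))"
        using Br[OF d BD const', of n F] by linarith
      have eq: "(\<Sum>E\<in>Pow {1..n}. indicator A2 (T E Z)) = ennreal (real (card {E \<in> Pow {1..n}. T E Z \<in> A2}))"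
        by (simp add: indicator_def sum.If_cases Int_def ennreal_of_nat_eq_real_of_nat)
      show "(\<Sum>E\<in>Pow {1..n}. indicator A2 (T E Z)) \<le> ennreal (2 ^ n * (2 * exp (- r * D)))"
        unfolding eq by (rule ennreal_leI[OF le])
    qed
    also have "\<dots> = ennreal (2 ^ n * (2 * exp (- r * D)))"
      using prob_space.emeasure_space_1[OF pP] by simp
    finally have "ennreal (2 ^ n) * emeasure (?P {1..2 * n}) A2 \<le> ennreal (2 ^ n) * ennreal (2 * exp (- r * D))"
      by (simp add: ennreal_mult ennreal_of_nat_eq_real_of_nat)
    hence A2le: "emeasure (?P {1..2 * n}) A2 \<le> ennreal (2 * exp (- r * D))"
      by (subst (asm) ennreal_mult_le_mult_iff) auto
    have two: "ennreal 2 * ennreal (1 / 2) = 1" using ennreal_mult[of 2 "1 / 2"] by simp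
    have "emeasure (?P I) A = ennreal 2 * (ennreal (1 / 2) * emeasure (?P I) A)"
      unfolding mult.assoc[symmetric] two by simp
    also have "\<dots> \<le> ennreal 2 * ennreal (2 * exp (- r * D))"
      using order_trans[OF sym A2le] by (intro mult_left_mono) auto
    also have "\<dots> = ennreal (2 * (2 * exp (- r * D)))" by (rule ennreal_mult[symmetric]) auto
    also have "\<dots> = ennreal (4 * exp (- r * D))" by simp
    finally show ?thesis unfolding A_def I_def \<psi>_def .
  qed
  show ?thesis
    by (rule exI[of _ B'], rule exI[of _ r]) (use B'(1) B r main in \<open>auto intro: less_le_trans\<close>)
qed

section \<open>Hellinger distance and log likelihood ratios\<close>

abbreviation unit_lebesgue :: "real measure" where
  "unit_lebesgue \<equiv> restrict_space lborel {0..1}"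

lemma exp_quadratic_upper: "\<bar>y\<bar> \<le> 1 \<Longrightarrow> exp y \<le> 1 + y + y\<^sup>2" for y :: real
proof (cases "y \<ge> 0")
  case True
  assume "\<bar>y\<bar> \<le> 1"
  thus ?thesis using exp_bound[of y] True by simp
next
  case False
  assume "\<bar>y\<bar> \<le> 1"
  have "1 \<le> (1 + y + y\<^sup>2) * (1 - y)"
  proof -
    have "(1 + y + y\<^sup>2) * (1 - y) = 1 + (- y) * y\<^sup>2" by (simp add: power2_eq_square algebra_simps)
    moreover have "(- y) * y\<^sup>2 \<ge> 0" using False by (intro mult_nonneg_nonneg) auto
    ultimately show ?thesis by linarith
  qed
  also have "\<dots> \<le> (1 + y + y\<^sup>2) * exp (- y)"
  proof (intro mult_left_mono)
    show "1 - y \<le> exp (- y)" using exp_ge_add_one_self[of "- y"] by simp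
    show "0 \<le> 1 + y + y\<^sup>2" using \<open>\<bar>y\<bar> \<le> 1\<close> by (smt (verit) zero_le_power2)
  qed
  finally show ?thesis by (simp add: exp_minus field_simps)
qed

text \<open>\<open>exp y + exp (- y) - 2\<close> equals \<open>exp y\<close> times the square of
  \<open>1 - exp (- y)\<close>, so the excess over 2 is of second order.\<close>

lemma exp_sum_inverse_le:
  fixes y r :: real
  assumes "\<bar>y\<bar> \<le> r"
  shows "exp y + exp (- y) \<le> 2 + r\<^sup>2 * exp r"
proof -
  have *: "exp y + exp (- y) - 2 \<le> y\<^sup>2 * exp y" if "y \<ge> 0" for y :: real
  proof -
    have "1 - exp (- y) \<le> y" "0 \<le> 1 - exp (- y)" using exp_ge_add_one_self[of "- y"] that by auto
    hence "(1 - exp (- y))\<^sup>2 \<le> y\<^sup>2" by (intro power_mono) auto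
    hence "exp y * (1 - exp (- y))\<^sup>2 \<le> exp y * y\<^sup>2" by (intro mult_left_mono) auto
    moreover have "exp y * (1 - exp (- y))\<^sup>2 = exp y + exp (- y) - 2"
    proof -
      have "exp y * exp (- y) = 1" by (simp add: exp_minus)
      moreover have "exp y * (1 - exp (- y))\<^sup>2 = exp y - 2 * (exp y * exp (- y)) + (exp y * exp (- y)) * exp (- y)"
        by (simp add: power2_eq_square algebra_simps)
      ultimately show ?thesis by simp
    qed
    ultimately show ?thesis by (simp add: mult.commute)
  qed
  have "\<bar>y\<bar>\<^sup>2 * exp \<bar>y\<bar> \<le> r\<^sup>2 * exp r" using assms by (intro mult_mono power_mono) auto
  moreover have "exp y + exp (- y) = exp \<bar>y\<bar> + exp (- \<bar>y\<bar>)" by (cases "y \<ge> 0") auto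
  ultimately show ?thesis using *[of "\<bar>y\<bar>"] by simp
qed

lemma tanh_log_ratio:
  fixes p p0 :: real
  assumes "p > 0" "p0 > 0"
  shows "tanh ((ln p - ln p0) / 4) * (sqrt p + sqrt p0) = sqrt p - sqrt p0"
proof -
  define v where "v = sqrt p"
  define w where "w = sqrt p0"
  have vw: "v > 0" "w > 0" unfolding v_def w_def using assms by auto
  have "- 2 * ((ln p - ln p0) / 4) = ln w - ln v" unfolding v_def w_def using assms by (simp add: ln_sqrt field_simps)
  hence "exp (- 2 * ((ln p - ln p0) / 4)) = exp (ln w - ln v)" by (rule arg_cong)
  hence "exp (- 2 * ((ln p - ln p0) / 4)) = w / v" using vw by (simp only: exp_diff exp_ln)
  hence "tanh ((ln p - ln p0) / 4) = (1 - w / v) / (1 + w / v)" unfolding tanh_real_altdef by simp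
  also have "\<dots> = ((1 - w / v) * v) / ((1 + w / v) * v)" using vw by simp
  also have "\<dots> = (v - w) / (v + w)" using vw by (simp add: algebra_simps)
  finally show ?thesis using vw unfolding v_def[symmetric] w_def[symmetric] by simp
qed

text \<open>With \<open>t = (\<surd>p - \<surd>p0) / (\<surd>p + \<surd>p0)\<close> these bound the mean of \<open>t\<close> and of \<open>t\<^sup>2\<close> under both
  \<open>p0\<close> and \<open>p\<close>; the terms linear in \<open>p - p0\<close> integrate to zero.\<close>

lemma tanh_log_ratio_bounds:
  fixes p p0 :: real
  assumes p: "p > 0" "p0 > 0"
  defines "t \<equiv> tanh ((ln p - ln p0) / 4)"
  shows "p0 * t \<le> (p - p0) / 4 - (sqrt p - sqrt p0)\<^sup>2 / 4"
    "p * t \<ge> (p - p0) / 4 + (sqrt p - sqrt p0)\<^sup>2 / 4"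
    "p0 * t\<^sup>2 \<le> (sqrt p - sqrt p0)\<^sup>2" "p * t\<^sup>2 \<le> (sqrt p - sqrt p0)\<^sup>2"
proof -
  define v where "v = sqrt p"
  define w where "w = sqrt p0"
  have vw: "v > 0" "w > 0" "p = v\<^sup>2" "p0 = w\<^sup>2" unfolding v_def w_def using p by auto
  have t: "t * (v + w) = v - w" using tanh_log_ratio[OF p] unfolding t_def v_def w_def .
  have pos: "t * (v - w) \<ge> 0"
    unfolding t[symmetric] using vw by (simp add: mult.assoc[symmetric])
  have e: "(v\<^sup>2 - w\<^sup>2) / 4 - (v - w)\<^sup>2 / 4 = w * (v - w) / 2" "(v\<^sup>2 - w\<^sup>2) / 4 + (v - w)\<^sup>2 / 4 = v * (v - w) / 2"
    by (simp_all add: power2_eq_square field_simps)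
  have "w * (t * (v + w)) / 2 - w\<^sup>2 * t = w * (t * (v - w)) / 2"
    by (simp add: power2_eq_square field_simps)
  hence "w * (v - w) / 2 - w\<^sup>2 * t = w * (t * (v - w)) / 2" unfolding t .
  moreover have "w * (t * (v - w)) / 2 \<ge> 0" using pos vw by simp
  ultimately have "w\<^sup>2 * t \<le> w * (v - w) / 2" by linarith
  thus "p0 * t \<le> (p - p0) / 4 - (sqrt p - sqrt p0)\<^sup>2 / 4"
    unfolding v_def[symmetric] w_def[symmetric] unfolding vw(3,4) e .
  have "v\<^sup>2 * t - v * (t * (v + w)) / 2 = v * (t * (v - w)) / 2"
    by (simp add: power2_eq_square field_simps)
  hence "v\<^sup>2 * t - v * (v - w) / 2 = v * (t * (v - w)) / 2" unfolding t .
  moreover have "v * (t * (v - w)) / 2 \<ge> 0" using pos vw by simp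
  ultimately have "v\<^sup>2 * t \<ge> v * (v - w) / 2" by linarith
  thus "p * t \<ge> (p - p0) / 4 + (sqrt p - sqrt p0)\<^sup>2 / 4"
    unfolding v_def[symmetric] w_def[symmetric] unfolding vw(3,4) e .
  have "w\<^sup>2 * t\<^sup>2 \<le> (v + w)\<^sup>2 * t\<^sup>2" "v\<^sup>2 * t\<^sup>2 \<le> (v + w)\<^sup>2 * t\<^sup>2"
    using vw by (intro mult_right_mono power_mono; simp)+
  moreover have "(v + w)\<^sup>2 * t\<^sup>2 = (v - w)\<^sup>2" unfolding t[symmetric] by (simp add: power_mult_distrib mult.commute)
  ultimately show "p0 * t\<^sup>2 \<le> (sqrt p - sqrt p0)\<^sup>2" "p * t\<^sup>2 \<le> (sqrt p - sqrt p0)\<^sup>2"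
    unfolding v_def[symmetric] w_def[symmetric] unfolding vw(3,4) by simp_all
qed

text \<open>Second order expansion of \<open>exp\<close>. In the first bound the linear term yields
  \<open>- h / 64\<close> and the square at most \<open>h / 256\<close>. In the third, the linear
  term yields \<open>- h / 128\<close>, and the square of \<open>t\<close> collects
  \<open>1 / 512\<close> from the correction inside the statistic and \<open>1 / 512\<close> from
  the expansion, hence at most \<open>h / 256\<close>.\<close>

lemma log_ratio_exp_bounds:
  fixes p p0 :: real
  assumes p: "p > 0" "p0 > 0"
  defines "t \<equiv> tanh ((ln p - ln p0) / 4)" and "h \<equiv> (sqrt p - sqrt p0)\<^sup>2"
  shows "p0 * exp (t / 16) \<le> p0 + (p - p0) / 64 - 3 * h / 256"
    "p0 * exp (t\<^sup>2) \<le> p0 + 2 * h"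
    "p * exp (- ((t - t\<^sup>2 / 16) / 32)) \<le> p - (p - p0) / 128 - h / 256"
proof -
  note b = tanh_log_ratio_bounds[OF p, folded t_def h_def]
  have t1: "\<bar>t\<bar> \<le> 1" unfolding t_def using tanh_real_bounds[of "(ln p - ln p0) / 4"] by auto
  have t2: "t\<^sup>2 \<le> 1" "t\<^sup>2 \<ge> 0" using t1 by (auto simp: abs_square_le_1)
  have "exp (t / 16) \<le> 1 + t / 16 + (t / 16)\<^sup>2" using t1 by (intro exp_quadratic_upper) auto
  hence "p0 * exp (t / 16) \<le> p0 * (1 + t / 16 + (t / 16)\<^sup>2)" using p by (intro mult_left_mono) auto
  also have "\<dots> = p0 + p0 * t / 16 + p0 * t\<^sup>2 / 256" by (simp add: power2_eq_square algebra_simps)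
  also have "\<dots> \<le> p0 + (p - p0) / 64 - 3 * h / 256" using b(1,3) by simp
  finally show "p0 * exp (t / 16) \<le> p0 + (p - p0) / 64 - 3 * h / 256" .
  have "(t\<^sup>2)\<^sup>2 \<le> t\<^sup>2" using t2 mult_left_mono[of "t\<^sup>2" 1 "t\<^sup>2"] by (simp add: power2_eq_square)
  moreover have "exp (t\<^sup>2) \<le> 1 + t\<^sup>2 + (t\<^sup>2)\<^sup>2" using t2 by (intro exp_quadratic_upper) auto
  ultimately have "exp (t\<^sup>2) \<le> 1 + 2 * t\<^sup>2" by linarith
  hence "p0 * exp (t\<^sup>2) \<le> p0 * (1 + 2 * t\<^sup>2)" using p by (intro mult_left_mono) auto
  also have "\<dots> \<le> p0 + 2 * h" using b(3) by (simp add: algebra_simps)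
  finally show "p0 * exp (t\<^sup>2) \<le> p0 + 2 * h" .
  define c where "c = t - t\<^sup>2 / 16"
  have ct: "c = t * (1 - t / 16)" unfolding c_def by (simp add: power2_eq_square algebra_simps)
  have "\<bar>1 - t / 16\<bar> \<le> 17 / 16" using t1 by linarith
  hence "(1 - t / 16)\<^sup>2 \<le> (17 / 16)\<^sup>2" by (metis abs_ge_zero power2_abs power_mono)
  hence "(1 - t / 16)\<^sup>2 \<le> 2" by (simp add: power2_eq_square)
  hence c2: "c\<^sup>2 \<le> 2 * t\<^sup>2" unfolding ct power_mult_distrib using mult_left_mono[of "(1 - t / 16)\<^sup>2" 2 "t\<^sup>2"] by (simp add: mult.commute)
  have "\<bar>c\<bar> \<le> 2" unfolding c_def using t1 t2 by linarith
  hence "exp (- (c / 32)) \<le> 1 + (- (c / 32)) + (- (c / 32))\<^sup>2" by (intro exp_quadratic_upper) auto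
  also have "\<dots> \<le> 1 - t / 32 + t\<^sup>2 / 256" using c2 unfolding c_def[symmetric]
    by (simp add: power_divide) (simp add: c_def field_simps)
  finally have "p * exp (- (c / 32)) \<le> p * (1 - t / 32 + t\<^sup>2 / 256)" using p by (intro mult_left_mono) auto
  also have "\<dots> = p - p * t / 32 + p * t\<^sup>2 / 256" by (simp add: algebra_simps)
  also have "\<dots> \<le> p - (p - p0) / 128 - h / 256" using b(2,4) by simp
  finally show "p * exp (- ((t - t\<^sup>2 / 16) / 32)) \<le> p - (p - p0) / 128 - h / 256" unfolding c_def .
qed

definition bounded_density :: "(real \<Rightarrow> real) \<Rightarrow> bool" where
  "bounded_density p \<longleftrightarrow> (\<forall>x\<in>{0..1}. p x > 0) \<and> p \<in> borel_measurable unit_lebesgue \<and>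
     (\<exists>K. \<forall>x\<in>{0..1}. p x \<le> K) \<and> (\<integral>x. p x \<partial>unit_lebesgue) = 1"

lemma space_unit_lebesgue [simp]: "space unit_lebesgue = {0..1}"
  by (simp add: space_restrict_space)

lemma finite_measure_unit_lebesgue: "finite_measure unit_lebesgue"
  by (rule finite_measureI) (simp add: emeasure_restrict_space)

lemma measure01_simps [simp]: "space (measure01 p) = {0..1}" "sets (measure01 p) = sets unit_lebesgue"
  by (simp_all add: measure01_def)

lemma integrable_unit_bounded:
  fixes g :: "real \<Rightarrow> real"
  assumes "g \<in> borel_measurable unit_lebesgue" "\<And>x. x \<in> {0..1} \<Longrightarrow> \<bar>g x\<bar> \<le> K"
  shows "integrable unit_lebesgue g"
proof -
  interpret finite_measure unit_lebesgue by (rule finite_measure_unit_lebesgue)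
  show ?thesis using assms by (intro integrable_const_bound[of _ K]) auto
qed

lemma bounded_density_integrable: "bounded_density p \<Longrightarrow> integrable unit_lebesgue p"
proof -
  assume p: "bounded_density p"
  then obtain K where "\<forall>x\<in>{0..1}. p x \<le> K" unfolding bounded_density_def by auto
  thus ?thesis using p unfolding bounded_density_def
    by (intro integrable_unit_bounded[of _ K]) (auto simp: abs_of_pos)
qed

definition hellinger_square :: "(real \<Rightarrow> real) \<Rightarrow> (real \<Rightarrow> real) \<Rightarrow> real" where
  "hellinger_square p r = (\<integral>x. (sqrt (p x) - sqrt (r x))\<^sup>2 \<partial>unit_lebesgue)"

lemma hellinger_eq: "hellinger p r = sqrt (hellinger_square p r)"
  unfolding hellinger_def hellinger_square_def set_lebesgue_integral_def
  by (subst integral_restrict_space) auto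

lemma hellinger_square_nonneg: "hellinger_square p r \<ge> 0"
  unfolding hellinger_square_def by (rule Bochner_Integration.integral_nonneg) simp

lemma integrable_hellinger:
  assumes "bounded_density p" "bounded_density p0"
  shows "integrable unit_lebesgue (\<lambda>x. (sqrt (p x) - sqrt (p0 x))\<^sup>2)"
proof (rule Bochner_Integration.integrable_bound)
  show "integrable unit_lebesgue (\<lambda>x. p x + p0 x)"
    using assms by (intro Bochner_Integration.integrable_add bounded_density_integrable)
  have [measurable]: "p \<in> borel_measurable unit_lebesgue" "p0 \<in> borel_measurable unit_lebesgue"
    using assms unfolding bounded_density_def by auto
  show "(\<lambda>x. (sqrt (p x) - sqrt (p0 x))\<^sup>2) \<in> borel_measurable unit_lebesgue" by measurable
  show "AE x in unit_lebesgue. norm ((sqrt (p x) - sqrt (p0 x))\<^sup>2) \<le> norm (p x + p0 x)"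
  proof (rule AE_I2)
    fix x assume "x \<in> space unit_lebesgue"
    hence pos: "p x > 0" "p0 x > 0" using assms unfolding bounded_density_def by auto
    have "(sqrt (p x) - sqrt (p0 x))\<^sup>2 = p x + p0 x - 2 * (sqrt (p x) * sqrt (p0 x))"
      using pos by (simp add: power2_diff)
    moreover have "sqrt (p x) * sqrt (p0 x) \<ge> 0" using pos by simp
    ultimately have "(sqrt (p x) - sqrt (p0 x))\<^sup>2 \<le> p x + p0 x" by linarith
    thus "norm ((sqrt (p x) - sqrt (p0 x))\<^sup>2) \<le> norm (p x + p0 x)" using pos by simp
  qed
qed

lemma nn_integral_measure01:
  assumes p: "bounded_density p0" and g: "g \<in> borel_measurable unit_lebesgue" "\<And>x. x \<in> {0..1} \<Longrightarrow> g x \<ge> 0"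
    and G: "integrable unit_lebesgue G" "\<And>x. x \<in> {0..1} \<Longrightarrow> p0 x * g x \<le> G x"
  shows "(\<integral>\<^sup>+x. ennreal (g x) \<partial>measure01 p0) \<le> ennreal (\<integral>x. G x \<partial>unit_lebesgue)"
proof -
  have [measurable]: "p0 \<in> borel_measurable unit_lebesgue" using p unfolding bounded_density_def by auto
  have p0: "p0 x > 0" if "x \<in> {0..1}" for x using p that unfolding bounded_density_def by auto
  have "(\<integral>\<^sup>+x. ennreal (g x) \<partial>measure01 p0) = (\<integral>\<^sup>+x. ennreal (p0 x) * ennreal (g x) \<partial>unit_lebesgue)"
    unfolding measure01_def using g(1) by (intro nn_integral_density) auto
  also have "\<dots> \<le> (\<integral>\<^sup>+x. ennreal (G x) \<partial>unit_lebesgue)"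
  proof (rule nn_integral_mono)
    fix x assume "x \<in> space unit_lebesgue"
    hence x: "x \<in> {0..1}" by simp
    show "ennreal (p0 x) * ennreal (g x) \<le> ennreal (G x)"
      using p0[OF x] g(2)[OF x] G(2)[OF x] by (simp add: ennreal_leI flip: ennreal_mult)
  qed
  also have "\<dots> = ennreal (\<integral>x. G x \<partial>unit_lebesgue)"
  proof (rule nn_integral_eq_integral[OF G(1)], rule AE_I2)
    fix x assume "x \<in> space unit_lebesgue"
    hence x: "x \<in> {0..1}" by simp
    have "0 \<le> p0 x * g x" using p0[OF x] g(2)[OF x] by simp
    thus "0 \<le> G x" using G(2)[OF x] by linarith
  qed
  finally show ?thesis .
qed

lemma borel_measurable_tanh [measurable]: "(tanh :: real \<Rightarrow> real) \<in> borel_measurable borel"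
  by (intro borel_measurable_continuous_onI continuous_intros) auto

context
  fixes p p0 :: "real \<Rightarrow> real"
  assumes p: "bounded_density p" and p0: "bounded_density p0"
begin

lemma density_measurable: "p \<in> borel_measurable unit_lebesgue" "p0 \<in> borel_measurable unit_lebesgue"
  using p p0 unfolding bounded_density_def by auto

lemma density_pos: "x \<in> {0..1} \<Longrightarrow> p x > 0" "x \<in> {0..1} \<Longrightarrow> p0 x > 0"
  using p p0 unfolding bounded_density_def by auto

lemma density_integral: "(\<integral>x. p x \<partial>unit_lebesgue) = 1" "(\<integral>x. p0 x \<partial>unit_lebesgue) = 1"
  using p p0 unfolding bounded_density_def by auto

text \<open>Every pointwise majorant below is such a combination, so its integral is explicit and
  multiples of \<open>p - p0\<close> vanish.\<close>

lemma integral_density_combination: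
  "integrable unit_lebesgue (\<lambda>x. a * p x + b * p0 x + c * (sqrt (p x) - sqrt (p0 x))\<^sup>2)"
  "(\<integral>x. a * p x + b * p0 x + c * (sqrt (p x) - sqrt (p0 x))\<^sup>2 \<partial>unit_lebesgue) = a + b + c * hellinger_square p p0"
  using bounded_density_integrable[OF p] bounded_density_integrable[OF p0] integrable_hellinger[OF p p0] density_integral
  unfolding hellinger_square_def by auto

abbreviation "\<tau> x \<equiv> tanh ((ln (p x) - ln (p0 x)) / 4)"

lemma log_ratio_mgf:
  "(\<integral>\<^sup>+x. ennreal (exp (\<tau> x / 16)) \<partial>measure01 p0) \<le> ennreal (exp (- 3 * hellinger_square p p0 / 256))"
proof -
  note density_measurable[measurable]
  have "(\<integral>\<^sup>+x. ennreal (exp (\<tau> x / 16)) \<partial>measure01 p0)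
      \<le> ennreal (\<integral>x. 1 / 64 * p x + 63 / 64 * p0 x + (- 3 / 256) * (sqrt (p x) - sqrt (p0 x))\<^sup>2 \<partial>unit_lebesgue)"
  proof (rule nn_integral_measure01[OF p0 _ _ integral_density_combination(1)])
    fix x :: real assume x: "x \<in> {0..1}"
    show "p0 x * exp (\<tau> x / 16) \<le> 1 / 64 * p x + 63 / 64 * p0 x + (- 3 / 256) * (sqrt (p x) - sqrt (p0 x))\<^sup>2"
      using log_ratio_exp_bounds(1)[OF density_pos[OF x]] by (simp add: field_simps)
  qed auto
  also have "\<dots> \<le> ennreal (exp (- 3 * hellinger_square p p0 / 256))"
    unfolding integral_density_combination
    using exp_ge_add_one_self[of "- 3 * hellinger_square p p0 / 256"] by (intro ennreal_leI) simp
  finally show ?thesis .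
qed

lemma log_ratio_square_mgf:
  "(\<integral>\<^sup>+x. ennreal (exp ((\<tau> x)\<^sup>2)) \<partial>measure01 p0) \<le> ennreal (exp (2 * hellinger_square p p0))"
proof -
  note density_measurable[measurable]
  have "(\<integral>\<^sup>+x. ennreal (exp ((\<tau> x)\<^sup>2)) \<partial>measure01 p0)
      \<le> ennreal (\<integral>x. 0 * p x + 1 * p0 x + 2 * (sqrt (p x) - sqrt (p0 x))\<^sup>2 \<partial>unit_lebesgue)"
  proof (rule nn_integral_measure01[OF p0 _ _ integral_density_combination(1)])
    fix x :: real assume x: "x \<in> {0..1}"
    show "p0 x * exp ((\<tau> x)\<^sup>2) \<le> 0 * p x + 1 * p0 x + 2 * (sqrt (p x) - sqrt (p0 x))\<^sup>2"
      using log_ratio_exp_bounds(2)[OF density_pos[OF x]] by (simp add: field_simps)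
  qed auto
  also have "\<dots> \<le> ennreal (exp (2 * hellinger_square p p0))"
    unfolding integral_density_combination
    using exp_ge_add_one_self[of "2 * hellinger_square p p0"] by (intro ennreal_leI) simp
  finally show ?thesis .
qed

text \<open>The error of the second kind in exponential form. It is written under \<open>p0\<close>
  with the likelihood ratio as a factor, because the numerator of the posterior is averaged under
  \<open>p0\<close>.\<close>

lemma type_II_mgf:
  "(\<integral>\<^sup>+x. ennreal (exp (- ((\<tau> x - (\<tau> x)\<^sup>2 / 16) / 32)) * (p x / p0 x)) \<partial>measure01 p0)
    \<le> ennreal (exp (- hellinger_square p p0 / 256))"
proof -
  note density_measurable[measurable]
  have "(\<integral>\<^sup>+x. ennreal (exp (- ((\<tau> x - (\<tau> x)\<^sup>2 / 16) / 32)) * (p x / p0 x)) \<partial>measure01 p0)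
      \<le> ennreal (\<integral>x. 127 / 128 * p x + 1 / 128 * p0 x + (- 1 / 256) * (sqrt (p x) - sqrt (p0 x))\<^sup>2 \<partial>unit_lebesgue)"
  proof (rule nn_integral_measure01[OF p0 _ _ integral_density_combination(1)])
    fix x :: real assume x: "x \<in> {0..1}"
    note pos = density_pos[OF x]
    show "0 \<le> exp (- ((\<tau> x - (\<tau> x)\<^sup>2 / 16) / 32)) * (p x / p0 x)" using pos by simp
    have "p0 x * (exp (- ((\<tau> x - (\<tau> x)\<^sup>2 / 16) / 32)) * (p x / p0 x)) = p x * exp (- ((\<tau> x - (\<tau> x)\<^sup>2 / 16) / 32))"
      using pos by simp
    also have "\<dots> \<le> p x - (p x - p0 x) / 128 - (sqrt (p x) - sqrt (p0 x))\<^sup>2 / 256"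
      by (rule log_ratio_exp_bounds(3)[OF pos])
    also have "\<dots> = 127 / 128 * p x + 1 / 128 * p0 x + (- 1 / 256) * (sqrt (p x) - sqrt (p0 x))\<^sup>2"
      by (simp add: field_simps)
    finally show "p0 x * (exp (- ((\<tau> x - (\<tau> x)\<^sup>2 / 16) / 32)) * (p x / p0 x))
      \<le> 127 / 128 * p x + 1 / 128 * p0 x + (- 1 / 256) * (sqrt (p x) - sqrt (p0 x))\<^sup>2" .
  qed measurable
  also have "\<dots> \<le> ennreal (exp (- hellinger_square p p0 / 256))"
    unfolding integral_density_combination
    using exp_ge_add_one_self[of "- hellinger_square p p0 / 256"] by (intro ennreal_leI) simp
  finally show ?thesis .
qed

lemma likelihood_ratio_mean: "(\<integral>\<^sup>+x. ennreal (p x / p0 x) \<partial>measure01 p0) \<le> 1"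
proof -
  note density_measurable[measurable]
  have "(\<integral>\<^sup>+x. ennreal (p x / p0 x) \<partial>measure01 p0)
      \<le> ennreal (\<integral>x. 1 * p x + 0 * p0 x + 0 * (sqrt (p x) - sqrt (p0 x))\<^sup>2 \<partial>unit_lebesgue)"
  proof (rule nn_integral_measure01[OF p0 _ _ integral_density_combination(1)])
    fix x :: real assume x: "x \<in> {0..1}"
    note pos = density_pos[OF x]
    show "0 \<le> p x / p0 x" using pos by simp
    show "p0 x * (p x / p0 x) \<le> 1 * p x + 0 * p0 x + 0 * (sqrt (p x) - sqrt (p0 x))\<^sup>2" using pos by simp
  qed measurable
  thus ?thesis unfolding integral_density_combination by simp
qed

text \<open>Under \<open>p0\<close> the ratio \<open>p / p0\<close> has mean 1. Adding it to its
  inverse cancels the first order term in the log ratio, so \<open>n\<close> observations lose only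
  an exponent of the order of \<open>n\<close> times the square of \<open>r\<close>.\<close>

lemma inverse_likelihood_ratio_mean:
  assumes r: "\<And>x. x \<in> {0..1} \<Longrightarrow> \<bar>ln (p x) - ln (p0 x)\<bar> \<le> r"
  shows "(\<integral>\<^sup>+x. ennreal (p0 x / p x) \<partial>measure01 p0) \<le> ennreal (exp (r\<^sup>2 * exp r))"
proof -
  note density_measurable[measurable]
  have "(\<integral>\<^sup>+x. ennreal (p0 x / p x) \<partial>measure01 p0)
      \<le> ennreal (\<integral>x. (- 1) * p x + (2 + r\<^sup>2 * exp r) * p0 x + 0 * (sqrt (p x) - sqrt (p0 x))\<^sup>2 \<partial>unit_lebesgue)"
  proof (rule nn_integral_measure01[OF p0 _ _ integral_density_combination(1)])
    fix x :: real assume x: "x \<in> {0..1}"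
    note pos = density_pos[OF x]
    show "0 \<le> p0 x / p x" using pos by simp
    have "exp (ln (p x) - ln (p0 x)) = p x / p0 x" "exp (- (ln (p x) - ln (p0 x))) = p0 x / p x"
      using pos by (simp_all add: exp_diff)
    hence "p x / p0 x + p0 x / p x \<le> 2 + r\<^sup>2 * exp r" using exp_sum_inverse_le[OF r[OF x]] by simp
    hence "p0 x * (p x / p0 x + p0 x / p x) \<le> p0 x * (2 + r\<^sup>2 * exp r)" using pos by (intro mult_left_mono) auto
    thus "p0 x * (p0 x / p x) \<le> (- 1) * p x + (2 + r\<^sup>2 * exp r) * p0 x + 0 * (sqrt (p x) - sqrt (p0 x))\<^sup>2"
      using pos by (simp add: distrib_left mult.commute)
  qed measurable
  also have "\<dots> \<le> ennreal (exp (r\<^sup>2 * exp r))"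
    unfolding integral_density_combination
    using exp_ge_add_one_self[of "r\<^sup>2 * exp r"] by (intro ennreal_leI) simp
  finally show ?thesis .
qed

end

section \<open>Log spline densities\<close>

text \<open>If \<open>lower_int \<alpha>\<close> is positive, continuity comes from
  differentiability; otherwise the bounded quotients are those of the function itself and give a
  modulus of continuity.\<close>

lemma hoelder_space_continuous:
  assumes \<alpha>: "\<alpha> > 0" and g: "g \<in> hoelder_space \<alpha>"
  shows "continuous_on {0..1} g"
proof (cases "lower_int \<alpha> = 0")
  case False
  hence "nth_deriv01 0 g differentiable_on {0..1}" using g unfolding hoelder_space_def by auto
  thus ?thesis unfolding nth_deriv01_def by (simp add: differentiable_imp_continuous_on)
next
  case True
  obtain K where K: "\<And>c. c \<in> hoelder_quotients \<alpha> g \<Longrightarrow> c \<le> K"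
    using g unfolding hoelder_space_def bdd_above_def by auto
  have lip: "\<bar>g x - g y\<bar> \<le> K * \<bar>x - y\<bar> powr \<alpha>" if "x \<in> {0..1}" "y \<in> {0..1}" for x y
  proof (cases "x = y")
    case False
    have "\<bar>g x - g y\<bar> / \<bar>x - y\<bar> powr \<alpha> \<in> hoelder_quotients \<alpha> g"
      unfolding hoelder_quotients_def using that False True by (auto simp: nth_deriv01_def)
    from K[OF this] show ?thesis using False by (simp add: divide_le_eq)
  qed simp
  show ?thesis
    unfolding continuous_on_def
  proof
    fix x :: real assume x: "x \<in> {0..1}"
    have "((\<lambda>y. K * \<bar>y - x\<bar> powr \<alpha>) \<longlongrightarrow> K * \<bar>x - x\<bar> powr \<alpha>) (at x within {0..1})"
      using \<alpha> by (intro tendsto_intros) auto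
    hence "((\<lambda>y. K * \<bar>y - x\<bar> powr \<alpha>) \<longlongrightarrow> 0) (at x within {0..1})" by simp
    moreover have "\<forall>\<^sub>F y in at x within {0..1}. norm (g y - g x) \<le> K * \<bar>y - x\<bar> powr \<alpha>"
      using lip x by (auto simp: eventually_at_filter)
    ultimately have "((\<lambda>y. g y - g x) \<longlongrightarrow> 0) (at x within {0..1})" by (rule Lim_null_comparison[rotated])
    thus "(g \<longlongrightarrow> g x) (at x within {0..1})" by (simp add: LIM_zero_iff)
  qed
qed

lemma continuous_on_unit_bounded:
  fixes g :: "real \<Rightarrow> real"
  assumes "continuous_on {0..1} g"
  obtains K where "\<And>x. x \<in> {0..1} \<Longrightarrow> \<bar>g x\<bar> \<le> K"
proof -
  have "compact (g ` {0..1})" using assms by (intro compact_continuous_image) auto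
  hence "bounded (g ` {0..1})" by (rule compact_imp_bounded)
  then obtain K where "\<forall>y\<in>g ` {0..1}. norm y \<le> K" unfolding bounded_iff by blast
  thus ?thesis by (intro that[of K]) auto
qed

lemma abs_le_sup_norm:
  assumes "\<And>x. x \<in> {0..1} \<Longrightarrow> \<bar>g x\<bar> \<le> K" "x \<in> {0..1}"
  shows "\<bar>g x\<bar> \<le> sup_norm g"
  unfolding sup_norm_def by (rule cSUP_upper) (use assms in \<open>auto intro!: bdd_aboveI[of _ K]\<close>)

lemma nth_deriv01_zero: "x \<in> {0..1} \<Longrightarrow> nth_deriv01 k (\<lambda>_. 0) x = 0"
proof (induction k arbitrary: x)
  case 0 thus ?case by (simp add: nth_deriv01_def)
next
  case (Suc k)
  have "nth_deriv01 (Suc k) (\<lambda>_. 0) x = vector_derivative (nth_deriv01 k (\<lambda>_. 0)) (at x within {0..1})"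
    unfolding nth_deriv01_def by simp
  also have "\<dots> = 0"
  proof (rule vector_derivative_within_cbox[of 0 1, simplified])
    show "(nth_deriv01 k (\<lambda>_. 0) has_vector_derivative 0) (at x within {0..1})"
      by (rule has_vector_derivative_transform[OF Suc.prems _ has_vector_derivative_const[of 0]]) (use Suc.IH in auto)
  qed (use Suc.prems in auto)
  finally show ?case .
qed

text \<open>Applied to the zero function, the covering property shows that every net is nonempty, so
  that the uniform distribution on it is meaningful.\<close>

lemma zero_in_hoelder_ball: "(\<lambda>_. 0) \<in> hoelder_space \<alpha>" "hoelder_norm \<alpha> (\<lambda>_. 0) = 0"
proof -
  have q: "hoelder_quotients \<alpha> (\<lambda>_. 0) = {0}"
  proof
    show "hoelder_quotients \<alpha> (\<lambda>_. 0) \<subseteq> {0}" unfolding hoelder_quotients_def by (auto simp: nth_deriv01_zero)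
    have "\<bar>nth_deriv01 (lower_int \<alpha>) (\<lambda>_. 0) 0 - nth_deriv01 (lower_int \<alpha>) (\<lambda>_. 0) 1\<bar>
        / \<bar>0 - 1\<bar> powr (\<alpha> - real (lower_int \<alpha>)) \<in> hoelder_quotients \<alpha> (\<lambda>_. 0)"
      unfolding hoelder_quotients_def by (rule CollectI, rule exI[of _ 0], rule exI[of _ 1]) auto
    thus "{0} \<subseteq> hoelder_quotients \<alpha> (\<lambda>_. 0)" by (simp add: nth_deriv01_zero)
  qed
  have "nth_deriv01 k (\<lambda>_. 0) differentiable_on {0..1}" for k
    unfolding differentiable_on_def
  proof
    fix x :: real assume x: "x \<in> {0..1}"
    show "nth_deriv01 k (\<lambda>_. 0) differentiable (at x within {0..1})"
      by (rule differentiableI_vector[OF has_vector_derivative_transform[OF x nth_deriv01_zero has_vector_derivative_const[of 0]]])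
  qed
  thus "(\<lambda>_. 0) \<in> hoelder_space \<alpha>" unfolding hoelder_space_def by (simp add: q)
  show "hoelder_norm \<alpha> (\<lambda>_. 0) = 0" unfolding hoelder_norm_def q sup_norm_def by simp
qed

lemma bspline_measurable [measurable]: "(\<lambda>x. bspline t k i x) \<in> borel_measurable borel"
proof (induction k arbitrary: i)
  case 0 thus ?case by simp
next
  case (Suc k)
  show ?case
  proof (cases k)
    case 0 thus ?thesis by simp
  next
    case (Suc m)
    have [measurable]: "(\<lambda>x. bspline t (Suc m) i x) \<in> borel_measurable borel" for i using Suc.IH Suc by simp
    show ?thesis unfolding Suc by simp
  qed
qed

lemma bspline_bounded: "\<exists>K. \<forall>x\<in>{0..1}. \<bar>bspline t k i x\<bar> \<le> K"
proof (induction k arbitrary: i)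
  case 0 thus ?case by auto
next
  case (Suc k)
  show ?case
  proof (cases k)
    case 0 thus ?thesis by (intro exI[of _ 1]) auto
  next
    case (Suc m)
    obtain K1 where K1: "\<And>x. x \<in> {0..1} \<Longrightarrow> \<bar>bspline t (Suc m) i x\<bar> \<le> K1" using Suc.IH[of i] unfolding Suc by blast
    obtain K2 where K2: "\<And>x. x \<in> {0..1} \<Longrightarrow> \<bar>bspline t (Suc m) (Suc i) x\<bar> \<le> K2" using Suc.IH[of "Suc i"] unfolding Suc by blast
    define a where "a = t (i + Suc m) - t i"
    define c where "c = t (Suc i + Suc m) - t (Suc i)"
    define L1 where "L1 = (1 + \<bar>t i\<bar>) / \<bar>a\<bar>"
    define L2 where "L2 = (1 + \<bar>t (i + Suc (Suc m))\<bar>) / \<bar>c\<bar>"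
    have "\<bar>bspline t (Suc (Suc m)) i x\<bar> \<le> L1 * K1 + L2 * K2" if x: "x \<in> {0..1}" for x
    proof -
      have "\<bar>(x - t i) / a\<bar> \<le> L1" unfolding L1_def abs_divide using x by (intro divide_right_mono) auto
      hence 1: "\<bar>(x - t i) / a * bspline t (Suc m) i x\<bar> \<le> L1 * K1"
        unfolding abs_mult using K1[OF x] by (intro mult_mono) (auto simp: L1_def)
      have "\<bar>(t (i + Suc (Suc m)) - x) / c\<bar> \<le> L2" unfolding L2_def abs_divide using x by (intro divide_right_mono) auto
      hence 2: "\<bar>(t (i + Suc (Suc m)) - x) / c * bspline t (Suc m) (Suc i) x\<bar> \<le> L2 * K2"
        unfolding abs_mult using K2[OF x] by (intro mult_mono) (auto simp: L2_def)
      have eq: "bspline t (Suc (Suc m)) i x = (x - t i) / a * bspline t (Suc m) i x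
          + (t (i + Suc (Suc m)) - x) / c * bspline t (Suc m) (Suc i) x"
        unfolding a_def c_def by simp
      show ?thesis unfolding eq by (rule order_trans[OF abs_triangle_ineq add_mono[OF 1 2]])
    qed
    thus ?thesis unfolding Suc by blast
  qed
qed

lemma spline_comb_measurable [measurable]: "spline_comb q J \<theta> \<in> borel_measurable borel"
  unfolding spline_comb_def[abs_def] spline_basis_def by measurable

lemma spline_comb_bounded:
  obtains K where "\<And>x. x \<in> {0..1} \<Longrightarrow> \<bar>spline_comb q J \<theta> x\<bar> \<le> K"
proof -
  obtain K where K: "\<And>j x. x \<in> {0..1} \<Longrightarrow> \<bar>spline_basis q J j x\<bar> \<le> K j"
    using bspline_bounded[of "spline_knots q (J + 1 - q)" q] unfolding spline_basis_def by metis
  have "\<bar>spline_comb q J \<theta> x\<bar> \<le> (\<Sum>j=1..J. \<bar>\<theta> j\<bar> * K j)" if x: "x \<in> {0..1}" for x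
  proof -
    have "\<bar>spline_comb q J \<theta> x\<bar> \<le> (\<Sum>j=1..J. \<bar>\<theta> j * spline_basis q J j x\<bar>)"
      unfolding spline_comb_def by (rule sum_abs)
    also have "\<dots> \<le> (\<Sum>j=1..J. \<bar>\<theta> j\<bar> * K j)"
      using K[OF x] by (intro sum_mono) (auto simp: abs_mult intro: mult_left_mono)
    finally show ?thesis .
  qed
  thus ?thesis using that by blast
qed

lemma exp_bounded_integral:
  fixes g :: "real \<Rightarrow> real"
  assumes g[measurable]: "g \<in> borel_measurable unit_lebesgue" and K: "\<And>x. x \<in> {0..1} \<Longrightarrow> \<bar>g x\<bar> \<le> K"
  shows "integrable unit_lebesgue (\<lambda>x. exp (g x))" "exp (- K) \<le> (\<integral>x. exp (g x) \<partial>unit_lebesgue)"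
    "(\<integral>x. exp (g x) \<partial>unit_lebesgue) \<le> exp K"
proof -
  interpret finite_measure unit_lebesgue by (rule finite_measure_unit_lebesgue)
  have m: "measure unit_lebesgue {0..1} = 1" by (simp add: measure_restrict_space)
  show int: "integrable unit_lebesgue (\<lambda>x. exp (g x))"
    using K by (intro integrable_unit_bounded[of _ "exp K"]) (auto simp: abs_le_iff)
  have c: "(\<integral>x. c \<partial>unit_lebesgue) = c" for c :: real using m by simp
  have "(\<integral>x. exp (- K) \<partial>unit_lebesgue) \<le> (\<integral>x. exp (g x) \<partial>unit_lebesgue)"
  proof (rule integral_mono[OF _ int])
    fix x assume "x \<in> space unit_lebesgue"
    hence "- K \<le> g x" using K[of x] by (simp add: abs_le_iff)
    thus "exp (- K) \<le> exp (g x)" by simp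
  qed simp
  thus "exp (- K) \<le> (\<integral>x. exp (g x) \<partial>unit_lebesgue)" unfolding c .
  have "(\<integral>x. exp (g x) \<partial>unit_lebesgue) \<le> (\<integral>x. exp K \<partial>unit_lebesgue)"
  proof (rule integral_mono[OF int])
    fix x assume "x \<in> space unit_lebesgue"
    hence "g x \<le> K" using K[of x] by (simp add: abs_le_iff)
    thus "exp (g x) \<le> exp K" by simp
  qed simp
  thus "(\<integral>x. exp (g x) \<partial>unit_lebesgue) \<le> exp K" unfolding c .
qed

lemma log_normalizer_eq: "log_normalizer q J \<theta> = ln (\<integral>x. exp (spline_comb q J \<theta> x) \<partial>unit_lebesgue)"
  unfolding log_normalizer_def set_lebesgue_integral_def by (subst integral_restrict_space) auto

lemma bounded_density_log_spline: "bounded_density (log_spline_density q J \<theta>)"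
proof -
  obtain K where K: "\<And>x. x \<in> {0..1} \<Longrightarrow> \<bar>spline_comb q J \<theta> x\<bar> \<le> K" using spline_comb_bounded by blast
  have m: "spline_comb q J \<theta> \<in> borel_measurable unit_lebesgue"
    by (rule measurable_restrict_space1) measurable
  define I where "I = (\<integral>x. exp (spline_comb q J \<theta> x) \<partial>unit_lebesgue)"
  note int = exp_bounded_integral[OF m K, folded I_def]
  have "I > 0" using int(2) by (meson exp_gt_zero less_le_trans)
  hence eq: "log_spline_density q J \<theta> x = exp (spline_comb q J \<theta> x) / I" for x
    unfolding log_spline_density_def log_normalizer_eq I_def[symmetric] by (simp add: exp_diff)
  show ?thesis
    unfolding bounded_density_def
  proof (intro conjI exI ballI)
    show "0 < log_spline_density q J \<theta> x" for x unfolding log_spline_density_def by simp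
    show "log_spline_density q J \<theta> \<in> borel_measurable unit_lebesgue"
      unfolding log_spline_density_def[abs_def] using m by measurable
    show "log_spline_density q J \<theta> x \<le> exp K / I" if "x \<in> {0..1}" for x
      unfolding eq using K[OF that] \<open>I > 0\<close> by (intro divide_right_mono) (auto simp: abs_le_iff)
    show "(\<integral>x. log_spline_density q J \<theta> x \<partial>unit_lebesgue) = 1"
      unfolding eq using \<open>I > 0\<close> by (simp add: I_def)
  qed
qed

lemma bounded_density_prob:
  assumes c: "continuous_on {0..1} p0" and pos: "\<And>x. x \<in> {0..1} \<Longrightarrow> p0 x > 0" and pr: "prob_space (measure01 p0)"
  shows "bounded_density p0"
  unfolding bounded_density_def
proof (intro conjI ballI pos)
  show m[measurable]: "p0 \<in> borel_measurable unit_lebesgue"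
  proof -
    have "sets unit_lebesgue = sets (restrict_space borel {0..1})" by (simp add: sets_restrict_space)
    from measurable_cong_sets[OF this refl] show ?thesis using borel_measurable_continuous_on_restrict[OF c] by simp
  qed
  obtain K where K: "\<And>x. x \<in> {0..1} \<Longrightarrow> \<bar>p0 x\<bar> \<le> K" using continuous_on_unit_bounded[OF c] by blast
  thus "\<exists>K. \<forall>x\<in>{0..1}. p0 x \<le> K" by (intro exI[of _ K]) (auto simp: abs_le_iff)
  have "emeasure (measure01 p0) (space (measure01 p0)) = 1" by (rule prob_space.emeasure_space_1[OF pr])
  hence "(\<integral>\<^sup>+x. ennreal (p0 x) \<partial>unit_lebesgue) = 1"
    unfolding measure01_def using sets.top[of unit_lebesgue]
    by (subst (asm) emeasure_density) (auto cong: nn_integral_cong_simp)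
  moreover have "(\<integral>\<^sup>+x. ennreal (p0 x) \<partial>unit_lebesgue) = ennreal (\<integral>x. p0 x \<partial>unit_lebesgue)"
    using K pos by (intro nn_integral_eq_integral integrable_unit_bounded[OF m K]) (auto intro!: AE_I2 less_imp_le)
  ultimately show "(\<integral>x. p0 x \<partial>unit_lebesgue) = 1" by simp
qed

text \<open>\<open>p0\<close> integrates to 1, so the integral of the exponentiated spline lies
  between \<open>exp (- r)\<close> and \<open>exp r\<close>; the normalization costs at most another
  \<open>r\<close>.\<close>

lemma log_spline_close:
  assumes p0: "bounded_density p0"
    and r: "\<And>x. x \<in> {0..1} \<Longrightarrow> \<bar>spline_comb q J \<theta> x - ln (p0 x)\<bar> \<le> r" and x: "x \<in> {0..1}"
  shows "\<bar>ln (log_spline_density q J \<theta> x) - ln (p0 x)\<bar> \<le> 2 * r"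
proof -
  obtain K where K: "\<And>x. x \<in> {0..1} \<Longrightarrow> \<bar>spline_comb q J \<theta> x\<bar> \<le> K" using spline_comb_bounded by blast
  have m: "spline_comb q J \<theta> \<in> borel_measurable unit_lebesgue"
    by (rule measurable_restrict_space1) measurable
  define I where "I = (\<integral>x. exp (spline_comb q J \<theta> x) \<partial>unit_lebesgue)"
  note int = exp_bounded_integral[OF m K, folded I_def]
  have I0: "I > 0" using int(2) by (meson exp_gt_zero less_le_trans)
  have b: "exp (- r) * p0 x \<le> exp (spline_comb q J \<theta> x)" "exp (spline_comb q J \<theta> x) \<le> exp r * p0 x" if x: "x \<in> {0..1}" for x
  proof -
    have pos: "p0 x > 0" using p0 x unfolding bounded_density_def by auto
    have "exp (- r + ln (p0 x)) \<le> exp (spline_comb q J \<theta> x)" "exp (spline_comb q J \<theta> x) \<le> exp (r + ln (p0 x))"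
      using r[OF x] by (auto simp: abs_le_iff)
    thus "exp (- r) * p0 x \<le> exp (spline_comb q J \<theta> x)" "exp (spline_comb q J \<theta> x) \<le> exp r * p0 x"
      using pos by (simp_all only: exp_add exp_ln)
  qed
  have int0: "integrable unit_lebesgue p0" "(\<integral>x. p0 x \<partial>unit_lebesgue) = 1"
    using bounded_density_integrable[OF p0] p0 unfolding bounded_density_def by auto
  have "(\<integral>x. exp (- r) * p0 x \<partial>unit_lebesgue) \<le> I"
    unfolding I_def using int0 b by (intro integral_mono int) auto
  hence "exp (- r) \<le> I" using int0 by simp
  hence "- r \<le> ln I" using I0 by (simp add: ln_ge_iff)
  moreover have "I \<le> (\<integral>x. exp r * p0 x \<partial>unit_lebesgue)"
    unfolding I_def using int0 b by (intro integral_mono int) auto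
  hence "I \<le> exp r" using int0 by simp
  hence "ln I \<le> r" using I0 by (metis ln_exp ln_le_cancel_iff exp_gt_zero)
  moreover have "ln (log_spline_density q J \<theta> x) = spline_comb q J \<theta> x - ln I"
    unfolding log_spline_density_def log_normalizer_eq I_def[symmetric] by simp
  ultimately show ?thesis using r[OF x] by linarith
qed

lemma iid_product_integral:
  assumes M: "prob_space (measure01 p0)" and u: "u \<in> borel_measurable unit_lebesgue"
  shows "(\<integral>\<^sup>+X. (\<Prod>i=1..n. ennreal (u (X i))) \<partial>iid_sample p0 n) = (\<integral>\<^sup>+x. ennreal (u x) \<partial>measure01 p0) ^ n"
proof -
  interpret prob_space "measure01 p0" by fact
  interpret product_sigma_finite "\<lambda>_. measure01 p0" by standard
  have [measurable]: "u \<in> borel_measurable (measure01 p0)" using u by (simp cong: measurable_cong_sets)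
  show ?thesis unfolding iid_sample_def by (subst product_nn_integral_prod) auto
qed

section \<open>The linear space of log likelihood ratios and its tests\<close>

definition test_stat :: "(real \<Rightarrow> real) \<Rightarrow> (real \<Rightarrow> real) \<Rightarrow> real \<Rightarrow> real" where
  "test_stat p p0 x = tanh ((ln (p x) - ln (p0 x)) / 4) - (tanh ((ln (p x) - ln (p0 x)) / 4))\<^sup>2 / 16"

lemma test_stat_measurable:
  assumes "bounded_density p" "bounded_density p0"
  shows "test_stat p p0 \<in> borel_measurable unit_lebesgue"
proof -
  have [measurable]: "p \<in> borel_measurable unit_lebesgue" "p0 \<in> borel_measurable unit_lebesgue"
    using assms unfolding bounded_density_def by auto
  show ?thesis unfolding test_stat_def[abs_def] by measurable
qed

text \<open>The spline basis is numbered from 1, so its functions occupy the positions from 2 on,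
  with the index shifted by one.\<close>

definition ratio_basis :: "(real \<Rightarrow> real) \<Rightarrow> nat \<Rightarrow> nat \<Rightarrow> nat \<Rightarrow> real \<Rightarrow> real" where
  "ratio_basis p0 q J j x = (if j = 0 then 1 else if j = 1 then ln (p0 x) else spline_basis q J (j - 1) x)"

text \<open>The log normalizer becomes the coefficient of the constant function, and the division by
  4 is the one inside \<open>tanh\<close>.\<close>

definition ratio_coords :: "nat \<Rightarrow> nat \<Rightarrow> (nat \<Rightarrow> real) \<Rightarrow> nat \<Rightarrow> real" where
  "ratio_coords q J \<theta> j = (if j = 0 then - log_normalizer q J \<theta> else if j = 1 then - 1 else \<theta> (j - 1)) / 4"

lemma sum_lessThan_add_2: "(\<Sum>j<J + 2. g j) = g 0 + g 1 + (\<Sum>j<J. g (Suc (Suc j)))" for g :: "nat \<Rightarrow> real"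
proof -
  have "J + 2 = Suc (Suc J)" by simp
  thus ?thesis by (simp only: sum.lessThan_Suc_shift) simp
qed

lemma ratio_coords_sum:
  "(\<Sum>j<J + 2. ratio_coords q J \<theta> j * ratio_basis p0 q J j x) = (ln (log_spline_density q J \<theta> x) - ln (p0 x)) / 4"
proof -
  have "(\<Sum>j<J + 2. ratio_coords q J \<theta> j * ratio_basis p0 q J j x)
     = - log_normalizer q J \<theta> / 4 - ln (p0 x) / 4 + (\<Sum>j<J. \<theta> (Suc j) * spline_basis q J (Suc j) x / 4)"
    unfolding sum_lessThan_add_2 by (simp add: ratio_coords_def ratio_basis_def)
  also have "(\<Sum>j<J. \<theta> (Suc j) * spline_basis q J (Suc j) x / 4) = spline_comb q J \<theta> x / 4"
    unfolding spline_comb_def by (simp add: sum.atLeast1_atMost_eq sum_divide_distrib)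
  finally show ?thesis unfolding log_spline_density_def by (simp add: field_simps)
qed

text \<open>The constants do not depend on \<open>p0\<close>, \<open>q\<close>, \<open>J\<close> or
  \<open>n\<close>, and \<open>\<Theta>\<close> is any countable set of parameters. Parameters from
  different models with the same order and dimension can therefore be tested together.\<close>

lemma log_spline_type_I_error:
  "\<exists>B r. 0 < B \<and> 0 < r \<and> (\<forall>p0 q J n \<Theta> D.
     bounded_density p0 \<longrightarrow> prob_space (measure01 p0) \<longrightarrow> countable \<Theta> \<longrightarrow> B * real (J + 2) \<le> D \<longrightarrow>
     (\<forall>\<theta>\<in>\<Theta>. D \<le> real n * hellinger_square (log_spline_density q J \<theta>) p0) \<longrightarrow>
     emeasure (iid_sample p0 n) {X \<in> space (iid_sample p0 n). \<exists>\<theta>\<in>\<Theta>.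
        0 < (\<Sum>i=1..n. test_stat (log_spline_density q J \<theta>) p0 (X i))} \<le> ennreal (4 * exp (- r * D)))"
proof -
  from uniform_type_I_error[where ?'a = real] obtain B r where B: "0 < B" and r: "0 < r" and Br: "\<forall>M b d n F (H :: (nat \<Rightarrow> real) \<Rightarrow> real) D.
     prob_space (M :: real measure) \<longrightarrow> d > 0 \<longrightarrow> (\<forall>j<d. b j \<in> borel_measurable M) \<longrightarrow> countable F \<longrightarrow>
     B * real d \<le> D \<longrightarrow>
     (\<forall>a t. \<exists>a'. \<forall>x. (\<Sum>j<d. a' j * b j x) = (\<Sum>j<d. a j * b j x) - t) \<longrightarrow>
     (\<forall>a\<in>F. D \<le> real n * H a \<and>
        (\<integral>\<^sup>+x. ennreal (exp (tanh (\<Sum>j<d. a j * b j x) / 16)) \<partial>M) \<le> ennreal (exp (- 3 * H a / 256)) \<and>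
        (\<integral>\<^sup>+x. ennreal (exp ((tanh (\<Sum>j<d. a j * b j x))\<^sup>2)) \<partial>M) \<le> ennreal (exp (2 * H a))) \<longrightarrow>
     emeasure (PiM {1..n} (\<lambda>_. M)) {X \<in> space (PiM {1..n} (\<lambda>_. M)). \<exists>a\<in>F.
        0 < (\<Sum>i\<in>{1..n}. tanh (\<Sum>j<d. a j * b j (X i)) - (tanh (\<Sum>j<d. a j * b j (X i)))\<^sup>2 / 16)}
       \<le> ennreal (4 * exp (- r * D))"
    by (elim exE conjE) (rule that)
  have main: "emeasure (iid_sample p0 n) {X \<in> space (iid_sample p0 n). \<exists>\<theta>\<in>\<Theta>.
        0 < (\<Sum>i=1..n. test_stat (log_spline_density q J \<theta>) p0 (X i))} \<le> ennreal (4 * exp (- r * D))"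
    if p0: "bounded_density p0" and pr: "prob_space (measure01 p0)" and \<Theta>: "countable \<Theta>"
      and D: "B * real (J + 2) \<le> D"
      and far: "\<forall>\<theta>\<in>\<Theta>. D \<le> real n * hellinger_square (log_spline_density q J \<theta>) p0"
    for p0 q J n \<Theta> D
  proof -
    define b where "b = ratio_basis p0 q J"
    \<comment> \<open>The distance has to be a function of the coefficient vector. It is recovered
      from the density \<open>p0\<close> times the exponential of the combination, which for
      \<open>ratio_coords\<close> is the log spline density on the unit interval.\<close>
    define H where "H a = hellinger_square (\<lambda>x. p0 x * exp (4 * (\<Sum>j<J + 2. a j * b j x))) p0" for a
    have [measurable]: "p0 \<in> borel_measurable unit_lebesgue" using p0 unfolding bounded_density_def by auto
    have sb: "spline_basis q J j \<in> borel_measurable unit_lebesgue" for j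
      unfolding spline_basis_def by (rule measurable_restrict_space1) measurable
    have bm: "b j \<in> borel_measurable (measure01 p0)" for j
    proof -
      have "b j \<in> borel_measurable unit_lebesgue"
        unfolding b_def ratio_basis_def[abs_def] using sb by measurable
      thus ?thesis by (simp cong: measurable_cong_sets)
    qed
    have four: "4 * (y / 4) = y" for y :: real by simp
    have Hc: "H (ratio_coords q J \<theta>) = hellinger_square (log_spline_density q J \<theta>) p0" for \<theta>
      unfolding H_def hellinger_square_def
    proof (rule Bochner_Integration.integral_cong[OF refl])
      fix x assume "x \<in> space unit_lebesgue"
      hence "p0 x > 0" using p0 unfolding bounded_density_def by auto
      moreover have "log_spline_density q J \<theta> x > 0" unfolding log_spline_density_def by simp
      ultimately have "p0 x * exp (4 * (\<Sum>j<J + 2. ratio_coords q J \<theta> j * b j x)) = log_spline_density q J \<theta> x"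
        unfolding b_def ratio_coords_sum four by (simp add: exp_diff)
      thus "(sqrt (p0 x * exp (4 * (\<Sum>j<J + 2. ratio_coords q J \<theta> j * b j x))) - sqrt (p0 x))\<^sup>2
         = (sqrt (log_spline_density q J \<theta> x) - sqrt (p0 x))\<^sup>2" by simp
    qed
    have const: "\<forall>a t. \<exists>a'. \<forall>x. (\<Sum>j<J + 2. a' j * b j x) = (\<Sum>j<J + 2. a j * b j x) - t"
    proof (intro allI)
      fix a :: "nat \<Rightarrow> real" and t :: real
      have "(\<Sum>j<J + 2. (a(0 := a 0 - t)) j * b j x) = (\<Sum>j<J + 2. a j * b j x) - t" for x
        unfolding sum_lessThan_add_2 by (simp add: b_def ratio_basis_def algebra_simps)
      thus "\<exists>a'. \<forall>x. (\<Sum>j<J + 2. a' j * b j x) = (\<Sum>j<J + 2. a j * b j x) - t" by blast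
    qed
    have prem: "\<forall>a\<in>ratio_coords q J ` \<Theta>. D \<le> real n * H a \<and>
        (\<integral>\<^sup>+x. ennreal (exp (tanh (\<Sum>j<J + 2. a j * b j x) / 16)) \<partial>measure01 p0) \<le> ennreal (exp (- 3 * H a / 256)) \<and>
        (\<integral>\<^sup>+x. ennreal (exp ((tanh (\<Sum>j<J + 2. a j * b j x))\<^sup>2)) \<partial>measure01 p0) \<le> ennreal (exp (2 * H a))"
    proof
      fix a assume "a \<in> ratio_coords q J ` \<Theta>"
      then obtain \<theta> where \<theta>: "\<theta> \<in> \<Theta>" "a = ratio_coords q J \<theta>" by auto
      show "D \<le> real n * H a \<and>
        (\<integral>\<^sup>+x. ennreal (exp (tanh (\<Sum>j<J + 2. a j * b j x) / 16)) \<partial>measure01 p0) \<le> ennreal (exp (- 3 * H a / 256)) \<and>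
        (\<integral>\<^sup>+x. ennreal (exp ((tanh (\<Sum>j<J + 2. a j * b j x))\<^sup>2)) \<partial>measure01 p0) \<le> ennreal (exp (2 * H a))"
        using far \<theta>(1) log_ratio_mgf[OF bounded_density_log_spline p0] log_ratio_square_mgf[OF bounded_density_log_spline p0]
        unfolding \<theta>(2) Hc unfolding b_def ratio_coords_sum by auto
    qed
    have "emeasure (PiM {1..n} (\<lambda>_. measure01 p0)) {X \<in> space (PiM {1..n} (\<lambda>_. measure01 p0)). \<exists>a\<in>ratio_coords q J ` \<Theta>.
        0 < (\<Sum>i\<in>{1..n}. tanh (\<Sum>j<J + 2. a j * b j (X i)) - (tanh (\<Sum>j<J + 2. a j * b j (X i)))\<^sup>2 / 16)}
       \<le> ennreal (4 * exp (- r * D))"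
    proof -
      have d0: "0 < J + 2" by simp
      have bm': "\<forall>j<J + 2. b j \<in> borel_measurable (measure01 p0)" using bm by blast
      have cF: "countable (ratio_coords q J ` \<Theta>)" using \<Theta> by (rule countable_image)
      note Br[THEN spec[where x = "measure01 p0"], THEN spec[where x = b], THEN spec[where x = "J + 2"], THEN spec[where x = n],
        THEN spec[where x = "ratio_coords q J ` \<Theta>"], THEN spec[where x = H], THEN spec[where x = D]]
      from this[THEN mp, OF pr, THEN mp, OF d0, THEN mp, OF bm', THEN mp, OF cF, THEN mp, OF D, THEN mp, OF const, THEN mp, OF prem]
      show ?thesis .
    qed
    moreover have im: "(\<exists>a\<in>ratio_coords q J ` \<Theta>. Q a) \<longleftrightarrow> (\<exists>\<theta>\<in>\<Theta>. Q (ratio_coords q J \<theta>))" for Q by auto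
    ultimately show ?thesis unfolding iid_sample_def test_stat_def im unfolding b_def ratio_coords_sum by (simp only:)
  qed
  show ?thesis by (rule exI[of _ B], rule exI[of _ r]) (use B r main in blast)
qed

section \<open>Posterior contraction\<close>

lemma nn_integral_sieve_prior:
  assumes "finite \<Theta>" "\<Theta> \<noteq> {}"
  shows "(\<integral>\<^sup>+p\<in>S. g p \<partial>measure_pmf (sieve_prior q J \<Theta>))
    = (\<Sum>\<theta>\<in>\<Theta>. g (log_spline_density q J \<theta>) * indicator S (log_spline_density q J \<theta>)) / of_nat (card \<Theta>)"
  unfolding sieve_prior_def using assms by (simp add: nn_integral_pmf_of_set)

text \<open>The degenerate cases hold by convention: \<open>0 / 0\<close> is 0, and so is every
  quotient by infinity.\<close>

lemma divide_le_one_ennreal: "a \<le> b \<Longrightarrow> a / b \<le> (1 :: ennreal)"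
proof (cases "b = 0 \<or> b = \<infinity>")
  case True
  assume "a \<le> b"
  thus ?thesis using True by (auto simp: ennreal_divide_top)
next
  case False
  assume "a \<le> b"
  hence "a / b \<le> b / b" by (rule divide_right_mono_ennreal)
  also have "\<dots> = 1" using False by (intro ennreal_divide_self) (auto simp: less_top)
  finally show ?thesis .
qed

lemma weighted_likelihood_mono:
  "S \<subseteq> S' \<Longrightarrow> weighted_likelihood I w Pr n X S \<le> weighted_likelihood I w Pr n X S'"
  unfolding weighted_likelihood_def
  by (intro nn_integral_mono mult_left_mono) (auto simp: indicator_def)

text \<open>On \<open>A\<close> the posterior is at most 1. Off \<open>A\<close>, numerator and
  denominator are divided by the likelihood of \<open>p0\<close>, and the majorants \<open>v\<close>
  are integrated model by model after an exchange of sum and integral. The estimate is pointwise in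
  \<open>X\<close>, so measurability is needed for \<open>v\<close> only.\<close>

lemma posterior_expectation_bound:
  fixes v :: "real \<Rightarrow> (nat \<Rightarrow> real) \<Rightarrow> ennreal" and k :: real and A :: "(nat \<Rightarrow> real) set"
  assumes p0: "bounded_density p0" and I: "countable I"
    and A: "A \<in> sets (iid_sample p0 n)" and k: "k > 0"
    and den: "\<And>X. X \<in> space (iid_sample p0 n) - A \<Longrightarrow>
        ennreal (k * (\<Prod>i=1..n. p0 (X i))) \<le> weighted_likelihood I w Pr n X UNIV"
    and num: "\<And>X \<alpha>. X \<in> space (iid_sample p0 n) - A \<Longrightarrow> \<alpha> \<in> I \<Longrightarrow>
        (\<integral>\<^sup>+p\<in>S. ennreal (\<Prod>i=1..n. p (X i) / p0 (X i)) \<partial>measure_pmf (Pr \<alpha>)) \<le> v \<alpha> X"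
    and v: "\<And>\<alpha>. \<alpha> \<in> I \<Longrightarrow> v \<alpha> \<in> borel_measurable (iid_sample p0 n)"
    and pr: "prob_space (measure01 p0)"
  shows "(\<integral>\<^sup>+X. posterior I w Pr n X S \<partial>iid_sample p0 n)
    \<le> emeasure (iid_sample p0 n) A
      + ennreal (1 / k) * (\<integral>\<^sup>+\<alpha>. ennreal (w \<alpha>) * (\<integral>\<^sup>+X. v \<alpha> X \<partial>iid_sample p0 n) \<partial>count_space I)"
proof -
  let ?P = "iid_sample p0 n"
  interpret P: prob_space ?P unfolding iid_sample_def by (intro prob_space_PiM pr)
  interpret sigma_finite_measure "count_space I" by (rule sigma_finite_measure_count_space_countable[OF I])
  interpret pair_sigma_finite "count_space I" ?P ..
  have meas: "(\<lambda>(\<alpha>, X). ennreal (w \<alpha>) * v \<alpha> X) \<in> borel_measurable (count_space I \<Otimes>\<^sub>M ?P)"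
    by (rule measurable_pair_measure_countable1[OF I]) (use v in simp)
  have measX: "(\<lambda>X. \<integral>\<^sup>+\<alpha>. ennreal (w \<alpha>) * v \<alpha> X \<partial>count_space I) \<in> borel_measurable ?P"
    using meas by measurable
  have "(\<integral>\<^sup>+X. posterior I w Pr n X S \<partial>?P)
    \<le> (\<integral>\<^sup>+X. indicator A X + ennreal (1 / k) * (\<integral>\<^sup>+\<alpha>. ennreal (w \<alpha>) * v \<alpha> X \<partial>count_space I) \<partial>?P)"
  proof (rule nn_integral_mono)
    fix X assume X: "X \<in> space ?P"
    show "posterior I w Pr n X S \<le> indicator A X + ennreal (1 / k) * (\<integral>\<^sup>+\<alpha>. ennreal (w \<alpha>) * v \<alpha> X \<partial>count_space I)"
    proof (cases "X \<in> A")
      case True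
      have "posterior I w Pr n X S \<le> 1"
        unfolding posterior_def by (intro divide_le_one_ennreal weighted_likelihood_mono) auto
      thus ?thesis using True by (simp add: add_increasing2)
    next
      case False
      have Xi: "X i \<in> {0..1}" if "i \<in> {1..n}" for i
        using X that unfolding iid_sample_def space_PiM by (auto simp: PiE_def Pi_def)
      have pos: "p0 (X i) > 0" if "i \<in> {1..n}" for i using p0 Xi[OF that] unfolding bounded_density_def by auto
      define R where "R = (\<Prod>i=1..n. p0 (X i))"
      have R: "R > 0" unfolding R_def using pos by (intro prod_pos) auto
      have fac: "ennreal (\<Prod>i=1..n. p (X i)) = ennreal R * ennreal (\<Prod>i=1..n. p (X i) / p0 (X i))" for p
      proof -
        have "R * (\<Prod>i=1..n. p (X i) / p0 (X i)) = (\<Prod>i=1..n. p (X i))"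
          unfolding R_def prod.distrib[symmetric] using pos by (intro prod.cong refl) (force simp: less_imp_neq)
        thus ?thesis using R by (metis ennreal_mult' less_imp_le)
      qed
      have "weighted_likelihood I w Pr n X S
         = (\<integral>\<^sup>+\<alpha>. ennreal R * (ennreal (w \<alpha>) * (\<integral>\<^sup>+p\<in>S. ennreal (\<Prod>i=1..n. p (X i) / p0 (X i)) \<partial>measure_pmf (Pr \<alpha>))) \<partial>count_space I)"
        unfolding weighted_likelihood_def fac
        by (intro nn_integral_cong) (simp add: mult.assoc nn_integral_cmult mult.left_commute)
      also have "\<dots> = ennreal R * (\<integral>\<^sup>+\<alpha>. ennreal (w \<alpha>) * (\<integral>\<^sup>+p\<in>S. ennreal (\<Prod>i=1..n. p (X i) / p0 (X i)) \<partial>measure_pmf (Pr \<alpha>)) \<partial>count_space I)"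
        by (rule nn_integral_cmult) simp
      also have "\<dots> \<le> ennreal R * (\<integral>\<^sup>+\<alpha>. ennreal (w \<alpha>) * v \<alpha> X \<partial>count_space I)"
        using num X False by (intro mult_left_mono nn_integral_mono) auto
      finally have nu: "weighted_likelihood I w Pr n X S \<le> ennreal R * (\<integral>\<^sup>+\<alpha>. ennreal (w \<alpha>) * v \<alpha> X \<partial>count_space I)" .
      define V where "V = (\<integral>\<^sup>+\<alpha>. ennreal (w \<alpha>) * v \<alpha> X \<partial>count_space I)"
      have dn: "ennreal (k * R) \<le> weighted_likelihood I w Pr n X UNIV" using den[of X] X False unfolding R_def by auto
      have "ennreal R = ennreal (k * R) * ennreal (1 / k)"
        using k R by (simp flip: ennreal_mult)
      hence "weighted_likelihood I w Pr n X S \<le> ennreal (k * R) * (ennreal (1 / k) * V)"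
        using nu unfolding V_def[symmetric] by (simp add: mult.assoc)
      also have "\<dots> \<le> weighted_likelihood I w Pr n X UNIV * (ennreal (1 / k) * V)"
        using dn by (intro mult_right_mono) auto
      finally have "posterior I w Pr n X S \<le> ennreal (1 / k) * V"
        unfolding posterior_def using dn k R
        by (intro divide_le_posI_ennreal) (auto intro: less_le_trans[OF _ dn])
      thus ?thesis using False unfolding V_def by simp
    qed
  qed
  also have "\<dots> = emeasure ?P A + ennreal (1 / k) * (\<integral>\<^sup>+X. \<integral>\<^sup>+\<alpha>. ennreal (w \<alpha>) * v \<alpha> X \<partial>count_space I \<partial>?P)"
    using A measX by (subst nn_integral_add) (auto simp: nn_integral_cmult)
  also have "(\<integral>\<^sup>+X. \<integral>\<^sup>+\<alpha>. ennreal (w \<alpha>) * v \<alpha> X \<partial>count_space I \<partial>?P)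
      = (\<integral>\<^sup>+\<alpha>. \<integral>\<^sup>+X. ennreal (w \<alpha>) * v \<alpha> X \<partial>?P \<partial>count_space I)"
    using meas by (rule Fubini')
  also have "\<dots> = (\<integral>\<^sup>+\<alpha>. ennreal (w \<alpha>) * (\<integral>\<^sup>+X. v \<alpha> X \<partial>?P) \<partial>count_space I)"
    using v by (intro nn_integral_cong nn_integral_cmult) auto
  finally show ?thesis .
qed

section \<open>Rates, dimensions and weights\<close>

lemma rate_square:
  assumes "n \<ge> 1" "\<alpha> > 0"
  shows "real n * (rate n \<alpha>)\<^sup>2 = real n powr (1 / (2 * \<alpha> + 1))"
proof -
  have "(rate n \<alpha>)\<^sup>2 = real n powr (- (2 * \<alpha>) / (2 * \<alpha> + 1))"
    unfolding rate_def using assms by (simp add: powr_power)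
  hence "real n * (rate n \<alpha>)\<^sup>2 = real n powr (1 + - (2 * \<alpha>) / (2 * \<alpha> + 1))"
    unfolding powr_add using assms by simp
  also have "1 + - (2 * \<alpha>) / (2 * \<alpha> + 1) = 1 / (2 * \<alpha> + 1)" using assms by (simp add: field_simps)
  finally show ?thesis .
qed

lemma rate_powr:
  assumes "n \<ge> 1" "\<alpha> > 0" "M > 0"
  shows "(M / rate n \<alpha>) powr (1 / \<alpha>) = M powr (1 / \<alpha>) * real n powr (1 / (2 * \<alpha> + 1))"
proof -
  have "1 / rate n \<alpha> = real n powr (\<alpha> / (2 * \<alpha> + 1))"
    unfolding rate_def by (simp add: powr_minus divide_simps flip: minus_divide_left)
  hence "(M / rate n \<alpha>) powr (1 / \<alpha>) = (M * real n powr (\<alpha> / (2 * \<alpha> + 1))) powr (1 / \<alpha>)"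
    by (simp add: divide_inverse)
  also have "\<dots> = M powr (1 / \<alpha>) * real n powr (\<alpha> / (2 * \<alpha> + 1) * (1 / \<alpha>))"
    using assms by (simp add: powr_mult powr_powr)
  also have "\<alpha> / (2 * \<alpha> + 1) * (1 / \<alpha>) = 1 / (2 * \<alpha> + 1)" using assms by simp
  finally show ?thesis .
qed

lemma rate_bounds:
  assumes "n \<ge> 1" "\<alpha> > 0"
  shows "0 < rate n \<alpha>" "rate n \<alpha> \<le> 1"
proof -
  show "0 < rate n \<alpha>" unfolding rate_def using assms by simp
  have "real n powr (- \<alpha> / (2 * \<alpha> + 1)) \<le> real n powr 0" using assms by (intro powr_mono) auto
  thus "rate n \<alpha> \<le> 1" unfolding rate_def using assms by simp
qed

text \<open>Rounding a number that is at least 1 down to an integer loses at most a factor 2, whence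
  the constant \<open>2 powr \<alpha>\<close>.\<close>

lemma spline_dim_bounds:
  assumes n: "n \<ge> 1" and \<alpha>: "\<alpha> > 0"
  shows "real (spline_dim n \<alpha>) \<le> real n powr (1 / (2 * \<alpha> + 1))"
    "(1 / real (spline_dim n \<alpha>)) powr \<alpha> \<le> 2 powr \<alpha> * rate n \<alpha>"
proof -
  define x where "x = real n powr (1 / (2 * \<alpha> + 1))"
  have x1: "x \<ge> 1" unfolding x_def using assms by (intro ge_one_powr_ge_zero) auto
  have J: "real (spline_dim n \<alpha>) = real_of_int \<lfloor>x\<rfloor>" unfolding spline_dim_def x_def[symmetric] using x1 by simp
  show "real (spline_dim n \<alpha>) \<le> real n powr (1 / (2 * \<alpha> + 1))" unfolding J x_def[symmetric] by simp
  have "1 \<le> \<lfloor>x\<rfloor>" using x1 by simp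
  hence "1 \<le> real_of_int \<lfloor>x\<rfloor>" by linarith
  hence "x / 2 \<le> real (spline_dim n \<alpha>)" unfolding J by linarith
  hence "1 / real (spline_dim n \<alpha>) \<le> 1 / (x / 2)" using x1 by (intro divide_left_mono mult_pos_pos) auto
  hence "(1 / real (spline_dim n \<alpha>)) powr \<alpha> \<le> (2 * (1 / x)) powr \<alpha>"
    using \<alpha> by (intro powr_mono2) auto
  also have "\<dots> = 2 powr \<alpha> * (1 / x) powr \<alpha>" by (rule powr_mult)
  also have "(1 / x) powr \<alpha> = rate n \<alpha>"
  proof -
    have "1 / x = real n powr (- (1 / (2 * \<alpha> + 1)))" unfolding x_def by (simp add: powr_minus_divide)
    hence "(1 / x) powr \<alpha> = real n powr (- (1 / (2 * \<alpha> + 1)) * \<alpha>)" by (simp add: powr_powr)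
    thus ?thesis unfolding rate_def by simp
  qed
  finally show "(1 / real (spline_dim n \<alpha>)) powr \<alpha> \<le> 2 powr \<alpha> * rate n \<alpha>" .
qed

lemma countable_pos_rats: "countable pos_rats"
  unfolding pos_rats_def by (rule countable_subset[OF _ countable_rat]) auto

text \<open>Each root is at most the sum \<open>S\<close> of all roots, so
  \<open>\<mu> \<alpha>\<close> is at most \<open>S * sqrt (\<mu> \<alpha>)\<close>.\<close>

lemma summable_on_of_sqrt:
  fixes \<mu> :: "real \<Rightarrow> real"
  assumes pos: "\<And>\<alpha>. \<alpha> \<in> A \<Longrightarrow> \<mu> \<alpha> > 0" and s: "(\<lambda>\<alpha>. sqrt (\<mu> \<alpha>)) summable_on A"
  shows "\<mu> summable_on A"
proof -
  define S where "S = infsum (\<lambda>\<alpha>. sqrt (\<mu> \<alpha>)) A"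
  have le: "sqrt (\<mu> \<alpha>) \<le> S" if "\<alpha> \<in> A" for \<alpha>
    using finite_sum_le_infsum[OF s, of "{\<alpha>}"] that pos unfolding S_def by (simp add: less_imp_le)
  have "(\<lambda>\<alpha>. S * sqrt (\<mu> \<alpha>)) summable_on A" using s by (rule summable_on_cmult_right)
  thus ?thesis
  proof (rule summable_on_comparison_test)
    fix \<alpha> assume \<alpha>: "\<alpha> \<in> A"
    have "\<mu> \<alpha> = sqrt (\<mu> \<alpha>) * sqrt (\<mu> \<alpha>)" using pos[OF \<alpha>] by simp
    also have "\<dots> \<le> S * sqrt (\<mu> \<alpha>)" using le[OF \<alpha>] pos[OF \<alpha>] by (intro mult_right_mono) auto
    finally show "\<mu> \<alpha> \<le> S * sqrt (\<mu> \<alpha>)" .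
  qed (use pos in \<open>auto intro: less_imp_le\<close>)
qed

lemma nn_integral_count_space_finite:
  fixes \<mu> :: "real \<Rightarrow> real"
  assumes pos: "\<And>\<alpha>. \<alpha> \<in> A \<Longrightarrow> \<mu> \<alpha> \<ge> 0" and s: "\<mu> summable_on A"
  obtains K where "K \<ge> 0" "(\<integral>\<^sup>+\<alpha>. ennreal (\<mu> \<alpha>) \<partial>count_space A) = ennreal K"
proof -
  have "Infinite_Sum.abs_summable_on \<mu> A" using s by (subst (asm) summable_on_iff_abs_summable_on_real)
  hence i: "integrable (count_space A) \<mu>"
    unfolding abs_summable_equivalent abs_summable_on_def .
  have "(\<integral>\<^sup>+\<alpha>. ennreal (\<mu> \<alpha>) \<partial>count_space A) = ennreal (integral\<^sup>L (count_space A) \<mu>)"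
    using i pos by (intro nn_integral_eq_integral) (auto simp: AE_count_space)
  moreover have "integral\<^sup>L (count_space A) \<mu> \<ge> 0" using pos by (intro integral_nonneg_AE) (auto simp: AE_count_space)
  ultimately show ?thesis using that by blast
qed

text \<open>The normalizer is positive and common to all models, so it cancels when two weights are
  compared.\<close>

lemma model_weight_ratio:
  assumes C: "C > 0" and pos: "\<And>\<alpha>. \<alpha> \<in> pos_rats \<Longrightarrow> \<mu> \<alpha> > 0" and s: "\<mu> summable_on pos_rats" and \<beta>: "\<beta> \<in> pos_rats"
  obtains Z where "Z > 0" "\<And>\<alpha>. model_weight C \<mu> n \<alpha> = \<mu> \<alpha> * exp (- C * (real n * (rate n \<alpha>)\<^sup>2)) / Z"
proof -
  define g where "g \<alpha> = \<mu> \<alpha> * exp (- C * real n * (rate n \<alpha>)\<^sup>2)" for \<alpha>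
  have g0: "g \<alpha> > 0" if "\<alpha> \<in> pos_rats" for \<alpha> unfolding g_def using pos[OF that] by simp
  have gs: "g summable_on pos_rats"
  proof (rule summable_on_comparison_test[OF s])
    fix \<alpha> assume \<alpha>: "\<alpha> \<in> pos_rats"
    show "g \<alpha> \<le> \<mu> \<alpha>" unfolding g_def using pos[OF \<alpha>] C by (simp add: mult_left_le)
  qed (use g0 in \<open>auto intro: less_imp_le\<close>)
  have "g \<beta> \<le> infsum g pos_rats"
    using finite_sum_le_infsum[OF gs, of "{\<beta>}"] \<beta> g0 by (simp add: less_imp_le)
  hence "infsum g pos_rats > 0" using g0[OF \<beta>] by linarith
  thus ?thesis using that[of "infsum g pos_rats"] unfolding model_weight_def g_def by (simp add: mult.assoc)
qed

lemma average_le_ennreal: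
  fixes g :: "'a \<Rightarrow> ennreal"
  assumes "finite A" "A \<noteq> {}" "\<And>a. a \<in> A \<Longrightarrow> g a \<le> c"
  shows "(\<Sum>a\<in>A. g a) / of_nat (card A) \<le> c"
proof (rule divide_le_posI_ennreal)
  show "0 < (of_nat (card A) :: ennreal)" using assms by (simp add: card_gt_0_iff)
  have "(\<Sum>a\<in>A. g a) \<le> (\<Sum>a\<in>A. c)" using assms(3) by (rule sum_mono)
  thus "(\<Sum>a\<in>A. g a) \<le> of_nat (card A) * c" by simp
qed

lemma polynomial_exp_limit:
  fixes H a c :: real
  assumes "a > 0"
  shows "((\<lambda>x. (H * x + 1)\<^sup>2 * (4 * exp (- a * x)) + c * exp (- x)) \<longlongrightarrow> 0) at_top"
proof -
  have p: "((\<lambda>x::real. x ^ k / exp x) \<longlongrightarrow> 0) at_top" for k by (rule tendsto_power_div_exp_0)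
  have l: "filterlim (\<lambda>x. a * x) at_top at_top" by (rule filterlim_tendsto_pos_mult_at_top[OF tendsto_const assms filterlim_ident])
  have q: "((\<lambda>x. (a * x) ^ k / exp (a * x)) \<longlongrightarrow> 0) at_top" for k using filterlim_compose[OF p l] .
  have "((\<lambda>x. 4 * (H / a)\<^sup>2 * ((a * x) ^ 2 / exp (a * x)) + 8 * (H / a) * ((a * x) ^ 1 / exp (a * x)) + 4 * ((a * x) ^ 0 / exp (a * x)) + c * (x ^ 0 / exp x))
      \<longlongrightarrow> 4 * (H / a)\<^sup>2 * 0 + 8 * (H / a) * 0 + 4 * 0 + c * 0) at_top"
    by (intro tendsto_intros q p)
  moreover have "4 * (H / a)\<^sup>2 * ((a * x) ^ 2 / exp (a * x)) + 8 * (H / a) * ((a * x) ^ 1 / exp (a * x)) + 4 * ((a * x) ^ 0 / exp (a * x)) + c * (x ^ 0 / exp x)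
      = (H * x + 1)\<^sup>2 * (4 * exp (- a * x)) + c * exp (- x)" for x
  proof -
    have d: "y / exp (a * x) = y * exp (- a * x)" "y / exp x = y * exp (- x)" for y
      by (simp_all add: exp_minus divide_inverse)
    have e: "H / a * (a * x) = H * x" using assms by simp
    have "4 * u\<^sup>2 * (v ^ 2 * E) + 8 * u * (v ^ 1 * E) + 4 * (v ^ 0 * E) + c * (x ^ 0 * G)
      = 4 * (u * v)\<^sup>2 * E + 8 * (u * v) * E + 4 * E + c * G" for u v E G :: real
      by (simp add: power_mult_distrib)
    note 1 = this[of "H / a" "a * x" "exp (- a * x)" "exp (- x)", unfolded e]
    show ?thesis unfolding d 1 by (simp add: power2_eq_square algebra_simps)
  qed
  ultimately show ?thesis by simp
qed

lemma iid_component_measurable: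
  assumes "u \<in> borel_measurable unit_lebesgue" "i \<in> {1..n}"
  shows "(\<lambda>X. u (X i)) \<in> borel_measurable (iid_sample p0 n)"
proof -
  have "u \<in> borel_measurable (measure01 p0)" using assms(1) by (simp cong: measurable_cong_sets)
  thus ?thesis unfolding iid_sample_def
    using assms(2) by (intro measurable_compose[OF measurable_component_singleton]) auto
qed

lemma powr_at_top_lim: "a > 0 \<Longrightarrow> filterlim (\<lambda>y::real. y powr a) at_top at_top"
  unfolding filterlim_at_top
proof (intro allI)
  fix Z :: real
  assume a: "a > 0"
  have "Z \<le> y powr a" if "y \<ge> max 1 Z powr (1 / a)" for y
  proof -
    have "max 1 Z = (max 1 Z powr (1 / a)) powr a" using a by (simp add: powr_powr)
    also have "\<dots> \<le> y powr a" using that a by (intro powr_mono2) auto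
    finally show ?thesis by simp
  qed
  thus "\<forall>\<^sub>F y in at_top. Z \<le> y powr a" unfolding eventually_at_top_linorder by blast
qed

theorem theorem5p3:
  fixes M C :: real
    and \<mu> :: "real \<Rightarrow> real"
    and q :: "real \<Rightarrow> nat"
    and N :: "nat \<Rightarrow> real \<Rightarrow> nat"
    and f :: "nat \<Rightarrow> real \<Rightarrow> nat \<Rightarrow> real \<Rightarrow> real"
    and \<theta> :: "nat \<Rightarrow> real \<Rightarrow> nat \<Rightarrow> nat \<Rightarrow> real"
    and p0 :: "real \<Rightarrow> real"
    and \<beta> :: real
  assumes "M > 0" and "C > 0"
    and mu_pos: "\<And>\<alpha>. \<alpha> \<in> pos_rats \<Longrightarrow> \<mu> \<alpha> > 0"
    and mu_summable: "(\<lambda>\<alpha>. sqrt (\<mu> \<alpha>)) summable_on pos_rats"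
    and order: "\<And>\<alpha>. \<alpha> \<in> pos_rats \<Longrightarrow> real (q \<alpha>) \<ge> \<alpha>"
    and net_in_ball: "\<And>n \<alpha> i. \<lbrakk>n \<ge> 1; \<alpha> \<in> pos_rats; i \<in> {1..N n \<alpha>}\<rbrakk>
          \<Longrightarrow> f n \<alpha> i \<in> hoelder_space \<alpha> \<and> hoelder_norm \<alpha> (f n \<alpha> i) \<le> M"
    and net_covers: "\<And>n \<alpha> g. \<lbrakk>n \<ge> 1; \<alpha> \<in> pos_rats; g \<in> hoelder_space \<alpha>; hoelder_norm \<alpha> g \<le> M\<rbrakk>
          \<Longrightarrow> \<exists>i\<in>{1..N n \<alpha>}. sup_norm (\<lambda>x. g x - f n \<alpha> i x) \<le> rate n \<alpha>"
    and net_size: "\<And>\<alpha>. \<alpha> \<in> pos_rats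
          \<Longrightarrow> \<exists>D. \<forall>n\<ge>1. ln (real (N n \<alpha>)) \<le> D * (M / rate n \<alpha>) powr (1 / \<alpha>)"
    and theta_vector: "\<And>n \<alpha> i. \<lbrakk>n \<ge> 1; \<alpha> \<in> usable_indices q n; i \<in> {1..N n \<alpha>}\<rbrakk>
          \<Longrightarrow> \<theta> n \<alpha> i \<in> {1..spline_dim n \<alpha>} \<rightarrow>\<^sub>E UNIV"
    and theta_approx: "\<And>\<alpha>. \<alpha> \<in> pos_rats
          \<Longrightarrow> \<exists>D. \<forall>n\<ge>1. \<alpha> \<in> usable_indices q n \<longrightarrow> (\<forall>i\<in>{1..N n \<alpha>}.
                sup_norm (\<lambda>x. spline_comb (q \<alpha>) (spline_dim n \<alpha>) (\<theta> n \<alpha> i) x - f n \<alpha> i x)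
                  \<le> D * (1 / real (spline_dim n \<alpha>)) powr \<alpha>)"
    and p0_prob: "prob_space (measure01 p0)"
    and p0_pos: "\<And>x. x \<in> {0..1} \<Longrightarrow> p0 x > 0"
    and beta: "\<beta> \<in> pos_rats"
    and p0_hoelder: "p0 \<in> hoelder_space \<beta>"
    and log_p0_hoelder: "(\<lambda>x. ln (p0 x)) \<in> hoelder_space \<beta>"
    and log_p0_norm: "hoelder_norm \<beta> (\<lambda>x. ln (p0 x)) < M"
  shows "\<exists>B::real.
    (\<lambda>n. \<integral>\<^sup>+X. posterior (usable_indices q n) (model_weight C \<mu> n)
              (\<lambda>\<alpha>. sieve_prior (q \<alpha>) (spline_dim n \<alpha>) (\<theta> n \<alpha> ` {1..N n \<alpha>}))
              n X {p. hellinger p p0 \<ge> B * rate n \<beta>}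
            \<partial>iid_sample p0 n) \<longlonglongrightarrow> 0"
proof -
  have \<beta>0: "\<beta> > 0" using beta unfolding pos_rats_def by auto
  have p0c: "continuous_on {0..1} p0" by (rule hoelder_space_continuous[OF \<beta>0 p0_hoelder])
  have lnc: "continuous_on {0..1} (\<lambda>x. ln (p0 x))" by (rule hoelder_space_continuous[OF \<beta>0 log_p0_hoelder])
  have p0d: "bounded_density p0" by (rule bounded_density_prob[OF p0c p0_pos p0_prob])
  have mu_sum: "\<mu> summable_on pos_rats" by (rule summable_on_of_sqrt[OF mu_pos mu_summable])
  obtain K where K: "K \<ge> 0" "(\<integral>\<^sup>+\<alpha>. ennreal (\<mu> \<alpha>) \<partial>count_space pos_rats) = ennreal K"
    by (rule nn_integral_count_space_finite[OF less_imp_le[OF mu_pos] mu_sum])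
  obtain D1 where D1: "\<forall>n\<ge>1. ln (real (N n \<beta>)) \<le> D1 * (M / rate n \<beta>) powr (1 / \<beta>)" using net_size[OF beta] by blast
  obtain D2 where D2: "\<forall>n\<ge>1. \<beta> \<in> usable_indices q n \<longrightarrow> (\<forall>i\<in>{1..N n \<beta>}.
      sup_norm (\<lambda>x. spline_comb (q \<beta>) (spline_dim n \<beta>) (\<theta> n \<beta> i) x - f n \<beta> i x)
        \<le> D2 * (1 / real (spline_dim n \<beta>)) powr \<beta>)" using theta_approx[OF beta] by blast
  from log_spline_type_I_error obtain BT r where BT: "0 < BT" and r: "0 < r" and type_I: "\<forall>p0 q J n \<Theta> D.
     bounded_density p0 \<longrightarrow> prob_space (measure01 p0) \<longrightarrow> countable \<Theta> \<longrightarrow> BT * real (J + 2) \<le> D \<longrightarrow>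
     (\<forall>\<theta>\<in>\<Theta>. D \<le> real n * hellinger_square (log_spline_density q J \<theta>) p0) \<longrightarrow>
     emeasure (iid_sample p0 n) {X \<in> space (iid_sample p0 n). \<exists>\<theta>\<in>\<Theta>.
        0 < (\<Sum>i=1..n. test_stat (log_spline_density q J \<theta>) p0 (X i))} \<le> ennreal (4 * exp (- r * D))"
    by (elim exE conjE) (rule that)

  \<comment> \<open>Choice of the constants\<close>
  define K1 where "K1 = max 0 (D1 * M powr (1 / \<beta>))"
  \<comment> \<open>Uniform distance from the selected spline to \<open>ln p0\<close>, in units of
    the rate: 1 for the net and the rest for the spline approximation.\<close>
  define K2 where "K2 = 1 + max 0 D2 * 2 powr \<beta>"
  \<comment> \<open>With normalization the log ratio is at most \<open>2 * K2\<close> rates, hence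
    at most \<open>2 * K2\<close>; inserted into \<open>inverse_likelihood_ratio_mean\<close>, this
    gives the exponent \<open>K3 * x n\<close> for \<open>n\<close> observations.\<close>
  define K3 where "K3 = 4 * K2\<^sup>2 * exp (2 * K2)"
  \<comment> \<open>The exponents to be beaten, in units of \<open>x n\<close>: \<open>K1\<close>
    for the size of the net, \<open>K3 + 1\<close> for the likelihood ratio, \<open>C\<close> for
    the weight of model \<beta>, and 1 left over for convergence.\<close>
  define G where "G = K1 + K3 + 2 + C"
  define H where "H = max 1 (G / C)"
  \<comment> \<open>The first bound makes the error of the second kind at most
    \<open>exp (- G * x n)\<close>. The second is what the tests require, since the spaces of smooth
    models have dimension \<open>J + 2\<close> at most \<open>(H + 2) * x n\<close>.\<close>
  define B where "B = sqrt (max (256 * G) (BT * (H + 2)))"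
  have K1: "K1 \<ge> 0" unfolding K1_def by simp
  have K2: "K2 \<ge> 1" unfolding K2_def by simp
  have K3: "K3 \<ge> 0" unfolding K3_def by simp
  have G: "G > 0" unfolding G_def using K1 K3 \<open>C > 0\<close> by simp
  have H: "H \<ge> 1" "C * H \<ge> G" unfolding H_def using \<open>C > 0\<close> by (auto simp: max_def field_simps)
  have B2: "B\<^sup>2 = max (256 * G) (BT * (H + 2))" unfolding B_def using G by (intro real_sqrt_pow2) (simp add: le_max_iff_disj)
  have B: "B > 0" "B\<^sup>2 \<ge> 256 * G" "B\<^sup>2 \<ge> BT * (H + 2)"
    unfolding B2 unfolding B_def using G by (auto simp: less_max_iff_disj)
  define x where "x n = real n powr (1 / (2 * \<beta> + 1))" for n
  define bound where "bound y = (H * y + 1)\<^sup>2 * (4 * exp (- (r * B\<^sup>2) * y)) + (1 + K / \<mu> \<beta>) * exp (- y)" for y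
  have main: "(\<integral>\<^sup>+X. posterior (usable_indices q n) (model_weight C \<mu> n)
              (\<lambda>\<alpha>. sieve_prior (q \<alpha>) (spline_dim n \<alpha>) (\<theta> n \<alpha> ` {1..N n \<alpha>}))
              n X {p. hellinger p p0 \<ge> B * rate n \<beta>}
            \<partial>iid_sample p0 n) \<le> ennreal (bound (x n))"
    if n: "n \<ge> 1" and large: "real (q \<beta>) + 1 \<le> x n" for n
  proof -
    let ?P = "iid_sample p0 n"
    define I where "I = usable_indices q n"
    define w where "w = model_weight C \<mu> n"
    define dm where "dm = spline_dim n"
    define \<Theta> where "\<Theta> \<alpha> = \<theta> n \<alpha> ` {1..N n \<alpha>}" for \<alpha>
    define pd where "pd \<alpha> t = log_spline_density (q \<alpha>) (dm \<alpha>) t" for \<alpha> t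
    define S where "S = {p. hellinger p p0 \<ge> B * rate n \<beta>}"
    define smooth where "smooth \<alpha> \<longleftrightarrow> real n powr (1 / (2 * \<alpha> + 1)) < H * x n" for \<alpha>
    define Pr where "Pr \<alpha> = sieve_prior (q \<alpha>) (dm \<alpha>) (\<Theta> \<alpha>)" for \<alpha>
    have x1: "x n \<ge> 1" using large by simp
    have nrate: "real n * (rate n \<beta>)\<^sup>2 = x n" unfolding x_def by (rule rate_square[OF n \<beta>0])
    have I_sub: "I \<subseteq> pos_rats" unfolding I_def usable_indices_def by auto
    have cI: "countable I" by (rule countable_subset[OF I_sub countable_pos_rats])
    have Ipos: "\<alpha> > 0" if "\<alpha> \<in> I" for \<alpha> using that I_sub unfolding pos_rats_def by auto
    have fin: "finite (\<Theta> \<alpha>)" for \<alpha> unfolding \<Theta>_def by simp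
    have ne: "\<Theta> \<alpha> \<noteq> {}" if \<alpha>r: "\<alpha> \<in> pos_rats" for \<alpha>
    proof -
      obtain i where "i \<in> {1..N n \<alpha>}" using net_covers[OF n \<alpha>r zero_in_hoelder_ball(1)] zero_in_hoelder_ball(2) \<open>M > 0\<close> by auto
      thus ?thesis unfolding \<Theta>_def by auto
    qed
    have pdd: "bounded_density (pd \<alpha> t)" for \<alpha> t unfolding pd_def by (rule bounded_density_log_spline)
    have pd_pos: "pd \<alpha> t y > 0" for \<alpha> t y unfolding pd_def log_spline_density_def by simp
    have spaceP: "Y i \<in> {0..1}" if "Y \<in> space ?P" "i \<in> {1..n}" for Y i
      using that unfolding iid_sample_def space_PiM by (auto simp: PiE_def Pi_def)

    \<comment> \<open>Tests for the smooth models\<close>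
    define m where "m = nat \<lfloor>H * x n\<rfloor>"
    have Hx: "H * x n \<ge> 1" using H x1 mult_mono[of 1 H 1 "x n"] by simp
    have m: "real m \<le> H * x n" unfolding m_def using Hx by simp
    \<comment> \<open>There may be infinitely many smooth models, but they are distinguished here
      only by order and dimension. Pooling their parameters leaves one test for each pair of numbers
      up to \<open>m\<close>, so that the union bound costs only a polynomial factor.\<close>
    define \<Theta>s where "\<Theta>s k J = {t. \<exists>\<alpha>\<in>I. q \<alpha> = k \<and> dm \<alpha> = J \<and> smooth \<alpha> \<and> t \<in> \<Theta> \<alpha> \<and> log_spline_density k J t \<in> S}" for k J
    define A1 where "A1 k J = {Y \<in> space ?P. \<exists>t\<in>\<Theta>s k J. 0 < (\<Sum>i=1..n. test_stat (log_spline_density k J t) p0 (Y i))}" for k J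
    have c\<Theta>s: "countable (\<Theta>s k J)" for k J
      by (rule countable_subset[of _ "\<Union>\<alpha>\<in>I. \<Theta> \<alpha>"]) (use cI fin in \<open>auto simp: \<Theta>s_def countable_finite\<close>)
    have A1m: "A1 k J \<in> sets ?P" for k J
    proof -
      have [measurable]: "(\<lambda>Y. test_stat (log_spline_density k J t) p0 (Y i)) \<in> borel_measurable ?P" if "i \<in> {1..n}" for t i
        using that by (intro iid_component_measurable test_stat_measurable bounded_density_log_spline p0d) auto
      have "A1 k J = (\<Union>t\<in>\<Theta>s k J. {Y \<in> space ?P. 0 < (\<Sum>i=1..n. test_stat (log_spline_density k J t) p0 (Y i))})"
        unfolding A1_def by auto
      also have "\<dots> \<in> sets ?P" using c\<Theta>s by (intro sets.countable_UN'') measurable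
      finally show ?thesis .
    qed
    have hell: "B\<^sup>2 * x n \<le> real n * hellinger_square p p0" if "p \<in> S" for p
    proof -
      have "B * rate n \<beta> \<le> sqrt (hellinger_square p p0)" using that unfolding S_def hellinger_eq by simp
      hence "(B * rate n \<beta>)\<^sup>2 \<le> (sqrt (hellinger_square p p0))\<^sup>2"
        using B rate_bounds[OF n \<beta>0] by (intro power_mono) auto
      hence "B\<^sup>2 * (rate n \<beta>)\<^sup>2 \<le> hellinger_square p p0"
        using hellinger_square_nonneg by (simp add: power_mult_distrib)
      hence "real n * (B\<^sup>2 * (rate n \<beta>)\<^sup>2) \<le> real n * hellinger_square p p0" by (intro mult_left_mono) auto
      thus ?thesis unfolding nrate[symmetric] by (simp add: mult_ac)
    qed
    have A1e: "emeasure ?P (A1 k J) \<le> ennreal (4 * exp (- (r * B\<^sup>2) * x n))" if J: "J \<le> m" for k J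
    proof -
      have "real (J + 2) \<le> (H + 2) * x n"
      proof -
        have "real J \<le> H * x n" using J m by linarith
        thus ?thesis using x1 by (simp add: distrib_right)
      qed
      hence "BT * real (J + 2) \<le> BT * ((H + 2) * x n)" using BT by (intro mult_left_mono) auto
      also have "\<dots> \<le> B\<^sup>2 * x n" using B(3) x1 by (simp add: mult.assoc[symmetric] mult_right_mono)
      finally have b1: "BT * real (J + 2) \<le> B\<^sup>2 * x n" .
      have b2: "\<forall>t\<in>\<Theta>s k J. B\<^sup>2 * x n \<le> real n * hellinger_square (log_spline_density k J t) p0"
        using hell unfolding \<Theta>s_def by blast
      note type_I[THEN spec[where x = p0], THEN spec[where x = k], THEN spec[where x = J], THEN spec[where x = n],
        THEN spec[where x = "\<Theta>s k J"], THEN spec[where x = "B\<^sup>2 * x n"], THEN mp, OF p0d, THEN mp, OF p0_prob,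
        THEN mp, OF c\<Theta>s, THEN mp, OF b1, THEN mp, OF b2]
      thus ?thesis unfolding A1_def by (simp add: mult.assoc)
    qed

    \<comment> \<open>Lower bound for the evidence\<close>
    have usable: "\<beta> \<in> I"
    proof -
      have "int (q \<beta>) \<le> \<lfloor>x n\<rfloor>" using large by (simp add: le_floor_iff)
      hence "q \<beta> \<le> spline_dim n \<beta>" unfolding spline_dim_def x_def[symmetric] by linarith
      thus ?thesis unfolding I_def usable_indices_def using beta by simp
    qed
    obtain t0 where t0: "t0 \<in> \<Theta> \<beta>" and close: "\<And>y. y \<in> {0..1} \<Longrightarrow> \<bar>ln (pd \<beta> t0 y) - ln (p0 y)\<bar> \<le> 2 * (K2 * rate n \<beta>)"
    proof -
      obtain i where i: "i \<in> {1..N n \<beta>}" "sup_norm (\<lambda>y. ln (p0 y) - f n \<beta> i y) \<le> rate n \<beta>"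
        using net_covers[OF n beta log_p0_hoelder] log_p0_norm by auto
      have fc: "continuous_on {0..1} (f n \<beta> i)"
        using net_in_ball[OF n beta i(1)] by (intro hoelder_space_continuous[OF \<beta>0]) auto
      obtain Kf where Kf: "\<And>y. y \<in> {0..1} \<Longrightarrow> \<bar>f n \<beta> i y\<bar> \<le> Kf" using continuous_on_unit_bounded[OF fc] by blast
      obtain Kl where Kl: "\<And>y. y \<in> {0..1} \<Longrightarrow> \<bar>ln (p0 y)\<bar> \<le> Kl" using continuous_on_unit_bounded[OF lnc] by blast
      obtain Ks where Ks: "\<And>y. y \<in> {0..1} \<Longrightarrow> \<bar>spline_comb (q \<beta>) (dm \<beta>) (\<theta> n \<beta> i) y\<bar> \<le> Ks"
        using spline_comb_bounded by blast
      have sp: "sup_norm (\<lambda>y. spline_comb (q \<beta>) (dm \<beta>) (\<theta> n \<beta> i) y - f n \<beta> i y) \<le> D2 * (1 / real (dm \<beta>)) powr \<beta>"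
        using D2 n usable i(1) unfolding I_def dm_def by blast
      have "D2 * (1 / real (dm \<beta>)) powr \<beta> \<le> max 0 D2 * (2 powr \<beta> * rate n \<beta>)"
        unfolding dm_def using spline_dim_bounds(2)[OF n \<beta>0] by (intro mult_mono) auto
      hence sp': "sup_norm (\<lambda>y. spline_comb (q \<beta>) (dm \<beta>) (\<theta> n \<beta> i) y - f n \<beta> i y) \<le> (K2 - 1) * rate n \<beta>"
        using sp unfolding K2_def by (simp add: mult.assoc)
      have c1: "\<bar>spline_comb (q \<beta>) (dm \<beta>) (\<theta> n \<beta> i) y - ln (p0 y)\<bar> \<le> K2 * rate n \<beta>" if y: "y \<in> {0..1}" for y
      proof -
        have b1: "\<bar>ln (p0 z) - f n \<beta> i z\<bar> \<le> Kl + Kf" if "z \<in> {0..1}" for z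
          using Kl[OF that] Kf[OF that] by linarith
        have b2: "\<bar>spline_comb (q \<beta>) (dm \<beta>) (\<theta> n \<beta> i) z - f n \<beta> i z\<bar> \<le> Ks + Kf" if "z \<in> {0..1}" for z
          using Ks[OF that] Kf[OF that] by linarith
        have "\<bar>ln (p0 y) - f n \<beta> i y\<bar> \<le> rate n \<beta>"
          using abs_le_sup_norm[of "\<lambda>y. ln (p0 y) - f n \<beta> i y", OF b1 y] i(2) by simp
        moreover have "\<bar>spline_comb (q \<beta>) (dm \<beta>) (\<theta> n \<beta> i) y - f n \<beta> i y\<bar> \<le> (K2 - 1) * rate n \<beta>"
          using abs_le_sup_norm[of "\<lambda>y. spline_comb (q \<beta>) (dm \<beta>) (\<theta> n \<beta> i) y - f n \<beta> i y", OF b2 y] sp' by simp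
        ultimately show ?thesis by (simp add: left_diff_distrib)
      qed
      show ?thesis
      proof (rule that)
        show "\<theta> n \<beta> i \<in> \<Theta> \<beta>" unfolding \<Theta>_def using i(1) by auto
        show "\<bar>ln (pd \<beta> (\<theta> n \<beta> i) y) - ln (p0 y)\<bar> \<le> 2 * (K2 * rate n \<beta>)" if "y \<in> {0..1}" for y
          unfolding pd_def using log_spline_close[OF p0d c1 that] by simp
      qed
    qed
    \<comment> \<open>\<open>K3 * x n\<close> bounds the logarithm of the exponential moment; the
      additional \<open>x n\<close> is the exponent of the exceptional event
      \<open>A2\<close>.\<close>
    define \<kappa> where "\<kappa> = (K3 + 1) * x n"
    define A2 where "A2 = {Y \<in> space ?P. \<kappa> \<le> (\<Sum>i=1..n. ln (p0 (Y i)) - ln (pd \<beta> t0 (Y i)))}"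
    have Lm: "(\<lambda>y. ln (p0 y) - ln (pd \<beta> t0 y)) \<in> borel_measurable unit_lebesgue"
    proof -
      have [measurable]: "p0 \<in> borel_measurable unit_lebesgue" "pd \<beta> t0 \<in> borel_measurable unit_lebesgue"
        using p0d pdd unfolding bounded_density_def by auto
      show ?thesis by measurable
    qed
    have A2m: "A2 \<in> sets ?P"
    proof -
      have [measurable]: "(\<lambda>Y. ln (p0 (Y i)) - ln (pd \<beta> t0 (Y i))) \<in> borel_measurable ?P" if "i \<in> {1..n}" for i
        using iid_component_measurable[OF Lm that] .
      show ?thesis unfolding A2_def by measurable
    qed
    have A2e: "emeasure ?P A2 \<le> ennreal (exp (- x n))"
    proof -
      define rr where "rr = 2 * (K2 * rate n \<beta>)"
      have rate01: "0 < rate n \<beta>" "rate n \<beta> \<le> 1" using rate_bounds[OF n \<beta>0] by auto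
      have Lm': "(\<lambda>y. ln (p0 y) - ln (pd \<beta> t0 y)) \<in> borel_measurable (measure01 p0)"
        using Lm by (simp cong: measurable_cong_sets)
      have "emeasure ?P A2 \<le> ennreal (exp (- \<kappa>)) * (\<integral>\<^sup>+y. ennreal (exp (ln (p0 y) - ln (pd \<beta> t0 y))) \<partial>measure01 p0) ^ card {1..n}"
        unfolding A2_def iid_sample_def by (rule iid_chernoff[OF p0_prob Lm']) simp
      also have "(\<integral>\<^sup>+y. ennreal (exp (ln (p0 y) - ln (pd \<beta> t0 y))) \<partial>measure01 p0) = (\<integral>\<^sup>+y. ennreal (p0 y / pd \<beta> t0 y) \<partial>measure01 p0)"
        by (intro nn_integral_cong) (simp add: exp_diff p0_pos pd_pos)
      also have "\<dots> \<le> ennreal (exp (rr\<^sup>2 * exp rr))"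
        using close unfolding rr_def by (intro inverse_likelihood_ratio_mean[OF pdd p0d]) auto
      finally have "emeasure ?P A2 \<le> ennreal (exp (- \<kappa>)) * ennreal (exp (rr\<^sup>2 * exp rr)) ^ n"
        by (simp add: mult_left_mono power_mono)
      also have "\<dots> = ennreal (exp (- \<kappa> + real n * (rr\<^sup>2 * exp rr)))"
        by (simp only: ennreal_power exp_ge_zero exp_of_nat_mult[symmetric] ennreal_mult[symmetric] exp_add[symmetric])
      also have "\<dots> \<le> ennreal (exp (- x n))"
      proof (intro ennreal_leI)
        have "rr \<le> 2 * K2" unfolding rr_def using rate01 K2 by (simp add: mult_left_le)
        have "real n * (rr\<^sup>2 * exp rr) = 4 * K2\<^sup>2 * x n * exp rr"
          unfolding rr_def nrate[symmetric] by (simp add: power_mult_distrib)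
        also have "\<dots> \<le> 4 * K2\<^sup>2 * x n * exp (2 * K2)"
          using \<open>rr \<le> 2 * K2\<close> x1 by (intro mult_left_mono) auto
        finally have "real n * (rr\<^sup>2 * exp rr) \<le> K3 * x n" unfolding K3_def by (simp add: mult_ac)
        thus "exp (- \<kappa> + real n * (rr\<^sup>2 * exp rr)) \<le> exp (- x n)" unfolding \<kappa>_def by (simp add: distrib_right)
      qed
      finally show ?thesis .
    qed

    obtain Z where Z: "Z > 0" "\<And>\<alpha>. model_weight C \<mu> n \<alpha> = \<mu> \<alpha> * exp (- C * (real n * (rate n \<alpha>)\<^sup>2)) / Z"
      using model_weight_ratio[OF \<open>C > 0\<close> mu_pos mu_sum beta] by blast
    have wpos: "w \<alpha> > 0" if "\<alpha> \<in> pos_rats" for \<alpha> unfolding w_def Z(2) using mu_pos[OF that] Z(1) by simp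
    have Npos: "N n \<beta> \<ge> 1" using ne[OF beta] unfolding \<Theta>_def by (cases "N n \<beta>") auto
    have NK: "real (N n \<beta>) \<le> exp (K1 * x n)"
    proof -
      have "ln (real (N n \<beta>)) \<le> D1 * (M powr (1 / \<beta>) * x n)"
        using D1[THEN spec[where x = n], THEN mp, OF n] by (simp add: rate_powr[OF n \<beta>0 \<open>M > 0\<close>] x_def)
      also have "\<dots> \<le> K1 * x n" unfolding K1_def mult.assoc[symmetric] using x1 by (intro mult_right_mono) auto
      finally have "exp (ln (real (N n \<beta>))) \<le> exp (K1 * x n)" by simp
      thus ?thesis using Npos by simp
    qed
    \<comment> \<open>The parameters of the net need not be distinct. Their set has at most
      \<open>N n \<beta>\<close> elements, so each one has mass at least
      \<open>1 / N n \<beta>\<close>.\<close>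
    define k where "k = w \<beta> * exp (- \<kappa>) / real (N n \<beta>)"
    have k: "k > 0" unfolding k_def using wpos[OF beta] Npos by simp
    define A where "A = (\<Union>(k, J)\<in>{..m} \<times> {..m}. A1 k J) \<union> A2"
    have Am: "A \<in> sets ?P" unfolding A_def using A1m A2m by (intro sets.Un sets.finite_UN) auto
    have Ae: "emeasure ?P A \<le> ennreal ((H * x n + 1)\<^sup>2 * (4 * exp (- (r * B\<^sup>2) * x n)) + exp (- x n))"
    proof -
      have sub: "emeasure ?P A \<le> emeasure ?P (\<Union>(k, J)\<in>{..m} \<times> {..m}. A1 k J) + emeasure ?P A2"
        unfolding A_def using A1m A2m by (intro emeasure_subadditive sets.finite_UN) auto
      have "emeasure ?P (\<Union>(k, J)\<in>{..m} \<times> {..m}. A1 k J) \<le> (\<Sum>z\<in>{..m} \<times> {..m}. emeasure ?P (case z of (k, J) \<Rightarrow> A1 k J))"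
        using A1m by (intro emeasure_subadditive_finite) auto
      also have "\<dots> \<le> (\<Sum>z\<in>{..m} \<times> {..m}. ennreal (4 * exp (- (r * B\<^sup>2) * x n)))"
        using A1e by (intro sum_mono) auto
      also have "\<dots> = ennreal ((real m + 1)\<^sup>2 * (4 * exp (- (r * B\<^sup>2) * x n)))"
        by (subst sum_ennreal) (simp_all add: card_cartesian_product power2_eq_square algebra_simps)
      also have "\<dots> \<le> ennreal ((H * x n + 1)\<^sup>2 * (4 * exp (- (r * B\<^sup>2) * x n)))"
        using m by (intro ennreal_leI mult_right_mono power_mono) auto
      finally have "emeasure ?P A \<le> ennreal ((H * x n + 1)\<^sup>2 * (4 * exp (- (r * B\<^sup>2) * x n))) + ennreal (exp (- x n))"
        by (rule order_trans[OF sub add_mono[OF _ A2e]])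
      thus ?thesis by (simp add: ennreal_plus)
    qed

    \<comment> \<open>Numerators of the single models\<close>
    define u where "u \<alpha> t y = (if smooth \<alpha> then exp (- (test_stat (pd \<alpha> t) p0 y / 32)) else 1) * (pd \<alpha> t y / p0 y)" for \<alpha> t y
    define v where "v \<alpha> Y = (\<Sum>t\<in>\<Theta> \<alpha>. (\<Prod>i=1..n. ennreal (u \<alpha> t (Y i))) * indicator S (pd \<alpha> t)) / of_nat (card (\<Theta> \<alpha>))" for \<alpha> Y
    \<comment> \<open>Smooth models gain from the test; for the others the mean likelihood ratio 1
      suffices, their weights being small.\<close>
    define c where "c \<alpha> = (if smooth \<alpha> then exp (- G * x n) else 1)" for \<alpha>
    have um: "u \<alpha> t \<in> borel_measurable unit_lebesgue" for \<alpha> t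
    proof -
      have [measurable]: "p0 \<in> borel_measurable unit_lebesgue" "pd \<alpha> t \<in> borel_measurable unit_lebesgue"
        "test_stat (pd \<alpha> t) p0 \<in> borel_measurable unit_lebesgue"
        using p0d pdd[of \<alpha> t] test_stat_measurable[OF pdd[of \<alpha> t] p0d] unfolding bounded_density_def by auto
      show ?thesis unfolding u_def[abs_def] by measurable
    qed
    have prm: "(\<lambda>Y. \<Prod>i=1..n. ennreal (u \<alpha> t (Y i))) \<in> borel_measurable ?P" for \<alpha> t
    proof -
      have [measurable]: "(\<lambda>Y. u \<alpha> t (Y i)) \<in> borel_measurable ?P" if "i \<in> {1..n}" for i
        using iid_component_measurable[OF um that] .
      show ?thesis by measurable
    qed
    have vm: "v \<alpha> \<in> borel_measurable ?P" for \<alpha>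
      unfolding v_def[abs_def] using prm by (intro borel_measurable_divide_ennreal borel_measurable_sum borel_measurable_times) auto
    have vi: "(\<integral>\<^sup>+Y. v \<alpha> Y \<partial>?P) \<le> ennreal (c \<alpha>)" if \<alpha>: "\<alpha> \<in> I" for \<alpha>
    proof -
      have "(\<integral>\<^sup>+Y. v \<alpha> Y \<partial>?P) = (\<Sum>t\<in>\<Theta> \<alpha>. (\<integral>\<^sup>+Y. (\<Prod>i=1..n. ennreal (u \<alpha> t (Y i))) \<partial>?P) * indicator S (pd \<alpha> t)) / of_nat (card (\<Theta> \<alpha>))"
        unfolding v_def using prm
        by (subst nn_integral_divide) (auto simp: nn_integral_sum nn_integral_multc intro!: borel_measurable_sum borel_measurable_times)
      also have "\<dots> \<le> ennreal (c \<alpha>)"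
      proof (rule average_le_ennreal[OF fin ne])
        show "\<alpha> \<in> pos_rats" using \<alpha> I_sub by auto
        fix t assume t: "t \<in> \<Theta> \<alpha>"
        show "(\<integral>\<^sup>+Y. (\<Prod>i=1..n. ennreal (u \<alpha> t (Y i))) \<partial>?P) * indicator S (pd \<alpha> t) \<le> ennreal (c \<alpha>)"
        proof (cases "pd \<alpha> t \<in> S")
          case True
          have "(\<integral>\<^sup>+Y. (\<Prod>i=1..n. ennreal (u \<alpha> t (Y i))) \<partial>?P) = (\<integral>\<^sup>+y. ennreal (u \<alpha> t y) \<partial>measure01 p0) ^ n"
            by (rule iid_product_integral[OF p0_prob um])
          also have "\<dots> \<le> ennreal (c \<alpha>)"
          proof (cases "smooth \<alpha>")
            case sm: True
            have "(\<integral>\<^sup>+y. ennreal (u \<alpha> t y) \<partial>measure01 p0) \<le> ennreal (exp (- hellinger_square (pd \<alpha> t) p0 / 256))"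
              using type_II_mgf[OF pdd[of \<alpha> t] p0d] sm unfolding u_def test_stat_def by simp
            hence "(\<integral>\<^sup>+y. ennreal (u \<alpha> t y) \<partial>measure01 p0) ^ n \<le> ennreal (exp (- hellinger_square (pd \<alpha> t) p0 / 256)) ^ n"
              by (intro power_mono) auto
            also have "\<dots> = ennreal (exp (- (real n * hellinger_square (pd \<alpha> t) p0) / 256))"
              by (simp add: ennreal_power flip: exp_of_nat_mult)
            also have "\<dots> \<le> ennreal (exp (- G * x n))"
            proof -
              have "256 * G * x n \<le> B\<^sup>2 * x n" using B(2) x1 by (intro mult_right_mono) auto
              hence "G * x n \<le> real n * hellinger_square (pd \<alpha> t) p0 / 256" using hell[OF True] by simp
              thus ?thesis by (intro ennreal_leI) simp
            qed
            finally show ?thesis unfolding c_def using sm by simp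
          next
            case False
            have "(\<integral>\<^sup>+y. ennreal (u \<alpha> t y) \<partial>measure01 p0) \<le> 1"
              using likelihood_ratio_mean[OF pdd[of \<alpha> t] p0d] False unfolding u_def by simp
            hence "(\<integral>\<^sup>+y. ennreal (u \<alpha> t y) \<partial>measure01 p0) ^ n \<le> 1 ^ n" by (intro power_mono) auto
            thus ?thesis unfolding c_def using False by simp
          qed
          finally show ?thesis using True by simp
        qed simp
      qed
      finally show ?thesis .
    qed
    have num: "(\<integral>\<^sup>+p\<in>S. ennreal (\<Prod>i=1..n. p (Y i) / p0 (Y i)) \<partial>measure_pmf (Pr \<alpha>)) \<le> v \<alpha> Y"
      if Y: "Y \<in> space ?P - A" and \<alpha>: "\<alpha> \<in> I" for Y \<alpha>
    proof -
      have \<alpha>': "\<alpha> \<in> pos_rats" using \<alpha> I_sub by auto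
      have p0Y: "p0 (Y i) > 0" if "i \<in> {1..n}" for i using spaceP[of Y i] Y that p0_pos by auto
      have "(\<integral>\<^sup>+p\<in>S. ennreal (\<Prod>i=1..n. p (Y i) / p0 (Y i)) \<partial>measure_pmf (Pr \<alpha>))
        = (\<Sum>t\<in>\<Theta> \<alpha>. ennreal (\<Prod>i=1..n. pd \<alpha> t (Y i) / p0 (Y i)) * indicator S (pd \<alpha> t)) / of_nat (card (\<Theta> \<alpha>))"
        unfolding Pr_def pd_def by (rule nn_integral_sieve_prior[OF fin ne[OF \<alpha>']])
      also have "\<dots> \<le> v \<alpha> Y"
        unfolding v_def
      proof (intro divide_right_mono_ennreal sum_mono)
        fix t assume t: "t \<in> \<Theta> \<alpha>"
        show "ennreal (\<Prod>i=1..n. pd \<alpha> t (Y i) / p0 (Y i)) * indicator S (pd \<alpha> t)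
          \<le> (\<Prod>i=1..n. ennreal (u \<alpha> t (Y i))) * indicator S (pd \<alpha> t)"
        proof (cases "pd \<alpha> t \<in> S")
          case True
          have unn: "u \<alpha> t (Y i) \<ge> 0" if "i \<in> {1..n}" for i
            unfolding u_def using p0Y[OF that] pd_pos[of \<alpha> t "Y i"] by simp
          define W where "W = (\<Prod>i=1..n. pd \<alpha> t (Y i) / p0 (Y i))"
          have W: "W \<ge> 0" unfolding W_def using p0Y pd_pos by (intro prod_nonneg) (auto intro!: divide_nonneg_pos less_imp_le)
          \<comment> \<open>Off \<open>A\<close> the sum of the test statistics is at most 0, so the
            factors \<open>exp (- (test_stat (pd \<alpha> t) p0 y / 32))\<close> multiply to at
            least 1. They stand in for the indicator of acceptance and keep the majorant a product
            over the observations.\<close>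
          have "W \<le> (\<Prod>i=1..n. u \<alpha> t (Y i))"
          proof (cases "smooth \<alpha>")
            case sm: True
            have "real (dm \<alpha>) \<le> H * x n"
              using spline_dim_bounds(1)[OF n Ipos[OF \<alpha>]] sm unfolding dm_def smooth_def by linarith
            hence dmm: "dm \<alpha> \<le> m" unfolding m_def by (simp add: le_nat_floor)
            \<comment> \<open>Usability bounds the order by the dimension, so both are at most
              \<open>m\<close> and the pair is among those tested.\<close>
            have "q \<alpha> \<le> dm \<alpha>" using \<alpha> unfolding I_def usable_indices_def dm_def by auto
            hence "Y \<notin> A1 (q \<alpha>) (dm \<alpha>)" using Y dmm unfolding A_def by auto
            moreover have "t \<in> \<Theta>s (q \<alpha>) (dm \<alpha>)" unfolding \<Theta>s_def using \<alpha> sm t True unfolding pd_def by auto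
            ultimately have "(\<Sum>i=1..n. test_stat (pd \<alpha> t) p0 (Y i)) \<le> 0"
              using Y unfolding A1_def pd_def by force
            hence "1 \<le> exp (- ((\<Sum>i=1..n. test_stat (pd \<alpha> t) p0 (Y i)) / 32))" by simp
            also have "\<dots> = (\<Prod>i=1..n. exp (- (test_stat (pd \<alpha> t) p0 (Y i) / 32)))"
              by (simp add: exp_sum[symmetric] sum_negf sum_divide_distrib)
            finally have "1 * W \<le> (\<Prod>i=1..n. exp (- (test_stat (pd \<alpha> t) p0 (Y i) / 32))) * W" using W by (intro mult_right_mono)
            also have "\<dots> = (\<Prod>i=1..n. u \<alpha> t (Y i))"
              unfolding W_def prod.distrib[symmetric] u_def using sm by simp
            finally show ?thesis by simp
          next
            case False
            thus ?thesis unfolding W_def u_def by simp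
          qed
          hence "ennreal W \<le> (\<Prod>i=1..n. ennreal (u \<alpha> t (Y i)))"
            using unn by (subst prod_ennreal) (auto intro: ennreal_leI)
          thus ?thesis unfolding W_def using True by simp
        qed simp
      qed
      finally show ?thesis .
    qed
    have den: "ennreal (k * (\<Prod>i=1..n. p0 (Y i))) \<le> weighted_likelihood I w Pr n Y UNIV"
      if Y: "Y \<in> space ?P - A" for Y
    proof -
      have p0Y: "p0 (Y i) > 0" if "i \<in> {1..n}" for i using spaceP[of Y i] Y that p0_pos by auto
      have "(\<Sum>i=1..n. ln (p0 (Y i)) - ln (pd \<beta> t0 (Y i))) \<le> \<kappa>" using Y unfolding A_def A2_def by auto
      hence "exp (- \<kappa>) * exp (\<Sum>i=1..n. ln (p0 (Y i))) \<le> exp (\<Sum>i=1..n. ln (pd \<beta> t0 (Y i)))"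
        by (simp add: sum_subtractf flip: exp_add)
      also have "exp (\<Sum>i=1..n. ln (pd \<beta> t0 (Y i))) = (\<Prod>i=1..n. pd \<beta> t0 (Y i))"
        using pd_pos by (simp add: exp_sum)
      also have "exp (\<Sum>i=1..n. ln (p0 (Y i))) = (\<Prod>i=1..n. p0 (Y i))"
        using p0Y by (simp add: exp_sum)
      finally have L: "exp (- \<kappa>) * (\<Prod>i=1..n. p0 (Y i)) \<le> (\<Prod>i=1..n. pd \<beta> t0 (Y i))" .
      define Q where "Q = (\<Prod>i=1..n. pd \<beta> t0 (Y i))"
      have Q: "Q \<ge> 0" unfolding Q_def using pd_pos by (intro prod_nonneg) (auto intro: less_imp_le)
      define cd where "cd = card (\<Theta> \<beta>)"
      have cd: "cd > 0" "cd \<le> N n \<beta>"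
        unfolding cd_def using fin[of \<beta>] ne[OF beta] card_image_le[of "{1..N n \<beta>}" "\<theta> n \<beta>"] by (auto simp: card_gt_0_iff \<Theta>_def)
      have "k * (\<Prod>i=1..n. p0 (Y i)) = w \<beta> * (exp (- \<kappa>) * (\<Prod>i=1..n. p0 (Y i)) / real (N n \<beta>))" unfolding k_def by simp
      also have "\<dots> \<le> w \<beta> * (Q / real (N n \<beta>))"
        using L wpos[OF beta] unfolding Q_def by (intro mult_left_mono divide_right_mono) auto
      also have "\<dots> \<le> w \<beta> * (Q / real cd)"
        using cd Q wpos[OF beta] by (intro mult_left_mono divide_left_mono) auto
      finally have "ennreal (k * (\<Prod>i=1..n. p0 (Y i))) \<le> ennreal (w \<beta> * (Q / real cd))" by (rule ennreal_leI)
      also have "\<dots> = ennreal (w \<beta>) * (ennreal Q / of_nat cd)"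
        using wpos[OF beta] Q cd by (simp add: ennreal_mult[symmetric] divide_ennreal ennreal_of_nat_eq_real_of_nat)
      also have "\<dots> \<le> ennreal (w \<beta>) * ((\<Sum>t\<in>\<Theta> \<beta>. ennreal (\<Prod>i=1..n. pd \<beta> t (Y i)) * indicator UNIV (pd \<beta> t)) / of_nat (card (\<Theta> \<beta>)))"
        unfolding cd_def Q_def using fin[of \<beta>] t0
        by (intro mult_left_mono divide_right_mono_ennreal order_trans[OF _ member_le_sum[of t0]]) auto
      also have "(\<Sum>t\<in>\<Theta> \<beta>. ennreal (\<Prod>i=1..n. pd \<beta> t (Y i)) * indicator UNIV (pd \<beta> t)) / of_nat (card (\<Theta> \<beta>))
        = (\<integral>\<^sup>+p\<in>UNIV. ennreal (\<Prod>i=1..n. p (Y i)) \<partial>measure_pmf (Pr \<beta>))"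
        unfolding Pr_def pd_def by (rule nn_integral_sieve_prior[OF fin ne[OF beta], symmetric])
      also have "ennreal (w \<beta>) * \<dots> \<le> weighted_likelihood I w Pr n Y UNIV"
        unfolding weighted_likelihood_def by (rule nn_integral_ge_point[OF usable])
      finally show ?thesis .
    qed

    \<comment> \<open>Comparison with the evidence and summation over the models\<close>
    have ratio: "w \<alpha> * c \<alpha> / k \<le> \<mu> \<alpha> * (exp (- x n) / \<mu> \<beta>)" if \<alpha>: "\<alpha> \<in> I" for \<alpha>
    proof -
      have \<alpha>': "\<alpha> \<in> pos_rats" using \<alpha> I_sub by auto
      define xa where "xa = real n powr (1 / (2 * \<alpha> + 1))"
      have wa: "w \<alpha> = \<mu> \<alpha> * exp (- C * xa) / Z" unfolding w_def Z(2) rate_square[OF n Ipos[OF \<alpha>]] xa_def ..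
      have wb: "w \<beta> = \<mu> \<beta> * exp (- C * x n) / Z" unfolding w_def Z(2) rate_square[OF n \<beta>0] x_def ..
      have cc: "exp (- C * xa) * c \<alpha> \<le> exp (- G * x n)"
      proof (cases "smooth \<alpha>")
        case True
        have "exp (- C * xa) \<le> 1" unfolding xa_def using \<open>C > 0\<close> by simp
        hence "exp (- C * xa) * exp (- G * x n) \<le> 1 * exp (- G * x n)" by (intro mult_right_mono) auto
        thus ?thesis unfolding c_def using True by simp
      next
        case False
        hence "H * x n \<le> xa" unfolding smooth_def xa_def by simp
        hence "C * (H * x n) \<le> C * xa" using \<open>C > 0\<close> by (intro mult_left_mono) auto
        moreover have "G * x n \<le> C * H * x n" using H(2) x1 by (intro mult_right_mono) auto
        ultimately show ?thesis unfolding c_def using False by (simp add: mult.assoc)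
      qed
      have "w \<alpha> * c \<alpha> / k = \<mu> \<alpha> / \<mu> \<beta> * (real (N n \<beta>) * (exp \<kappa> * (exp (C * x n) * (exp (- C * xa) * c \<alpha>))))"
        unfolding k_def wa wb using Z(1) mu_pos[OF beta] Npos by (simp add: exp_minus field_simps)
      also have "\<dots> \<le> \<mu> \<alpha> / \<mu> \<beta> * (exp (K1 * x n) * (exp \<kappa> * (exp (C * x n) * exp (- G * x n))))"
        using NK cc mu_pos[OF beta] mu_pos[OF \<alpha>'] by (intro mult_left_mono mult_mono) (auto simp: c_def)
      \<comment> \<open>By the choice of \<open>G\<close> the exponents add up to exactly
        \<open>- x n\<close>.\<close>
      also have "exp (K1 * x n) * (exp \<kappa> * (exp (C * x n) * exp (- G * x n))) = exp (- x n)"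
        unfolding \<kappa>_def G_def by (simp add: algebra_simps flip: exp_add)
      finally show ?thesis by simp
    qed
    have "(\<integral>\<^sup>+Y. posterior I w Pr n Y S \<partial>?P)
      \<le> emeasure ?P A + ennreal (1 / k) * (\<integral>\<^sup>+\<alpha>. ennreal (w \<alpha>) * (\<integral>\<^sup>+Y. v \<alpha> Y \<partial>?P) \<partial>count_space I)"
      by (rule posterior_expectation_bound[OF p0d cI Am k den num vm p0_prob])
    also have "ennreal (1 / k) * (\<integral>\<^sup>+\<alpha>. ennreal (w \<alpha>) * (\<integral>\<^sup>+Y. v \<alpha> Y \<partial>?P) \<partial>count_space I)
      = (\<integral>\<^sup>+\<alpha>. ennreal (1 / k) * (ennreal (w \<alpha>) * (\<integral>\<^sup>+Y. v \<alpha> Y \<partial>?P)) \<partial>count_space I)"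
      by (rule nn_integral_cmult[symmetric]) simp
    also have "\<dots> \<le> (\<integral>\<^sup>+\<alpha>. ennreal (exp (- x n) / \<mu> \<beta>) * ennreal (\<mu> \<alpha>) \<partial>count_space I)"
    proof (rule nn_integral_mono)
      fix \<alpha> assume "\<alpha> \<in> space (count_space I)"
      hence \<alpha>: "\<alpha> \<in> I" by simp
      hence \<alpha>': "\<alpha> \<in> pos_rats" using I_sub by auto
      have c0: "c \<alpha> \<ge> 0" unfolding c_def by simp
      have "ennreal (1 / k) * (ennreal (w \<alpha>) * (\<integral>\<^sup>+Y. v \<alpha> Y \<partial>?P)) \<le> ennreal (1 / k) * (ennreal (w \<alpha>) * ennreal (c \<alpha>))"
        using vi[OF \<alpha>] by (intro mult_left_mono) auto
      also have "\<dots> = ennreal (w \<alpha> * c \<alpha> / k)"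
        using k wpos[OF \<alpha>'] c0 by (simp flip: ennreal_mult)
      also have "\<dots> \<le> ennreal (\<mu> \<alpha> * (exp (- x n) / \<mu> \<beta>))" by (rule ennreal_leI[OF ratio[OF \<alpha>]])
      also have "\<dots> = ennreal (exp (- x n) / \<mu> \<beta>) * ennreal (\<mu> \<alpha>)"
        using mu_pos[OF beta] mu_pos[OF \<alpha>'] by (simp add: mult.commute flip: ennreal_mult)
      finally show "ennreal (1 / k) * (ennreal (w \<alpha>) * (\<integral>\<^sup>+Y. v \<alpha> Y \<partial>?P)) \<le> ennreal (exp (- x n) / \<mu> \<beta>) * ennreal (\<mu> \<alpha>)" .
    qed
    also have "\<dots> = ennreal (exp (- x n) / \<mu> \<beta>) * (\<integral>\<^sup>+\<alpha>. ennreal (\<mu> \<alpha>) \<partial>count_space I)"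
      by (rule nn_integral_cmult) simp
    also have "(\<integral>\<^sup>+\<alpha>. ennreal (\<mu> \<alpha>) \<partial>count_space I) \<le> (\<integral>\<^sup>+\<alpha>. ennreal (\<mu> \<alpha>) \<partial>count_space pos_rats)"
    proof -
      have "(\<integral>\<^sup>+\<alpha>. ennreal (\<mu> \<alpha>) * indicator I \<alpha> \<partial>count_space UNIV) \<le> (\<integral>\<^sup>+\<alpha>. ennreal (\<mu> \<alpha>) * indicator pos_rats \<alpha> \<partial>count_space UNIV)"
        using I_sub by (intro nn_integral_mono mult_left_mono) (auto simp: indicator_def)
      thus ?thesis by (simp add: nn_integral_count_space_indicator)
    qed
    finally have "(\<integral>\<^sup>+Y. posterior I w Pr n Y S \<partial>?P) \<le> emeasure ?P A + ennreal (exp (- x n) / \<mu> \<beta>) * ennreal K"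
      unfolding K(2) by (simp add: add_left_mono mult_left_mono)
    also have "\<dots> \<le> ennreal ((H * x n + 1)\<^sup>2 * (4 * exp (- (r * B\<^sup>2) * x n)) + exp (- x n)) + ennreal (exp (- x n) / \<mu> \<beta>) * ennreal K"
      using Ae by (rule add_right_mono)
    also have "\<dots> = ennreal (((H * x n + 1)\<^sup>2 * (4 * exp (- (r * B\<^sup>2) * x n)) + exp (- x n)) + exp (- x n) / \<mu> \<beta> * K)"
      using K(1) mu_pos[OF beta] by (subst ennreal_mult[symmetric]) (auto simp: ennreal_plus intro!: add_nonneg_nonneg)
    also have "((H * x n + 1)\<^sup>2 * (4 * exp (- (r * B\<^sup>2) * x n)) + exp (- x n)) + exp (- x n) / \<mu> \<beta> * K = bound (x n)"
      unfolding bound_def by (simp add: distrib_right)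
    finally show ?thesis unfolding I_def w_def Pr_def S_def dm_def \<Theta>_def .
  qed

  \<comment> \<open>Passage to the limit\<close>
  have xlim: "filterlim x at_top sequentially"
    unfolding x_def[abs_def] using \<beta>0
    by (intro filterlim_compose[OF powr_at_top_lim filterlim_real_sequentially]) auto
  have "((\<lambda>y. bound y) \<longlongrightarrow> 0) at_top"
    unfolding bound_def using r B by (intro polynomial_exp_limit) auto
  hence "(\<lambda>n. bound (x n)) \<longlonglongrightarrow> 0" by (rule filterlim_compose[OF _ xlim])
  hence lim: "(\<lambda>n. ennreal (bound (x n))) \<longlonglongrightarrow> ennreal 0" by (rule tendsto_ennrealI)
  have ev: "\<forall>\<^sub>F n in sequentially. (\<integral>\<^sup>+X. posterior (usable_indices q n) (model_weight C \<mu> n)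
              (\<lambda>\<alpha>. sieve_prior (q \<alpha>) (spline_dim n \<alpha>) (\<theta> n \<alpha> ` {1..N n \<alpha>}))
              n X {p. hellinger p p0 \<ge> B * rate n \<beta>}
            \<partial>iid_sample p0 n) \<le> ennreal (bound (x n))"
    using filterlim_at_top[THEN iffD1, OF xlim, rule_format, of "real (q \<beta>) + 1"] eventually_ge_at_top[of 1]
    by eventually_elim (rule main)
  show ?thesis
  proof (rule exI[of _ B], rule tendsto_sandwich[OF _ ev tendsto_const])
    show "(\<lambda>n. ennreal (bound (x n))) \<longlonglongrightarrow> 0" using lim by simp
  qed simp
qed

end
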